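(* The variety $\mathsf{V}(S_7^0)$ has exactly fifteen finitely based subvarieties, namely \[ \begin{gathered} \mathbf T,\quad \mathsf{V}(D_2),\quad \mathsf{V}(M_2),\quad \mathsf{V}(M_2,D_2),\quad \mathsf{V}(M_2^0),\\ \mathsf{V}(T_2),\quad \mathsf{V}(T_2,D_2),\quad \mathsf{V}(T_2^0),\quad \mathsf{V}(S_c(ab)),\\ \mathsf{V}(M_2,T_2),\quad \mathsf{V}(M_2,T_2,D_2),\quad \mathsf{V}(M_2^0,T_2),\quad \mathsf{V}(M_2,T_2^0),\quad \mathsf{V}(M_2^0,T_2^0),\\ \mathsf{V}(M_2,S_c(ab)). \end{gathered} \] Every other subvariety of $\mathsf{V}(S_7^0)$ is nonfinitely based.
   Context: An ai-semiring is an algebra $(S,+,\cdot)$ such that $(S,+)$ is a commutative idempotent semigroup, $(S,\cdot)$ is a semigroup, and multiplication distributes over addition on both sides; it is commutative if $\cdot$ is commutative. $\mathsf{V}(S_1,\dots,S_k)$ denotes the variety generated by $S_1,\dots,S_k$, and $\mathbf T$ is the trivial variety. A variety is finitely based if it can be defined by a finite set of identities, and nonfinitely based otherwise. Two-element ai-semirings on $\{0,1\}$, all with addition $x+y=\max(x,y)$: $M_2$ has $xy=\max(x,y)$; $D_2$ has $xy=\min(x,y)$; $T_2$ has $xy=1$ for all $x,y$. $S_7=\{1,a,\infty\}$ is the commutative ai-semiring with $x+x=x$, $x+y=\infty$ if $x\ne y$, and $1\cdot x=x$ for all $x$, $a\cdot a=\infty$, $\infty\cdot x=\infty$ for all $x$.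 For a nonempty word $\mathbf w$ in the free commutative semigroup, $S_c(\mathbf w)$ is the set of all nonempty divisors of $\mathbf w$ together with a new element $\infty$; addition is $u+u=u$ and $u+v=\infty$ for $u\neq v$; the product of two divisors $u,v$ is $uv$ if $uv$ divides $\mathbf w$ and $\infty$ otherwise; and $\infty$ is absorbing for both operations. Thus $S_c(ab)=\{a,b,ab,\infty\}$ with $a,b$ distinct letters. For an ai-semiring $S$, $S^0$ denotes $S\cup\{0\}$, where $0$ is a new element with $0+s=s+0=s$ and $0s=s0=0$ for all $s\in S\cup\{0\}$. *)

theory Defs
  imports "HOL-Library.FuncSet" "HOL-Library.Multiset"
begin

section \<open>Ai-semirings\<close>

record 'a alg =
  elems :: "'a set"
  sadd :: "'a \<Rightarrow> 'a \<Rightarrow> 'a"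
  smul :: "'a \<Rightarrow> 'a \<Rightarrow> 'a"

definition ai_semiring :: "'a alg \<Rightarrow> bool" where
  "ai_semiring S \<longleftrightarrow>
     elems S \<noteq> {} \<and>
     (\<forall>x\<in>elems S. \<forall>y\<in>elems S. sadd S x y \<in> elems S \<and> smul S x y \<in> elems S) \<and>
     (\<forall>x\<in>elems S. \<forall>y\<in>elems S. \<forall>z\<in>elems S.
        sadd S (sadd S x y) z = sadd S x (sadd S y z) \<and>
        smul S (smul S x y) z = smul S x (smul S y z) \<and>
        smul S x (sadd S y z) = sadd S (smul S x y) (smul S x z) \<and>
        smul S (sadd S x y) z = sadd S (smul S x z) (smul S y z)) \<and>
     (\<forall>x\<in>elems S. \<forall>y\<in>elems S. sadd S x y = sadd S y x) \<and>
     (\<forall>x\<in>elems S. sadd S x x = x)"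

definition alg_hom :: "'a alg \<Rightarrow> 'b alg \<Rightarrow> ('a \<Rightarrow> 'b) set" where
  "alg_hom A B = {h. h ` elems A \<subseteq> elems B \<and>
     (\<forall>x\<in>elems A. \<forall>y\<in>elems A.
        h (sadd A x y) = sadd B (h x) (h y) \<and> h (smul A x y) = smul B (h x) (h y))}"

definition alg_prod :: "'i set \<Rightarrow> ('i \<Rightarrow> 'a alg) \<Rightarrow> ('i \<Rightarrow> 'a) alg" where
  "alg_prod I A =
     \<lparr>elems = (\<Pi>\<^sub>E i\<in>I. elems (A i)),
      sadd = (\<lambda>f g. \<lambda>i\<in>I. sadd (A i) (f i) (g i)),
      smul = (\<lambda>f g. \<lambda>i\<in>I. smul (A i) (f i) (g i))\<rparr>"

section \<open>Varieties\<close>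

text \<open>
  A variety is a class of ai-semirings closed under homomorphic images, subalgebras and
  arbitrary products. Classes are represented by their members with carrier in a fixed
  type \<open>'u\<close>. For infinite \<open>'u\<close> nothing is lost, since a variety is determined by its
  countable members. A product of members need not fit into \<open>'u\<close>, so closure under
  subalgebras and products is stated jointly, for the algebras over \<open>'u\<close> that embed
  into a product; a single factor gives subalgebras, and the empty product gives the
  one-element algebras. Index sets in \<open>'u\<close> suffice: if \<open>'u\<close> is infinite, the elements of
  an algebra over \<open>'u\<close> that embeds into a product are already separated by at most
  \<open>|'u|\<close> of the factors.
\<close>

definition variety :: "'u alg set \<Rightarrow> bool" where
  "variety W \<longleftrightarrow>
     (\<forall>A\<in>W. ai_semiring A) \<and>
     (\<forall>A\<in>W. \<forall>B. \<forall>h\<in>alg_hom A B. h ` elems A = elems B \<longrightarrow> B \<in> W) \<and>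
     (\<forall>(I :: 'u set) A. (\<forall>i\<in>I. A i \<in> W) \<longrightarrow>
        (\<forall>B. \<forall>h\<in>alg_hom B (alg_prod I A).
           ai_semiring B \<and> inj_on h (elems B) \<longrightarrow> B \<in> W))"

definition Vgen :: "'u alg set \<Rightarrow> 'u alg set" where
  "Vgen K = \<Inter>{W. variety W \<and> K \<subseteq> W}"

definition copies :: "'b alg \<Rightarrow> 'u alg set" where
  "copies S = {A. ai_semiring A \<and> (\<exists>h\<in>alg_hom A S. bij_betw h (elems A) (elems S))}"

definition trivial_variety :: "'u alg set" where
  "trivial_variety = {A. ai_semiring A \<and> (\<exists>x. elems A = {x})}"

definition subvariety :: "'u alg set \<Rightarrow> 'u alg set \<Rightarrow> bool" where
  "subvariety W V \<longleftrightarrow> variety W \<and> variety V \<and> W \<subseteq> V"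

section \<open>Identities\<close>

datatype tm = Var nat | Sum tm tm | Prod tm tm

primrec eval_tm :: "'a alg \<Rightarrow> (nat \<Rightarrow> 'a) \<Rightarrow> tm \<Rightarrow> 'a" where
  "eval_tm S v (Var n) = v n"
| "eval_tm S v (Sum s t) = sadd S (eval_tm S v s) (eval_tm S v t)"
| "eval_tm S v (Prod s t) = smul S (eval_tm S v s) (eval_tm S v t)"

definition satisfies :: "'a alg \<Rightarrow> tm \<times> tm \<Rightarrow> bool" where
  "satisfies S e \<longleftrightarrow> (\<forall>v. range v \<subseteq> elems S \<longrightarrow> eval_tm S v (fst e) = eval_tm S v (snd e))"

text \<open>
  The ai-semiring axioms are finitely many identities, so it makes no difference that they
  are presupposed rather than counted as part of the basis.
\<close>

definition finitely_based :: "'u alg set \<Rightarrow> bool" where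
  "finitely_based W \<longleftrightarrow>
     (\<exists>E. finite E \<and> W = {A. ai_semiring A \<and> (\<forall>e\<in>E. satisfies A e)})"

definition nonfinitely_based :: "'u alg set \<Rightarrow> bool" where
  "nonfinitely_based W \<longleftrightarrow> \<not> finitely_based W"

section \<open>The generating algebras\<close>

definition M2 :: "nat alg" where
  "M2 = \<lparr>elems = {0, 1}, sadd = max, smul = max\<rparr>"

definition D2 :: "nat alg" where
  "D2 = \<lparr>elems = {0, 1}, sadd = max, smul = min\<rparr>"

definition T2 :: "nat alg" where
  "T2 = \<lparr>elems = {0, 1}, sadd = max, smul = (\<lambda>x y. 1)\<rparr>"

datatype s7 = S7_one | S7_a | S7_inf

definition S7 :: "s7 alg" where
  "S7 = \<lparr>elems = UNIV,
         sadd = (\<lambda>x y. if x = y then x else S7_inf),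
         smul = (\<lambda>x y. if x = S7_one then y else if y = S7_one then x else S7_inf)\<rparr>"

text \<open>
  Elements of the free commutative semigroup are nonempty multisets of letters, with union
  as multiplication and inclusion as divisibility; \<open>None\<close> is the element \<open>\<infinity>\<close>.
\<close>

definition Sc :: "'l multiset \<Rightarrow> 'l multiset option alg" where
  "Sc w = \<lparr>elems = insert None (Some ` {u. u \<noteq> {#} \<and> u \<subseteq># w}),
           sadd = (\<lambda>x y. if x = y then x else None),
           smul = (\<lambda>x y. case (x, y) of
                     (Some u, Some v) \<Rightarrow> if u + v \<subseteq># w then Some (u + v) else None
                   | _ \<Rightarrow> None)\<rparr>"

datatype letter = La | Lb

definition Sc_ab :: "letter multiset option alg" where
  "Sc_ab = Sc {#La, Lb#}"

text \<open>Here \<open>None\<close> is the new element \<open>0\<close>.\<close>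

definition adjoin_zero :: "'a alg \<Rightarrow> 'a option alg" where
  "adjoin_zero S =
     \<lparr>elems = insert None (Some ` elems S),
      sadd = (\<lambda>x y. case (x, y) of
                (Some u, Some v) \<Rightarrow> Some (sadd S u v)
              | (None, _) \<Rightarrow> y
              | (_, None) \<Rightarrow> x),
      smul = (\<lambda>x y. case (x, y) of
                (Some u, Some v) \<Rightarrow> Some (smul S u v)
              | _ \<Rightarrow> None)\<rparr>"

end

theory Submission
  imports Defs "HOL-Library.Z2"
begin

text \<open>
  An identity of commutative ai-semirings amounts to inequalities \<open>w \<le> \<Sum>S\<close> between a word \<open>w\<close> and a finite
  set \<open>S\<close> of words, where words are multisets of letters. The inequalities valid in a class \<open>W\<close> form a
  consequence relation \<open>Ent W\<close>, and by Birkhoff's theorem (\<open>birkhoff\<close>) a variety is determined by it.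

  Each of the algebras \<open>X = D\<^sub>2, M\<^sub>2, T\<^sub>2, M\<^sub>2\<^sup>0, T\<^sub>2\<^sup>0, S\<^sub>c(ab)\<close> comes with a law that splits the lattice of
  subvarieties of \<open>V(S\<^sub>7\<^sup>0)\<close>: a subvariety obeys the law or contains \<open>X\<close>. Indeed a valuation in \<open>X\<close>
  refuting a consequence of a subvariety, read as a substitution, turns this consequence into the law
  (\<open>split_ent\<close>, \<open>pair_rigid\<close>). The same argument applies to \<open>S\<^sub>c(abc)\<close> and \<open>law_ABC\<close> (\<open>triple_rigid\<close>).

  A subvariety is called tame if it obeys \<open>law_AB\<close>, the law split by \<open>S\<^sub>c(ab)\<close>, or both \<open>law_ABC\<close> and
  the path law \<open>xw \<le> xy + yz + zw\<close>. Tame subvarieties are determined by which of the six laws they obey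
  (\<open>tame_determined\<close>): whatever holds in all the algebras \<open>X\<close> that they contain is derived from the laws of
  the remaining ones and a few laws of \<open>S\<^sub>7\<^sup>0\<close>. Hence they are finitely based, by the laws that they
  obey, and the implications between the laws leave fifteen possibilities, all realized by the list.

  The other subvarieties are not finitely based. For every \<open>k\<close> there is a finite algebra that satisfies
  their identities in \<open>k\<close> letters, yet violates an identity of \<open>S\<^sub>7\<^sup>0\<close>. If \<open>law_AB\<close> and the path law fail,
  it is made from a long odd cycle: the identity expresses that no set of vertices meets every edge
  exactly once, while all small subgraphs are bipartite. If \<open>law_ABC\<close> fails, it is made from a
  hypergraph with edges of size three, again without a set of vertices meeting every edge
  exactly once, whose small subhypergraphs are forests. Such hypergraphs arise from a finite 2-group
  in which three involutions satisfy no short nontrivial relations: every vertex lies on three edges,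
  and the number of edges is not divisible by three (\<open>local_forest_without_exact_transversal\<close>).
\<close>

section \<open>Identities and varieties\<close>

lemma ai_closed:
  assumes "ai_semiring A" "x \<in> elems A" "y \<in> elems A"
  shows "sadd A x y \<in> elems A" "smul A x y \<in> elems A"
  using assms unfolding ai_semiring_def by blast+

lemma ai_laws:
  assumes "ai_semiring A" "x \<in> elems A" "y \<in> elems A" "z \<in> elems A"
  shows "sadd A (sadd A x y) z = sadd A x (sadd A y z)"
    "smul A (smul A x y) z = smul A x (smul A y z)"
    "smul A x (sadd A y z) = sadd A (smul A x y) (smul A x z)"
    "smul A (sadd A x y) z = sadd A (smul A x z) (smul A y z)"
  using assms unfolding ai_semiring_def by blast+

lemma ai_add:
  assumes "ai_semiring A" "x \<in> elems A"
  shows "sadd A x x = x" "y \<in> elems A \<Longrightarrow> sadd A x y = sadd A y x"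
  using assms unfolding ai_semiring_def by blast+

lemma eval_closed:
  assumes "ai_semiring A" "range v \<subseteq> elems A"
  shows "eval_tm A v t \<in> elems A"
  using assms by (induction t) (auto simp: ai_closed)

lemma eval_hom:
  assumes "ai_semiring A" "h \<in> alg_hom A B" "range v \<subseteq> elems A"
  shows "h (eval_tm A v t) = eval_tm B (h \<circ> v) t"
  using assms(2) eval_closed[OF assms(1,3)] by (induction t) (auto simp: alg_hom_def)

lemma ai_semiring_image:
  assumes A: "ai_semiring A" and h: "h \<in> alg_hom A B" and onto: "h ` elems A = elems B"
  shows "ai_semiring B"
proof -
  have *: "sadd B (h x) (h y) = h (sadd A x y) \<and> smul B (h x) (h y) = h (smul A x y)"
    if "x \<in> elems A" "y \<in> elems A" for x y using h that unfolding alg_hom_def by auto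
  have cl: "sadd A x y \<in> elems A \<and> smul A x y \<in> elems A"
    if "x \<in> elems A" "y \<in> elems A" for x y using ai_closed[OF A] that by auto
  have "elems A \<noteq> {}" using A unfolding ai_semiring_def by blast
  then show ?thesis
    unfolding ai_semiring_def onto[symmetric]
    apply (auto simp: * cl ai_laws[OF A] ai_add(1)[OF A])
    by (simp add: ai_add(2)[OF A])
qed

lemma ai_semiring_embed:
  assumes P: "ai_semiring P" and k: "k \<in> alg_hom B P" "inj_on k (elems B)"
    and ne: "elems B \<noteq> {}"
    and cl: "\<And>x y. x \<in> elems B \<Longrightarrow> y \<in> elems B \<Longrightarrow> sadd B x y \<in> elems B \<and> smul B x y \<in> elems B"
  shows "ai_semiring B"
proof -
  have hom: "k (sadd B x y) = sadd P (k x) (k y)" "k (smul B x y) = smul P (k x) (k y)" "k x \<in> elems P"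
    if "x \<in> elems B" "y \<in> elems B" for x y using k that unfolding alg_hom_def by auto
  have inj: "x = y" if "k x = k y" "x \<in> elems B" "y \<in> elems B" for x y
    using k(2) that by (meson inj_onD)
  have "sadd B (sadd B x y) z = sadd B x (sadd B y z) \<and> smul B (smul B x y) z = smul B x (smul B y z)
    \<and> smul B x (sadd B y z) = sadd B (smul B x y) (smul B x z)
    \<and> smul B (sadd B x y) z = sadd B (smul B x z) (smul B y z)"
    if "x \<in> elems B" "y \<in> elems B" "z \<in> elems B" for x y z
    by (intro conjI inj) (use that in \<open>simp_all add: hom cl ai_laws[OF P]\<close>)
  moreover have "sadd B x y = sadd B y x" if "x \<in> elems B" "y \<in> elems B" for x y
    by (intro inj) (use that ai_add(2)[OF P] in \<open>simp_all add: hom cl\<close>)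
  moreover have "sadd B x x = x" if "x \<in> elems B" for x
    by (intro inj) (use that in \<open>simp_all add: hom cl ai_add(1)[OF P]\<close>)
  ultimately show ?thesis using ne cl unfolding ai_semiring_def by auto
qed

lemma ai_semiring_prod:
  fixes A :: "'i \<Rightarrow> 'a alg"
  assumes "\<And>i. i \<in> I \<Longrightarrow> ai_semiring (A i)"
  shows "ai_semiring (alg_prod I A)"
proof -
  have ne: "(\<Pi>\<^sub>E i\<in>I. elems (A i)) \<noteq> {}"
    using assms unfolding PiE_eq_empty_iff ai_semiring_def by blast
  have m: "f i \<in> elems (A i)" if "f \<in> (\<Pi>\<^sub>E i\<in>I. elems (A i))" "i \<in> I" for f i
    using that by (auto simp: PiE_iff)
  have e: "f i = undefined" if "f \<in> (\<Pi>\<^sub>E i\<in>I. elems (A i))" "i \<notin> I" for f i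
    using that by (auto simp: PiE_iff extensional_def)
  let ?P = "\<Pi>\<^sub>E i\<in>I. elems (A i)"
  have cl: "(\<lambda>i\<in>I. sadd (A i) (f i) (g i)) \<in> ?P" "(\<lambda>i\<in>I. smul (A i) (f i) (g i)) \<in> ?P"
    if "f \<in> ?P" "g \<in> ?P" for f g using that by (auto simp: PiE_iff ai_closed assms)
  have eq: "(\<lambda>i\<in>I. F i) = (\<lambda>i\<in>I. G i)" if "\<And>i. i \<in> I \<Longrightarrow> F i = G i" for F G :: "'i \<Rightarrow> 'a"
    using that by (auto simp: fun_eq_iff)
  have idem: "(\<lambda>i\<in>I. sadd (A i) (f i) (f i)) = f" if "f \<in> ?P" for f
    by (rule ext) (use that in \<open>auto simp: restrict_def m e ai_add(1) assms\<close>)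
  show ?thesis
    unfolding ai_semiring_def alg_prod_def alg.simps
    by (intro conjI ballI; (rule ne cl eq; assumption?)?; (simp add: idem)?)
      (simp_all add: assms m ai_laws ai_add(2))
qed

lemma prod_component_hom:
  assumes "k \<in> alg_hom B (alg_prod I A)" "i \<in> I"
  shows "(\<lambda>x. k x i) \<in> alg_hom B (A i)"
  using assms unfolding alg_hom_def alg_prod_def by (auto simp: PiE_iff image_subset_iff)

lemma satisfies_image:
  assumes A: "ai_semiring A" and h: "h \<in> alg_hom A B" and onto: "h ` elems A = elems B"
    and sat: "satisfies A e"
  shows "satisfies B e"
  unfolding satisfies_def
proof (intro allI impI)
  fix v :: "nat \<Rightarrow> _" assume v: "range v \<subseteq> elems B"
  define v' where "v' n = (SOME x. x \<in> elems A \<and> h x = v n)" for n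
  have v': "v' n \<in> elems A \<and> h (v' n) = v n" for n
    unfolding v'_def by (rule someI_ex) (use v onto in \<open>metis image_iff rangeI subsetD\<close>)
  then have "h \<circ> v' = v" "range v' \<subseteq> elems A" by auto
  then show "eval_tm B v (fst e) = eval_tm B v (snd e)"
    using eval_hom[OF A h] sat unfolding satisfies_def by metis
qed

lemma satisfies_embed_prod:
  assumes B: "ai_semiring B" and k: "k \<in> alg_hom B (alg_prod I A)" "inj_on k (elems B)"
    and sat: "\<And>i. i \<in> I \<Longrightarrow> satisfies (A i) e"
  shows "satisfies B e"
  unfolding satisfies_def
proof (intro allI impI)
  fix v :: "nat \<Rightarrow> _" assume v: "range v \<subseteq> elems B"
  let ?l = "eval_tm B v (fst e)" and ?r = "eval_tm B v (snd e)"
  have el: "?l \<in> elems B" "?r \<in> elems B" using eval_closed[OF B v] by auto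
  have "k ?l i = k ?r i" if i: "i \<in> I" for i
  proof -
    note h = prod_component_hom[OF k(1) i]
    have "range ((\<lambda>x. k x i) \<circ> v) \<subseteq> elems (A i)" using h v unfolding alg_hom_def by auto
    then show ?thesis using eval_hom[OF B h v] sat[OF i] unfolding satisfies_def by metis
  qed
  moreover have "k ?l \<in> extensional I" "k ?r \<in> extensional I"
    using k(1) el unfolding alg_hom_def alg_prod_def by (auto simp: PiE_def image_subset_iff)
  ultimately have "k ?l = k ?r" by (meson extensionalityI)
  then show "?l = ?r" using k(2) el by (meson inj_onD)
qed

definition models :: "(tm \<times> tm) set \<Rightarrow> 'a alg set" where
  "models E = {A. ai_semiring A \<and> (\<forall>e\<in>E. satisfies A e)}"

lemma variety_models: "variety (models E)"
  unfolding variety_def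
proof (intro conjI ballI allI impI)
  fix A :: "'a alg" assume "A \<in> models E" then show "ai_semiring A" unfolding models_def by blast
next
  fix A B :: "'a alg" and h assume "A \<in> models E" "h \<in> alg_hom A B" "h ` elems A = elems B"
  then show "B \<in> models E"
    using ai_semiring_image[of A h B] satisfies_image[of A h B] by (simp add: models_def)
next
  fix I :: "'a set" and A and B :: "'a alg" and h
  assume "\<forall>i\<in>I. A i \<in> models E" "h \<in> alg_hom B (alg_prod I A)" "ai_semiring B \<and> inj_on h (elems B)"
  then show "B \<in> models E" using satisfies_embed_prod[of B h I A] by (simp add: models_def)
qed

lemma variety_ai: "variety W \<Longrightarrow> A \<in> W \<Longrightarrow> ai_semiring A"
  unfolding variety_def by blast

lemma variety_image:
  assumes "variety W" "A \<in> W" "h \<in> alg_hom A B" "h ` elems A = elems B"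
  shows "B \<in> W"
proof -
  have "\<forall>A\<in>W. \<forall>B. \<forall>h\<in>alg_hom A B. h ` elems A = elems B \<longrightarrow> B \<in> W"
    using assms(1) unfolding variety_def by (elim conjE)
  from this[rule_format, OF assms(2-4)] show ?thesis .
qed

lemma variety_embed:
  fixes W :: "'u alg set" and I :: "'u set"
  assumes "variety W" "\<And>i. i \<in> I \<Longrightarrow> A i \<in> W" "h \<in> alg_hom B (alg_prod I A)"
    "ai_semiring B" "inj_on h (elems B)"
  shows "B \<in> W"
proof -
  have *: "\<forall>(I :: 'u set) A. (\<forall>i\<in>I. A i \<in> W) \<longrightarrow>
        (\<forall>B. \<forall>h\<in>alg_hom B (alg_prod I A). ai_semiring B \<and> inj_on h (elems B) \<longrightarrow> B \<in> W)"
    using assms(1) unfolding variety_def by (elim conjE)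
  show ?thesis
    by (rule *[rule_format, of I A h]) (use assms in auto)
qed

lemma variety_Vgen:
  assumes "\<And>A. A \<in> K \<Longrightarrow> ai_semiring A"
  shows "variety (Vgen K)" "K \<subseteq> Vgen K"
proof -
  show "K \<subseteq> Vgen K" unfolding Vgen_def by blast
  have "variety (models {} :: 'a alg set)" "K \<subseteq> models {}"
    by (rule variety_models) (use assms in \<open>auto simp: models_def\<close>)
  then have ne: "models {} \<in> {W. variety W \<and> K \<subseteq> W}" by blast
  show "variety (Vgen K)"
    unfolding variety_def
  proof (intro conjI ballI allI impI)
    fix A assume "A \<in> Vgen K" then show "ai_semiring A" using ne unfolding Vgen_def models_def by blast
  next
    fix A B :: "'a alg" and h
    assume *: "A \<in> Vgen K" "h \<in> alg_hom A B" "h ` elems A = elems B"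
    show "B \<in> Vgen K" unfolding Vgen_def
    proof
      fix W assume "W \<in> {W. variety W \<and> K \<subseteq> W}"
      then show "B \<in> W" using * by (intro variety_image[of W A h B]) (auto simp: Vgen_def)
    qed
  next
    fix I :: "'a set" and A and B :: "'a alg" and h
    assume *: "\<forall>i\<in>I. A i \<in> Vgen K" "h \<in> alg_hom B (alg_prod I A)"
      "ai_semiring B \<and> inj_on h (elems B)"
    show "B \<in> Vgen K" unfolding Vgen_def
    proof
      fix W assume "W \<in> {W. variety W \<and> K \<subseteq> W}"
      then show "B \<in> W" using * by (intro variety_embed[of W I A h B]) (auto simp: Vgen_def)
    qed
  qed
qed

lemma Vgen_least: "variety W \<Longrightarrow> K \<subseteq> W \<Longrightarrow> Vgen K \<subseteq> W"
  unfolding Vgen_def by blast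

definition holds_in :: "'a alg set \<Rightarrow> tm \<times> tm \<Rightarrow> bool" where
  "holds_in W e \<longleftrightarrow> (\<forall>A\<in>W. satisfies A e)"

lemma holds_in_Vgen:
  assumes "\<And>A. A \<in> K \<Longrightarrow> ai_semiring A"
  shows "holds_in (Vgen K) e \<longleftrightarrow> holds_in K e"
proof
  show "holds_in K e" if "holds_in (Vgen K) e"
    using that variety_Vgen(2)[OF assms] unfolding holds_in_def by blast
next
  assume "holds_in K e"
  then have "K \<subseteq> models {e}" using assms unfolding models_def holds_in_def by auto
  then have "Vgen K \<subseteq> models {e}" by (rule Vgen_least[OF variety_models])
  then show "holds_in (Vgen K) e" unfolding models_def holds_in_def by auto
qed

subsection \<open>Birkhoff's theorem\<close>

datatype 'v gtm = GVar 'v | GSum "'v gtm" "'v gtm" | GProd "'v gtm" "'v gtm"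

primrec eval_gtm :: "'a alg \<Rightarrow> ('v \<Rightarrow> 'a) \<Rightarrow> 'v gtm \<Rightarrow> 'a" where
  "eval_gtm S v (GVar n) = v n"
| "eval_gtm S v (GSum s t) = sadd S (eval_gtm S v s) (eval_gtm S v t)"
| "eval_gtm S v (GProd s t) = smul S (eval_gtm S v s) (eval_gtm S v t)"

primrec rename :: "('v \<Rightarrow> nat) \<Rightarrow> 'v gtm \<Rightarrow> tm" where
  "rename f (GVar n) = Var (f n)"
| "rename f (GSum s t) = Sum (rename f s) (rename f t)"
| "rename f (GProd s t) = Prod (rename f s) (rename f t)"

lemma eval_rename: "eval_tm A v (rename f t) = eval_gtm A (v \<circ> f) t"
  by (induction t) auto

lemma eval_gtm_cong: "(\<And>x. x \<in> set_gtm t \<Longrightarrow> v x = w x) \<Longrightarrow> eval_gtm A v t = eval_gtm A w t"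
  by (induction t) auto

lemma eval_gtm_closed:
  assumes "ai_semiring A" "v ` set_gtm t \<subseteq> elems A"
  shows "eval_gtm A v t \<in> elems A"
  using assms(2) by (induction t) (simp_all add: ai_closed assms(1) image_Un)

lemma finite_set_gtm: "finite (set_gtm t)"
  by (induction t) auto

text \<open>An identity over arbitrary variables involves finitely many of them, so it can be renamed
  to one over the natural numbers.\<close>

lemma separating_member:
  assumes A: "ai_semiring A" and id: "\<And>e. holds_in W e \<Longrightarrow> satisfies A e"
    and s: "set_gtm s \<subseteq> elems A" and t: "set_gtm t \<subseteq> elems A"
    and ne: "eval_gtm A (\<lambda>x. x) s \<noteq> eval_gtm A (\<lambda>x. x) t"
  shows "\<exists>C v. C \<in> W \<and> range v \<subseteq> elems C \<and> eval_gtm C v s \<noteq> eval_gtm C v t"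
proof -
  let ?X = "set_gtm s \<union> set_gtm t"
  have "finite ?X" by (simp add: finite_set_gtm)
  then obtain f :: "'a \<Rightarrow> nat" where f: "inj_on f ?X"
    using finite_imp_inj_to_nat_seg by metis
  obtain a where a: "a \<in> elems A" using A unfolding ai_semiring_def by auto
  define g where "g n = (if n \<in> f ` ?X then the_inv_into ?X f n else a)" for n
  have g: "g (f x) = x" if "x \<in> ?X" for x using f that by (simp add: g_def the_inv_into_f_f)
  have "g n \<in> elems A" for n
    using s t a the_inv_into_into[OF f, of n ?X] by (auto simp: g_def)
  then have rg: "range g \<subseteq> elems A" by auto
  have "eval_tm A g (rename f u) = eval_gtm A (\<lambda>x. x) u" if "set_gtm u \<subseteq> ?X" for u
    unfolding eval_rename by (rule eval_gtm_cong) (use that g in auto)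
  then have "\<not> satisfies A (rename f s, rename f t)"
    using rg ne unfolding satisfies_def by (metis Un_upper1 Un_upper2 fst_conv snd_conv)
  then obtain C where "C \<in> W" "\<not> satisfies C (rename f s, rename f t)"
    using id unfolding holds_in_def by blast
  then obtain v where "C \<in> W" "range v \<subseteq> elems C"
    "eval_gtm C (v \<circ> f) s \<noteq> eval_gtm C (v \<circ> f) t"
    unfolding satisfies_def by (auto simp: eval_rename)
  then show ?thesis by (intro exI[of _ C] exI[of _ "v \<circ> f"]) auto
qed

lemma infinite_pairing:
  assumes "infinite (UNIV :: 'u set)"
  shows "\<exists>j :: 'u \<times> 'u \<Rightarrow> 'u. inj j"
proof -
  obtain j :: "'u \<times> 'u \<Rightarrow> 'u" where "bij_betw j (UNIV \<times> UNIV) UNIV"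
    using card_of_Times_same_infinite[OF assms] card_of_ordIso by blast
  then show ?thesis by (auto simp: bij_betw_def)
qed

lemma gtm_coding:
  assumes inf: "infinite (UNIV :: 'u set)"
  shows "\<exists>c :: 'u gtm \<Rightarrow> 'u. inj c"
proof -
  obtain j :: "'u \<times> 'u \<Rightarrow> 'u" where j: "inj j" using infinite_pairing[OF inf] by auto
  obtain q :: "nat \<Rightarrow> 'u" where q: "inj q" using infinite_countable_subset[OF inf] by auto
  define c where "c = rec_gtm (\<lambda>x. j (q 0, x)) (\<lambda>s t a b. j (q 1, j (a, b))) (\<lambda>s t a b. j (q 2, j (a, b)))"
  have c: "c (GVar x) = j (q 0, x)" "c (GSum s t) = j (q 1, j (c s, c t))"
    "c (GProd s t) = j (q 2, j (c s, c t))" for x s t by (simp_all add: c_def)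
  have je: "j x = j y \<longleftrightarrow> x = y" for x y using j by (simp add: inj_eq)
  have qe: "q x = q y \<longleftrightarrow> x = y" for x y using q by (simp add: inj_eq)
  have "c s = c t \<Longrightarrow> s = t" for s t
  proof (induction s arbitrary: t)
    case (GVar x) then show ?case by (cases t) (auto simp: c je qe)
  next
    case (GSum s1 s2) then show ?case by (cases t) (auto simp: c je qe)
  next
    case (GProd s1 s2) then show ?case by (cases t) (auto simp: c je qe)
  qed
  then show ?thesis by (meson injI)
qed

text \<open>\<open>A\<close> is an image of the algebra that is free in \<open>W\<close> on the elements of \<open>A\<close>. Terms over an
  infinite \<open>'u\<close> are no more numerous than \<open>'u\<close>, so terms can be coded as elements of \<open>'u\<close>; the free
  algebra is realized on the codes of representatives, and it embeds into the product with one
  factor for each pair of terms that differ in \<open>A\<close>.\<close>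

theorem birkhoff:
  fixes W :: "'u alg set"
  assumes inf: "infinite (UNIV :: 'u set)" and W: "variety W"
    and A: "ai_semiring A" and id: "\<And>e. holds_in W e \<Longrightarrow> satisfies A e"
  shows "A \<in> W"
proof -
  obtain j :: "'u \<times> 'u \<Rightarrow> 'u" where j: "inj j" using infinite_pairing[OF inf] by auto
  obtain c :: "'u gtm \<Rightarrow> 'u" where c: "inj c" using gtm_coding[OF inf] by auto
  define T where "T = {t :: 'u gtm. set_gtm t \<subseteq> elems A}"
  define ev where "ev = eval_gtm A (\<lambda>x. x)"
  define I where "I = {j (c s, c t) | s t. s \<in> T \<and> t \<in> T \<and> ev s \<noteq> ev t}"
  have "\<exists>Cv. fst Cv \<in> W \<and> range (snd Cv) \<subseteq> elems (fst Cv) \<and>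
     (\<forall>s t. i = j (c s, c t) \<longrightarrow> eval_gtm (fst Cv) (snd Cv) s \<noteq> eval_gtm (fst Cv) (snd Cv) t)"
    if "i \<in> I" for i
  proof -
    obtain s t where st: "i = j (c s, c t)" "s \<in> T" "t \<in> T" "ev s \<noteq> ev t"
      using \<open>i \<in> I\<close> unfolding I_def by blast
    then obtain C v where "C \<in> W" "range v \<subseteq> elems C" "eval_gtm C v s \<noteq> eval_gtm C v t"
      using separating_member[OF A id] unfolding T_def ev_def by blast
    moreover have "s' = s \<and> t' = t" if "i = j (c s', c t')" for s' t'
      using that st(1) j c by (auto simp: inj_eq)
    ultimately show ?thesis by (intro exI[of _ "(C, v)"]) auto
  qed
  then have "\<forall>i\<in>I. \<exists>Cv. fst Cv \<in> W \<and> range (snd Cv) \<subseteq> elems (fst Cv) \<and>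
     (\<forall>s t. i = j (c s, c t) \<longrightarrow> eval_gtm (fst Cv) (snd Cv) s \<noteq> eval_gtm (fst Cv) (snd Cv) t)"
    by (rule ballI)
  from bchoice[OF this] obtain Cv where Cv: "\<forall>i\<in>I. fst (Cv i) \<in> W \<and> range (snd (Cv i)) \<subseteq> elems (fst (Cv i)) \<and>
     (\<forall>s t. i = j (c s, c t) \<longrightarrow>
        eval_gtm (fst (Cv i)) (snd (Cv i)) s \<noteq> eval_gtm (fst (Cv i)) (snd (Cv i)) t)" ..
  define C v where "C i = fst (Cv i)" and "v i = snd (Cv i)" for i
  have C: "C i \<in> W" "range (v i) \<subseteq> elems (C i)" if "i \<in> I" for i
    using bspec[OF Cv that] by (simp_all add: C_def v_def)
  have sep: "eval_gtm (C i) (v i) s \<noteq> eval_gtm (C i) (v i) t" if "i \<in> I" "i = j (c s, c t)" for i s t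
    using bspec[OF Cv that(1)] that(2) by (simp add: C_def v_def)
  define h where "h t = (\<lambda>i\<in>I. eval_gtm (C i) (v i) t)" for t
  have hev: "ev s = ev t" if "s \<in> T" "t \<in> T" "h s = h t" for s t
  proof (rule ccontr)
    assume "ev s \<noteq> ev t"
    then have "j (c s, c t) \<in> I" using that unfolding I_def by blast
    from sep[OF this refl] this fun_cong[OF that(3), of "j (c s, c t)"] show False
      by (simp add: h_def)
  qed
  define rep where "rep t = (SOME t'. t' \<in> T \<and> h t' = h t)" for t
  have rep: "rep t \<in> T \<and> h (rep t) = h t" if "t \<in> T" for t
    unfolding rep_def by (rule someI[of _ t]) (use that in auto)
  define code where "code t = c (rep t)" for t
  define dec where "dec = inv c"
  have dec: "dec (code t) = rep t" for t using c by (simp add: dec_def code_def)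
  define B where "B = \<lparr>elems = code ` T, sadd = (\<lambda>x y. code (GSum (dec x) (dec y))),
     smul = (\<lambda>x y. code (GProd (dec x) (dec y)))\<rparr>"
  have TS: "GSum s t \<in> T" "GProd s t \<in> T" if "s \<in> T" "t \<in> T" for s t
    using that unfolding T_def by auto
  have decT: "dec x \<in> T" if "x \<in> elems B" for x using that rep by (auto simp: B_def dec)
  define k where "k x = h (dec x)" for x
  have hP: "h t \<in> elems (alg_prod I C)" for t
    using C eval_gtm_closed[of "C _" "v _" t] variety_ai[OF W] unfolding h_def alg_prod_def
    by (auto simp: image_subset_iff)
  have hop: "h (GSum s t) = sadd (alg_prod I C) (h s) (h t)"
    "h (GProd s t) = smul (alg_prod I C) (h s) (h t)" for s t
    unfolding h_def alg_prod_def by (auto simp: fun_eq_iff)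
  have khom: "k \<in> alg_hom B (alg_prod I C)"
    unfolding alg_hom_def using hP rep decT TS
    by (auto simp: k_def B_def dec hop)
  have kinj: "inj_on k (elems B)"
  proof (rule inj_onI)
    fix x y assume xy: "x \<in> elems B" "y \<in> elems B" "k x = k y"
    obtain s t where st: "x = code s" "y = code t" "s \<in> T" "t \<in> T" using xy unfolding B_def by auto
    then have "h s = h t" using xy(3) rep by (simp add: k_def dec)
    then show "x = y" by (simp add: st code_def rep_def)
  qed
  obtain a where a: "a \<in> elems A" using A unfolding ai_semiring_def by auto
  then have "GVar a \<in> T" unfolding T_def by auto
  then have Bne: "elems B \<noteq> {}" unfolding B_def by auto
  have Bcl: "sadd B x y \<in> elems B \<and> smul B x y \<in> elems B" if "x \<in> elems B" "y \<in> elems B" for x y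
    using TS[OF decT decT, OF that] unfolding B_def by auto
  have BS: "ai_semiring B"
    by (rule ai_semiring_embed[OF ai_semiring_prod khom kinj Bne Bcl]) (use C variety_ai[OF W] in auto)
  have "B \<in> W"
    by (rule variety_embed[OF W C(1) khom BS kinj])
  moreover define q where "q x = ev (dec x)" for x
  have evT: "ev t \<in> elems A" if "t \<in> T" for t
    using that eval_gtm_closed[OF A, of "\<lambda>x. x" t] unfolding ev_def T_def by auto
  have evrep: "ev (rep t) = ev t" if "t \<in> T" for t using hev rep that by blast
  have qc: "q (code t) = ev t" if "t \<in> T" for t using evrep that by (simp add: q_def dec)
  have "q \<in> alg_hom B A"
    unfolding alg_hom_def
  proof (intro CollectI conjI ballI)
    show "q ` elems B \<subseteq> elems A" using evT decT by (auto simp: q_def)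
  next
    fix x y assume "x \<in> elems B" "y \<in> elems B"
    then have "dec x \<in> T" "dec y \<in> T" using decT by auto
    then show "q (sadd B x y) = sadd A (q x) (q y)" "q (smul B x y) = smul A (q x) (q y)"
      using TS qc by (simp_all add: B_def q_def ev_def)
  qed
  moreover have "q ` elems B = elems A"
  proof
    show "q ` elems B \<subseteq> elems A" using evT decT by (auto simp: q_def)
    show "elems A \<subseteq> q ` elems B"
    proof
      fix x assume "x \<in> elems A"
      then have "GVar x \<in> T" unfolding T_def by auto
      then have "q (code (GVar x)) = x" "code (GVar x) \<in> elems B" using qc by (auto simp: ev_def B_def)
      then show "x \<in> q ` elems B" by (metis imageI)
    qed
  qed
  ultimately show ?thesis using variety_image[OF W] by blast
qed

section \<open>Words and consequence\<close>

definition comm_ai :: "'a alg \<Rightarrow> bool" where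
  "comm_ai A \<longleftrightarrow> ai_semiring A \<and> (\<forall>x\<in>elems A. \<forall>y\<in>elems A. smul A x y = smul A y x)"

definition le :: "'a alg \<Rightarrow> 'a \<Rightarrow> 'a \<Rightarrow> bool" where
  "le A x y \<longleftrightarrow> sadd A x y = y"

fun prodtm :: "nat list \<Rightarrow> tm" where
  "prodtm [] = Var 0"
| "prodtm [x] = Var x"
| "prodtm (x # y # xs) = Prod (Var x) (prodtm (y # xs))"

definition wval :: "'a alg \<Rightarrow> (nat \<Rightarrow> 'a) \<Rightarrow> nat multiset \<Rightarrow> 'a" where
  "wval A v w = eval_tm A v (prodtm (sorted_list_of_multiset w))"

primrec words :: "tm \<Rightarrow> nat multiset set" where
  "words (Var n) = {{#n#}}"
| "words (Sum s t) = words s \<union> words t"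
| "words (Prod s t) = (\<lambda>(u, w). u + w) ` (words s \<times> words t)"

lemma finite_words: "finite (words t)" by (induction t) auto
lemma words_nonempty: "words t \<noteq> {}" by (induction t) auto
lemma empty_notin_words: "{#} \<notin> words t" by (induction t) auto

definition sub :: "(nat \<Rightarrow> nat multiset) \<Rightarrow> nat multiset \<Rightarrow> nat multiset" where
  "sub \<sigma> w = \<Sum>\<^sub># (image_mset \<sigma> w)"

lemma sub_simps [simp]: "sub \<sigma> {#} = {#}" "sub \<sigma> (add_mset n w) = \<sigma> n + sub \<sigma> w"
  "sub \<sigma> (u + w) = sub \<sigma> u + sub \<sigma> w"
  by (auto simp: sub_def)

lemma sub_nonempty: "(\<And>n. \<sigma> n \<noteq> {#}) \<Longrightarrow> w \<noteq> {#} \<Longrightarrow> sub \<sigma> w \<noteq> {#}"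
  by (cases w) auto

lemma nonempty_mset_induct [consumes 1, case_names single add]:
  assumes "w \<noteq> {#}" "\<And>n. P {#n#}" "\<And>n u. u \<noteq> {#} \<Longrightarrow> P u \<Longrightarrow> P (add_mset n u)"
  shows "P w"
  using assms(1)
proof (induction w)
  case (add n u) then show ?case using assms(2,3) by (cases "u = {#}") auto
qed simp

locale comm_ai_semiring =
  fixes A :: "'a alg"
  assumes comm_ai: "comm_ai A"
begin

lemma ai: "ai_semiring A" using comm_ai unfolding comm_ai_def by auto

lemmas closed = ai_closed[OF ai]
lemmas laws = ai_laws[OF ai]

lemma mul_comm: "x \<in> elems A \<Longrightarrow> y \<in> elems A \<Longrightarrow> smul A x y = smul A y x"
  using comm_ai unfolding comm_ai_def by auto

lemma le_refl: "x \<in> elems A \<Longrightarrow> le A x x" unfolding le_def using ai_add(1)[OF ai] .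

lemma le_trans:
  assumes "x \<in> elems A" "y \<in> elems A" "z \<in> elems A" "le A x y" "le A y z"
  shows "le A x z"
  using assms laws(1)[of x y z] unfolding le_def by simp

lemma le_antisym: "x \<in> elems A \<Longrightarrow> y \<in> elems A \<Longrightarrow> le A x y \<Longrightarrow> le A y x \<Longrightarrow> x = y"
  unfolding le_def using ai_add(2)[OF ai] by metis

lemma add_ub:
  assumes "x \<in> elems A" "y \<in> elems A"
  shows "le A x (sadd A x y)" "le A y (sadd A x y)"
proof -
  show "le A x (sadd A x y)"
    unfolding le_def using laws(1)[of x x y] assms ai_add(1)[OF ai] by simp
  have "sadd A y (sadd A y x) = sadd A y x"
    using laws(1)[of y y x] assms ai_add(1)[OF ai] by simp
  then show "le A y (sadd A x y)"
    unfolding le_def using ai_add(2)[OF ai] assms by metis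
qed

lemma add_least:
  assumes "x \<in> elems A" "y \<in> elems A" "z \<in> elems A" "le A x z" "le A y z"
  shows "le A (sadd A x y) z"
  using assms laws(1)[of x y z] unfolding le_def by simp

lemma mul_mono:
  assumes "x \<in> elems A" "y \<in> elems A" "z \<in> elems A" "le A y z"
  shows "le A (smul A x y) (smul A x z)"
  using assms laws(3)[of x y z] unfolding le_def by simp

context
  fixes v :: "nat \<Rightarrow> 'a"
  assumes v: "range v \<subseteq> elems A"
begin

lemma eval_cl: "eval_tm A v t \<in> elems A" by (rule eval_closed[OF ai v])

lemma eval_prodtm_Cons:
  "xs \<noteq> [] \<Longrightarrow> eval_tm A v (prodtm (x # xs)) = smul A (v x) (eval_tm A v (prodtm xs))"
  by (cases xs) auto

lemma vcl: "v x \<in> elems A" using v by auto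

lemma eval_prodtm_append:
  assumes "xs \<noteq> []" "ys \<noteq> []"
  shows "eval_tm A v (prodtm (xs @ ys)) = smul A (eval_tm A v (prodtm xs)) (eval_tm A v (prodtm ys))"
  using assms
proof (induction xs rule: prodtm.induct)
  case (2 x) then show ?case by (simp add: eval_prodtm_Cons)
next
  case (3 x y xs) then show ?case
    using laws(2)[OF vcl eval_cl eval_cl] eval_prodtm_Cons[of "(y # xs) @ ys" x] by simp
qed auto

lemma eval_prodtm_mset:
  "mset xs = mset ys \<Longrightarrow> eval_tm A v (prodtm xs) = eval_tm A v (prodtm ys)"
proof (induction xs arbitrary: ys)
  case (Cons x xs)
  then have "x \<in> set ys" by (metis list.set_intros(1) set_mset_mset)
  then obtain a b where ys: "ys = a @ x # b" by (meson split_list)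
  then have m: "mset xs = mset (a @ b)" using Cons.prems by simp
  have move: "eval_tm A v (prodtm (a @ x # b)) = eval_tm A v (prodtm (x # a @ b))"
  proof (cases "a = []")
    case a: False
    show ?thesis
    proof (cases "b = []")
      case True
      then show ?thesis
        using a eval_prodtm_append[of a "[x]"] eval_prodtm_Cons[of a x] mul_comm[OF eval_cl vcl] by simp
    next
      case b: False
      let ?a = "eval_tm A v (prodtm a)" and ?b = "eval_tm A v (prodtm b)"
      have "smul A ?a (smul A (v x) ?b) = smul A (v x) (smul A ?a ?b)"
        using laws(2)[OF eval_cl vcl eval_cl, of "prodtm a" x "prodtm b"]
          laws(2)[OF vcl eval_cl eval_cl, of x "prodtm a" "prodtm b"]
          mul_comm[OF eval_cl vcl, of "prodtm a" x] by simp
      then show ?thesis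
        using a b eval_prodtm_append[of a "x # b"] eval_prodtm_append[of a b]
          eval_prodtm_Cons[of b x] eval_prodtm_Cons[of "a @ b" x] by simp
    qed
  qed simp
  show ?case
  proof (cases "xs = []")
    case True then show ?thesis using m ys by simp
  next
    case False
    then have "a @ b \<noteq> []" using m by auto
    then show ?thesis
      unfolding ys move
      by (simp only: eval_prodtm_Cons[OF False] eval_prodtm_Cons[OF \<open>a @ b \<noteq> []\<close>] Cons.IH[OF m])
  qed
qed simp

lemma wval_mset: "wval A v (mset xs) = eval_tm A v (prodtm xs)"
  unfolding wval_def by (rule eval_prodtm_mset) simp

lemma wval_single [simp]: "wval A v {#n#} = v n"
  by (simp add: wval_def)

lemma wval_cl: "wval A v w \<in> elems A"
  unfolding wval_def by (rule eval_cl)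

lemma wval_plus: "u \<noteq> {#} \<Longrightarrow> w \<noteq> {#} \<Longrightarrow> wval A v (u + w) = smul A (wval A v u) (wval A v w)"
proof -
  assume "u \<noteq> {#}" "w \<noteq> {#}"
  moreover obtain xs ys where "u = mset xs" "w = mset ys" by (metis ex_mset)
  ultimately show ?thesis
    using wval_mset eval_prodtm_append[of xs ys] by (simp flip: mset_append)
qed

lemma wval_add: "w \<noteq> {#} \<Longrightarrow> wval A v (add_mset n w) = smul A (v n) (wval A v w)"
  using wval_plus[of "{#n#}" w] by simp

lemma words_le_eval: "w \<in> words t \<Longrightarrow> le A (wval A v w) (eval_tm A v t)"
proof (induction t arbitrary: w)
  case (Var n) then show ?case by (simp add: le_refl vcl)
next
  case (Sum s t)
  then show ?case
    using add_ub[OF eval_cl[of s] eval_cl[of t]]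
      le_trans[OF wval_cl eval_cl closed(1)[OF eval_cl[of s] eval_cl[of t]], of w]
    by auto
next
  case (Prod s t)
  then obtain u u' where w: "w = u + u'" "u \<in> words s" "u' \<in> words t" by auto
  then have ne: "u \<noteq> {#}" "u' \<noteq> {#}" using empty_notin_words by auto
  have 1: "le A (smul A (wval A v u) (wval A v u')) (smul A (wval A v u) (eval_tm A v t))"
    using Prod.IH(2)[OF w(3)] by (intro mul_mono wval_cl eval_cl)
  have 2: "le A (smul A (eval_tm A v t) (wval A v u)) (smul A (eval_tm A v t) (eval_tm A v s))"
    using Prod.IH(1)[OF w(2)] by (intro mul_mono wval_cl eval_cl)
  show ?case
    using le_trans[OF _ _ _ 1, of "smul A (eval_tm A v s) (eval_tm A v t)"] 2
    by (simp add: w(1) wval_plus[OF ne] closed wval_cl eval_cl mul_comm[OF eval_cl wval_cl]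
        mul_comm[OF eval_cl eval_cl, of t s])
qed

text \<open>Multiplying by an arbitrary element makes the induction pass through products.\<close>

lemma mul_eval_least:
  assumes "c \<in> elems A" "z \<in> elems A" "\<And>w. w \<in> words t \<Longrightarrow> le A (smul A c (wval A v w)) z"
  shows "le A (smul A c (eval_tm A v t)) z"
  using assms
proof (induction t arbitrary: c)
  case (Var n) then show ?case by simp
next
  case (Sum s t)
  then show ?case by (auto simp: laws eval_cl closed intro!: add_least)
next
  case (Prod s t)
  have "le A (smul A (smul A c (eval_tm A v s)) (eval_tm A v t)) z"
  proof (rule Prod.IH(2))
    fix u' assume u': "u' \<in> words t"
    have "le A (smul A (smul A c (wval A v u')) (eval_tm A v s)) z"
    proof (rule Prod.IH(1))
      fix u assume u: "u \<in> words s"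
      then have ne: "u \<noteq> {#}" "u' \<noteq> {#}" using u' empty_notin_words by auto
      have "le A (smul A c (wval A v (u + u'))) z" using u u' by (intro Prod.prems(3)) auto
      then show "le A (smul A (smul A c (wval A v u')) (wval A v u)) z"
        by (simp add: laws(2) wval_cl Prod.prems wval_plus[OF ne] mul_comm[OF wval_cl wval_cl, of u'])
    qed (auto simp: closed wval_cl Prod.prems)
    moreover have "smul A (smul A c (wval A v u')) (eval_tm A v s) = smul A (smul A c (eval_tm A v s)) (wval A v u')"
      by (simp add: laws(2) wval_cl eval_cl Prod.prems mul_comm[OF wval_cl eval_cl])
    ultimately show "le A (smul A (smul A c (eval_tm A v s)) (wval A v u')) z" by simp
  qed (auto simp: closed eval_cl Prod.prems)
  then show ?case by (simp add: laws(2) eval_cl Prod.prems)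
qed

lemma eval_least:
  assumes "z \<in> elems A" "\<And>w. w \<in> words t \<Longrightarrow> le A (wval A v w) z"
  shows "le A (eval_tm A v t) z"
  using assms(2)
proof (induction t)
  case (Var n) then show ?case by simp
next
  case (Sum s t)
  then show ?case by (auto simp: assms(1) eval_cl intro!: add_least)
next
  case (Prod s t)
  have "le A (smul A (eval_tm A v s) (eval_tm A v t)) z"
  proof (rule mul_eval_least[OF eval_cl assms(1)])
    fix u' assume u': "u' \<in> words t"
    have "le A (smul A (wval A v u') (eval_tm A v s)) z"
    proof (rule mul_eval_least[OF wval_cl assms(1)])
      fix u assume u: "u \<in> words s"
      then have ne: "u \<noteq> {#}" "u' \<noteq> {#}" using u' empty_notin_words by auto
      have "le A (wval A v (u + u')) z" using u u' by (intro Prod.prems) auto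
      then show "le A (smul A (wval A v u') (wval A v u)) z"
        by (simp add: wval_plus[OF ne] mul_comm[OF wval_cl wval_cl, of u'])
    qed
    then show "le A (smul A (eval_tm A v s) (wval A v u')) z"
      by (simp add: mul_comm[OF eval_cl wval_cl])
  qed
  then show ?case by simp
qed

end

lemma wval_sub_range:
  "range v \<subseteq> elems A \<Longrightarrow> range (\<lambda>n. wval A v (\<sigma> n)) \<subseteq> elems A"
  using wval_cl by auto

lemma wval_sub:
  assumes v: "range v \<subseteq> elems A" and s: "\<And>n. \<sigma> n \<noteq> {#}" and w: "w \<noteq> {#}"
  shows "wval A v (sub \<sigma> w) = wval A (\<lambda>n. wval A v (\<sigma> n)) w"
  using w
proof (induction w rule: nonempty_mset_induct)
  case (single n) then show ?case by (simp add: wval_single[OF wval_sub_range[OF v]])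
next
  case (add n u)
  then show ?case
    by (simp add: wval_plus[OF v] s sub_nonempty wval_add[OF wval_sub_range[OF v]])
qed

end

text \<open>\<open>ent A S w\<close> says that \<open>w\<close> lies below the sum of \<open>S\<close> under all valuations in \<open>A\<close>; it is stated
  through upper bounds to avoid sums of finite sets.\<close>

definition ent :: "'a alg \<Rightarrow> nat multiset set \<Rightarrow> nat multiset \<Rightarrow> bool" where
  "ent A S w \<longleftrightarrow> (\<forall>v. range v \<subseteq> elems A \<longrightarrow>
     (\<forall>z\<in>elems A. (\<forall>u\<in>S. le A (wval A v u) z) \<longrightarrow> le A (wval A v w) z))"

definition Ent :: "'a alg set \<Rightarrow> nat multiset set \<Rightarrow> nat multiset \<Rightarrow> bool" where
  "Ent W S w \<longleftrightarrow> (\<forall>A\<in>W. ent A S w)"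

fun sumtm :: "nat list list \<Rightarrow> tm" where
  "sumtm [] = Var 0"
| "sumtm [x] = prodtm x"
| "sumtm (x # y # xs) = Sum (prodtm x) (sumtm (y # xs))"

lemma words_prodtm: "xs \<noteq> [] \<Longrightarrow> words (prodtm xs) = {mset xs}"
  by (induction xs rule: prodtm.induct) auto

lemma words_sumtm: "ss \<noteq> [] \<Longrightarrow> [] \<notin> set ss \<Longrightarrow> words (sumtm ss) = mset ` set ss"
  by (induction ss rule: sumtm.induct) (auto simp: words_prodtm)

lemma words_surj:
  assumes "finite S" "S \<noteq> {}" "{#} \<notin> S"
  shows "\<exists>t. words t = S"
proof -
  obtain us where us: "set us = S" using assms(1) finite_list by blast
  have "mset ` set (map sorted_list_of_multiset us) = S" by (auto simp: us image_image)
  moreover have "map sorted_list_of_multiset us \<noteq> []" "[] \<notin> set (map sorted_list_of_multiset us)"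
    using us assms by (auto dest: arg_cong[where f = mset])
  ultimately show ?thesis using words_sumtm by metis
qed

definition good :: "nat multiset set \<Rightarrow> bool" where
  "good S \<longleftrightarrow> finite S \<and> S \<noteq> {} \<and> {#} \<notin> S"

lemma good_words: "good (words t)"
  by (simp add: good_def finite_words words_nonempty empty_notin_words)

context comm_ai_semiring
begin

lemma ent_eval:
  assumes "range v \<subseteq> elems A" "ent A (words s) w"
  shows "le A (wval A v w) (eval_tm A v s)"
  using assms eval_cl words_le_eval unfolding ent_def by blast

lemma satisfies_iff_ent:
  "satisfies A (s, t) \<longleftrightarrow> (\<forall>w\<in>words t. ent A (words s) w) \<and> (\<forall>w\<in>words s. ent A (words t) w)"
proof
  assume R: "(\<forall>w\<in>words t. ent A (words s) w) \<and> (\<forall>w\<in>words s. ent A (words t) w)"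
  show "satisfies A (s, t)" unfolding satisfies_def
  proof (intro allI impI)
    fix v :: "nat \<Rightarrow> 'a" assume v: "range v \<subseteq> elems A"
    show "eval_tm A v (fst (s, t)) = eval_tm A v (snd (s, t))"
      using R by (auto intro!: le_antisym eval_cl v eval_least ent_eval)
  qed
next
  assume L: "satisfies A (s, t)"
  have *: "ent A (words a) w" if "w \<in> words b" and eq: "\<And>v. range v \<subseteq> elems A \<Longrightarrow> eval_tm A v a = eval_tm A v b" for a b w
    unfolding ent_def
  proof (intro allI impI ballI)
    fix v :: "nat \<Rightarrow> 'a" and z
    assume v: "range v \<subseteq> elems A" and z: "z \<in> elems A" "\<forall>u\<in>words a. le A (wval A v u) z"
    then have "le A (eval_tm A v b) z" using eval_least[OF v z(1), of a] eq[OF v] by auto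
    then show "le A (wval A v w) z"
      using le_trans[OF wval_cl eval_cl z(1) words_le_eval] v that(1) by blast
  qed
  show "(\<forall>w\<in>words t. ent A (words s) w) \<and> (\<forall>w\<in>words s. ent A (words t) w)"
    using L *[of _ t s] *[of _ s t] unfolding satisfies_def by auto
qed

lemma ent_mult:
  assumes S: "good S" and u: "u \<noteq> {#}" and w: "w \<noteq> {#}" and e: "ent A S w"
  shows "ent A ((+) u ` S) (u + w)"
  unfolding ent_def
proof (intro allI impI ballI)
  fix v :: "nat \<Rightarrow> 'a" and z
  assume v: "range v \<subseteq> elems A" and z: "z \<in> elems A" "\<forall>s\<in>(+) u ` S. le A (wval A v s) z"
  obtain t where t: "words t = S" using words_surj S unfolding good_def by blast
  have "le A (smul A (wval A v u) (eval_tm A v t)) z"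
  proof (rule mul_eval_least[OF v wval_cl[OF v] z(1)])
    fix s assume "s \<in> words t"
    then have "s \<in> S" "s \<noteq> {#}" using S by (auto simp: t good_def)
    then show "le A (smul A (wval A v u) (wval A v s)) z"
      using z(2) wval_plus[OF v u, of s] by auto
  qed
  moreover have "le A (wval A v (u + w)) (smul A (wval A v u) (eval_tm A v t))"
    unfolding wval_plus[OF v u w] using e t
    by (intro mul_mono ent_eval wval_cl eval_cl v) auto
  ultimately show "le A (wval A v (u + w)) z"
    using le_trans[OF wval_cl[OF v] closed(2)[OF wval_cl[OF v] eval_cl[OF v]] z(1)] by blast
qed

lemma ent_sub:
  assumes S: "{#} \<notin> S" and w: "w \<noteq> {#}" and s: "\<And>n. \<sigma> n \<noteq> {#}" and e: "ent A S w"
  shows "ent A (sub \<sigma> ` S) (sub \<sigma> w)"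
  unfolding ent_def
proof (intro allI impI ballI)
  fix v :: "nat \<Rightarrow> 'a" and z
  assume v: "range v \<subseteq> elems A" and z: "z \<in> elems A" "\<forall>s\<in>sub \<sigma> ` S. le A (wval A v s) z"
  have "\<forall>u\<in>S. le A (wval A (\<lambda>n. wval A v (\<sigma> n)) u) z"
  proof
    fix u assume "u \<in> S"
    then have "u \<noteq> {#}" "le A (wval A v (sub \<sigma> u)) z" using z(2) S by auto
    then show "le A (wval A (\<lambda>n. wval A v (\<sigma> n)) u) z" using wval_sub[OF v, of \<sigma> u] s by simp
  qed
  then have "le A (wval A (\<lambda>n. wval A v (\<sigma> n)) w) z"
    using e[unfolded ent_def, rule_format, OF wval_sub_range[OF v] z(1)] by blast
  then show "le A (wval A v (sub \<sigma> w)) z" using wval_sub[OF v, of \<sigma> w] s w by simp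
qed

lemma ent_cut:
  assumes "ent A S w" "\<And>u. u \<in> S \<Longrightarrow> ent A T u"
  shows "ent A T w"
  using assms unfolding ent_def by blast

end

lemma ent_refl: "w \<in> S \<Longrightarrow> ent A S w" unfolding ent_def by blast

text \<open>Laws are data rather than propositions, so that a law can be turned into an identity as well as
  into a rule for arbitrary words.\<close>

type_synonym law = "nat list list \<times> nat list"

definition obeys :: "(nat multiset set \<Rightarrow> nat multiset \<Rightarrow> bool) \<Rightarrow> law \<Rightarrow> bool" where
  "obeys E l \<longleftrightarrow> E (mset ` set (fst l)) (mset (snd l))"

definition wf_law :: "law \<Rightarrow> bool" where
  "wf_law l \<longleftrightarrow> fst l \<noteq> [] \<and> [] \<notin> set (fst l) \<and> snd l \<noteq> []"

definition law_eq :: "law \<Rightarrow> tm \<times> tm" where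
  "law_eq l = (sumtm (fst l), Sum (sumtm (fst l)) (prodtm (snd l)))"

lemma (in comm_ai_semiring) satisfies_law_eq:
  assumes "wf_law l"
  shows "satisfies A (law_eq l) \<longleftrightarrow> obeys (ent A) l"
  using assms unfolding law_eq_def satisfies_iff_ent wf_law_def obeys_def
  by (auto simp: words_sumtm words_prodtm ent_refl)

text \<open>The condition \<open>good S\<close> makes \<open>\<Sum>S\<close> meaningful. The rule \<open>mult\<close> depends on it, because by
  distributivity \<open>u\<close> times the sum of \<open>S\<close> is the least upper bound of the words \<open>u + s\<close>.\<close>

locale consequence =
  fixes E :: "nat multiset set \<Rightarrow> nat multiset \<Rightarrow> bool"
  assumes refl: "w \<in> S \<Longrightarrow> E S w"
    and cut: "E S w \<Longrightarrow> (\<And>u. u \<in> S \<Longrightarrow> E T u) \<Longrightarrow> E T w"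
    and mult: "good S \<Longrightarrow> u \<noteq> {#} \<Longrightarrow> w \<noteq> {#} \<Longrightarrow> E S w \<Longrightarrow> E ((+) u ` S) (u + w)"
    and subst: "{#} \<notin> S \<Longrightarrow> w \<noteq> {#} \<Longrightarrow> (\<And>n. \<sigma> n \<noteq> {#}) \<Longrightarrow> E S w \<Longrightarrow> E (sub \<sigma> ` S) (sub \<sigma> w)"
begin

lemma cut1: "E {u} w \<Longrightarrow> E T u \<Longrightarrow> E T w"
  using cut by blast

lemma mono: "E S w \<Longrightarrow> S \<subseteq> T \<Longrightarrow> E T w"
  using cut refl by blast

lemma mult1: "E {w} w' \<Longrightarrow> w \<noteq> {#} \<Longrightarrow> w' \<noteq> {#} \<Longrightarrow> E {u + w} (u + w')"
  using mult[of "{w}" u w'] by (cases "u = {#}") (auto simp: good_def)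

lemma obeys_subst:
  assumes "obeys E l" "wf_law l" "\<And>n. \<sigma> n \<noteq> {#}"
  shows "E ((\<lambda>s. sub \<sigma> (mset s)) ` set (fst l)) (sub \<sigma> (mset (snd l)))"
proof -
  have "{#} \<notin> mset ` set (fst l)" using assms(2) by (auto simp: wf_law_def)
  then have "E (sub \<sigma> ` mset ` set (fst l)) (sub \<sigma> (mset (snd l)))"
    using assms by (intro subst) (auto simp: obeys_def wf_law_def)
  then show ?thesis by (simp add: image_image)
qed

end

lemma consequence_Ent:
  assumes "\<And>A. A \<in> W \<Longrightarrow> comm_ai A"
  shows "consequence (Ent W)"
proof
  have c: "comm_ai_semiring A" if "A \<in> W" for A using assms that by unfold_locales
  show "w \<in> S \<Longrightarrow> Ent W S w" for w S by (auto simp: Ent_def ent_refl)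
  show "Ent W T w" if "Ent W S w" "\<And>u. u \<in> S \<Longrightarrow> Ent W T u" for S T w
    using that comm_ai_semiring.ent_cut[OF c, of _ S w T] unfolding Ent_def by blast
  show "Ent W ((+) u ` S) (u + w)" if "good S" "u \<noteq> {#}" "w \<noteq> {#}" "Ent W S w" for S u w
    using that comm_ai_semiring.ent_mult[OF c] unfolding Ent_def by blast
  show "Ent W (sub \<sigma> ` S) (sub \<sigma> w)" if "{#} \<notin> S" "w \<noteq> {#}" "\<And>n. \<sigma> n \<noteq> {#}" "Ent W S w" for \<sigma> S w
    using that comm_ai_semiring.ent_sub[OF c] unfolding Ent_def by blast
qed

lemma holds_in_iff_Ent:
  assumes "\<And>A. A \<in> W \<Longrightarrow> comm_ai A"
  shows "holds_in W (s, t) \<longleftrightarrow> (\<forall>w\<in>words t. Ent W (words s) w) \<and> (\<forall>w\<in>words s. Ent W (words t) w)"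
  using assms comm_ai_semiring.satisfies_iff_ent[OF comm_ai_semiring.intro]
  unfolding holds_in_def Ent_def by blast

lemma obeys_Ent: "obeys (Ent W) l \<longleftrightarrow> (\<forall>A\<in>W. obeys (ent A) l)"
  unfolding obeys_def Ent_def ..

lemma holds_in_law_eq:
  assumes "\<And>A. A \<in> W \<Longrightarrow> comm_ai A" "wf_law l"
  shows "holds_in W (law_eq l) \<longleftrightarrow> obeys (Ent W) l"
  using assms comm_ai_semiring.satisfies_law_eq[OF comm_ai_semiring.intro]
  unfolding holds_in_def obeys_Ent by blast

definition comm_eq :: "tm \<times> tm" where
  "comm_eq = (Prod (Var 0) (Var 1), Prod (Var 1) (Var 0))"

lemma satisfies_comm_eq:
  assumes "ai_semiring A"
  shows "satisfies A comm_eq \<longleftrightarrow> comm_ai A"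
proof
  assume L: "satisfies A comm_eq"
  have "smul A x y = smul A y x" if "x \<in> elems A" "y \<in> elems A" for x y
    using L[unfolded satisfies_def, rule_format, of "\<lambda>n. if n = 0 then x else y"] that
    by (auto simp: comm_eq_def)
  then show "comm_ai A" using assms by (auto simp: comm_ai_def)
next
  assume "comm_ai A"
  then show "satisfies A comm_eq"
    by (simp add: satisfies_def comm_eq_def comm_ai_def image_subset_iff)
qed

text \<open>By Birkhoff's theorem, a commutative variety is determined by its consequence relation.\<close>

lemma variety_le_if_Ent:
  fixes W V :: "'u alg set"
  assumes inf: "infinite (UNIV :: 'u set)" and W: "variety W" "\<And>A. A \<in> W \<Longrightarrow> comm_ai A"
    and V: "variety V" "\<And>A. A \<in> V \<Longrightarrow> comm_ai A"
    and E: "\<And>S w. good S \<Longrightarrow> w \<noteq> {#} \<Longrightarrow> Ent W S w \<Longrightarrow> Ent V S w"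
  shows "V \<subseteq> W"
proof
  fix A assume A: "A \<in> V"
  show "A \<in> W"
  proof (rule birkhoff[OF inf W(1)])
    show "ai_semiring A" using variety_ai[OF V(1) A] .
    fix e assume e: "holds_in W e"
    obtain s t where st: "e = (s, t)" by fastforce
    have "holds_in V (s, t)"
      using e E good_words empty_notin_words holds_in_iff_Ent[of W s t, OF W(2)] holds_in_iff_Ent[of V s t, OF V(2)]
      unfolding st by metis
    then show "satisfies A e" using A st unfolding holds_in_def by blast
  qed
qed

section \<open>Laws and their consequences\<close>

text \<open>For \<open>X\<close> among \<open>D2\<close>, \<open>M2\<close>, \<open>T2\<close>, \<open>M20\<close>, \<open>T20\<close>, the law \<open>law_X\<close> fails in the algebra of that name, and
  every subvariety of \<open>V(S\<^sub>7\<^sup>0)\<close> without this algebra obeys it; \<open>law_AB\<close> and \<open>law_ABC\<close> play the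
  same role for \<open>S\<^sub>c(ab)\<close> and \<open>S\<^sub>c(abc)\<close>. The law \<open>law_path\<close> holds in \<open>S\<^sub>7\<close> and in \<open>S\<^sub>c(ab)\<close>, but
  neither in \<open>D\<^sub>2\<close> nor in \<open>S\<^sub>7\<^sup>0\<close>.\<close>

definition law_D2 :: law where "law_D2 = ([[0,0,1,1]], [0,0])"
definition law_M2 :: law where "law_M2 = ([[0,0]], [0,0,1,1])"
definition law_T2 :: law where "law_T2 = ([[0]], [0,0])"
definition law_M20 :: law where "law_M20 = ([[0,0],[0,0,1,1,2,2]], [0,0,1,1])"
definition law_T20 :: law where "law_T20 = ([[0],[0,0,1,1]], [0,0])"
definition law_AB :: law where "law_AB = ([[0,1]], [0,0,1,1])"
definition law_ABC :: law where "law_ABC = ([[0,1,2]], [0,0,1,1,2,2])"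
definition law_path :: law where "law_path = ([[0,1],[1,2],[2,3]], [0,3])"

lemmas law_defs = law_D2_def law_M2_def law_T2_def law_M20_def law_T20_def law_AB_def law_ABC_def law_path_def

text \<open>These laws of \<open>S\<^sub>7\<^sup>0\<close> are all that the derivations below need. Apart from the first three, which say
  that \<open>x\<^sup>2 = x\<^sup>3 \<ge> x\<close>, they reflect that sums of distinct elements of \<open>S\<^sub>7\<close> are infinite: the sum
  has a value other than \<open>\<infinity>\<close> in \<open>S\<^sub>7\<close> only if all letters are sent to \<open>1\<close> or, in the last law, only if
  \<open>y\<close> is sent to \<open>1\<close>.\<close>

definition base_laws :: "law list" where
  "base_laws = [([[0,0]], [0,0,0]), ([[0,0,0]], [0,0]), ([[0,0]], [0]), ([[0,0],[1]], [0,0,1,1]),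
     ([[0,1],[0],[1]], [0,0,1,1]), ([[0,1,2],[0,1],[0,2],[1,2]], [0,0,1,1,2,2]),
     ([[0,1,2],[0],[1],[2]], [0,0,1,1,2,2]), ([[0],[0,1]], [0,1,1])]"

definition asg :: "'b \<Rightarrow> 'b \<Rightarrow> 'b \<Rightarrow> 'b \<Rightarrow> nat \<Rightarrow> 'b" where
  "asg x y z t n = (if n = 0 then x else if n = 1 then y else if n = 2 then z else t)"

lemma asg_simps [simp]: "asg x y z t 0 = x" "asg x y z t (Suc 0) = y" "asg x y z t 2 = z" "asg x y z t 3 = t"
  by (auto simp: asg_def)

lemma two_letters:
  assumes "w \<noteq> {#}" "sub \<sigma> w = {#0, 1#}" "\<And>n. \<sigma> n \<noteq> {#}"
  shows "(\<exists>n. w = {#n#} \<and> \<sigma> n = {#0, 1#}) \<or> (\<exists>p q. w = {#p, q#} \<and> \<sigma> p = {#0#} \<and> \<sigma> q = {#1#})"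
proof -
  obtain p w' where w: "w = add_mset p w'" using assms(1) by (cases w) auto
  show ?thesis
  proof (cases w')
    case empty then show ?thesis using w assms(2) by auto
  next
    case (add q w'')
    have s: "size (\<sigma> n) \<ge> 1" for n using assms(3)[of n] by (simp add: Suc_leI nonempty_has_size)
    have "size (sub \<sigma> w) = 2" using assms(2) by simp
    then have sz: "size (\<sigma> p) + size (\<sigma> q) + size (sub \<sigma> w'') = 2" by (simp add: w add)
    have "w'' = {#}"
    proof (rule ccontr)
      assume "w'' \<noteq> {#}"
      then have "size (sub \<sigma> w'') \<ge> 1"
        using sub_nonempty[of \<sigma>] assms(3) by (metis One_nat_def Suc_leI nonempty_has_size)
      then show False using sz s[of p] s[of q] by linarith
    qed
    moreover have "size (\<sigma> p) = 1" "size (\<sigma> q) = 1" using sz s[of p] s[of q] by linarith+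
    then obtain a b where ab: "\<sigma> p = {#a#}" "\<sigma> q = {#b#}" by (metis size_1_singleton_mset)
    ultimately have "{#a, b#} = {#0, 1#}" using assms(2) by (simp add: w add add_mset_commute)
    then have "a = 0 \<and> b = 1 \<or> a = 1 \<and> b = 0" by (auto simp: add_eq_conv_ex)
    then consider "\<sigma> p = {#0#}" "\<sigma> q = {#1#}" | "\<sigma> q = {#0#}" "\<sigma> p = {#1#}" using ab by auto
    then show ?thesis
      using \<open>w'' = {#}\<close> w add by cases (blast, metis add_mset_commute)
  qed
qed

context consequence
begin

lemma instantiate:
  assumes "obeys E l" "wf_law l" "x \<noteq> {#}" "y \<noteq> {#}" "z \<noteq> {#}" "t \<noteq> {#}"
  shows "E ((\<lambda>s. sub (asg x y z t) (mset s)) ` set (fst l)) (sub (asg x y z t) (mset (snd l)))"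
  using assms by (intro obeys_subst) (auto simp: asg_def)

lemma D2: "obeys E law_D2 \<Longrightarrow> x \<noteq> {#} \<Longrightarrow> y \<noteq> {#} \<Longrightarrow> E {x + x + y + y} (x + x)"
  using instantiate[of law_D2 x y x x] by (simp add: law_defs wf_law_def add_ac)

lemma M2: "obeys E law_M2 \<Longrightarrow> x \<noteq> {#} \<Longrightarrow> y \<noteq> {#} \<Longrightarrow> E {x + x} (x + x + y + y)"
  using instantiate[of law_M2 x y x x] by (simp add: law_defs wf_law_def add_ac)

lemma T2: "obeys E law_T2 \<Longrightarrow> x \<noteq> {#} \<Longrightarrow> E {x} (x + x)"
  using instantiate[of law_T2 x x x x] by (simp add: law_defs wf_law_def add_ac)

lemma M20: "obeys E law_M20 \<Longrightarrow> x \<noteq> {#} \<Longrightarrow> y \<noteq> {#} \<Longrightarrow> z \<noteq> {#} \<Longrightarrow>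
    E {x + x, x + x + y + y + z + z} (x + x + y + y)"
  using instantiate[of law_M20 x y z x] by (simp add: law_defs wf_law_def add_ac)

lemma T20: "obeys E law_T20 \<Longrightarrow> x \<noteq> {#} \<Longrightarrow> y \<noteq> {#} \<Longrightarrow> E {x, x + x + y + y} (x + x)"
  using instantiate[of law_T20 x y x x] by (simp add: law_defs wf_law_def add_ac)

lemma AB: "obeys E law_AB \<Longrightarrow> x \<noteq> {#} \<Longrightarrow> y \<noteq> {#} \<Longrightarrow> E {x + y} (x + x + y + y)"
  using instantiate[of law_AB x y x x] by (simp add: law_defs wf_law_def add_ac)

lemma ABC: "obeys E law_ABC \<Longrightarrow> x \<noteq> {#} \<Longrightarrow> y \<noteq> {#} \<Longrightarrow> z \<noteq> {#} \<Longrightarrow>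
    E {x + y + z} (x + x + y + y + z + z)"
  using instantiate[of law_ABC x y z x] by (simp add: law_defs wf_law_def add_ac)

lemma path: "obeys E law_path \<Longrightarrow> x \<noteq> {#} \<Longrightarrow> y \<noteq> {#} \<Longrightarrow> z \<noteq> {#} \<Longrightarrow> t \<noteq> {#} \<Longrightarrow>
    E {x + y, y + z, z + t} (x + t)"
  using instantiate[of law_path x y z t] by (simp add: law_defs wf_law_def add_ac)

end

locale base_consequence = consequence +
  assumes base: "\<And>l. l \<in> set base_laws \<Longrightarrow> obeys E l"
begin

lemma base_instantiate:
  assumes "l \<in> set base_laws" "x \<noteq> {#}" "y \<noteq> {#}" "z \<noteq> {#}"
  shows "E ((\<lambda>s. sub (asg x y z x) (mset s)) ` set (fst l)) (sub (asg x y z x) (mset (snd l)))"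
proof (rule instantiate)
  show "wf_law l" using assms(1) by (auto simp: base_laws_def wf_law_def)
qed (use assms base in auto)

lemma square_cube: "x \<noteq> {#} \<Longrightarrow> E {x + x} (x + x + x)"
  using base_instantiate[of "([[0,0]], [0,0,0])" x x x] by (simp add: base_laws_def add_ac)

lemma cube_square: "x \<noteq> {#} \<Longrightarrow> E {x + x + x} (x + x)"
  using base_instantiate[of "([[0,0,0]], [0,0])" x x x] by (simp add: base_laws_def add_ac)

lemma below_square: "x \<noteq> {#} \<Longrightarrow> E {x + x} x"
  using base_instantiate[of "([[0,0]], [0])" x x x] by (simp add: base_laws_def add_ac)

lemma square_absorb: "x \<noteq> {#} \<Longrightarrow> y \<noteq> {#} \<Longrightarrow> E {x + x, y} (x + x + y + y)"
  using base_instantiate[of "([[0,0],[1]], [0,0,1,1])" x y x] by (simp add: base_laws_def add_ac)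

lemma pair_letters: "x \<noteq> {#} \<Longrightarrow> y \<noteq> {#} \<Longrightarrow> E {x + y, x, y} (x + x + y + y)"
  using base_instantiate[of "([[0,1],[0],[1]], [0,0,1,1])" x y x] by (simp add: base_laws_def add_ac)

lemma triple_pairs: "x \<noteq> {#} \<Longrightarrow> y \<noteq> {#} \<Longrightarrow> z \<noteq> {#} \<Longrightarrow>
    E {x + y + z, x + y, x + z, y + z} (x + x + y + y + z + z)"
  using base_instantiate[of "([[0,1,2],[0,1],[0,2],[1,2]], [0,0,1,1,2,2])" x y z]
  by (simp add: base_laws_def add_ac)

lemma triple_letters: "x \<noteq> {#} \<Longrightarrow> y \<noteq> {#} \<Longrightarrow> z \<noteq> {#} \<Longrightarrow>
    E {x + y + z, x, y, z} (x + x + y + y + z + z)"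
  using base_instantiate[of "([[0,1,2],[0],[1],[2]], [0,0,1,1,2,2])" x y z]
  by (simp add: base_laws_def add_ac)

lemma letter_edge: "x \<noteq> {#} \<Longrightarrow> y \<noteq> {#} \<Longrightarrow> E {x, x + y} (x + y + y)"
  using base_instantiate[of "([[0],[0,1]], [0,1,1])" x y x] by (simp add: base_laws_def add_ac)

text \<open>Because \<open>x\<^sup>2 = x\<^sup>3\<close>, a word in which every letter is repeated depends on its content only;
  \<open>sq C\<close> is its normal form.\<close>

definition sq :: "nat set \<Rightarrow> nat multiset" where
  "sq C = mset_set C + mset_set C"

lemma double_content:
  assumes "w \<noteq> {#}" "\<And>c. c \<in># w \<Longrightarrow> count w c \<ge> 2"
  shows "E {w} (sq (set_mset w)) \<and> E {sq (set_mset w)} w"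
  using assms
proof (induction "size w" arbitrary: w rule: less_induct)
  case less
  show ?case
  proof (cases "\<exists>c. count w c \<ge> 3")
    case False
    have "w = sq (set_mset w)"
    proof (rule multiset_eqI)
      fix c
      show "count w c = count (sq (set_mset w)) c"
        using spec[OF False[unfolded not_ex], of c] less.prems(2)[of c]
        by (cases "c \<in># w") (auto simp: sq_def not_in_iff not_le)
    qed
    then show ?thesis using refl by (metis singletonI)
  next
    case True
    then obtain c where c: "count w c \<ge> 3" by auto
    define r where "r = w - {#c, c, c#}"
    have "{#c, c, c#} \<subseteq># w"
      using c by (intro mset_subset_eqI) auto
    then have w: "w = {#c, c, c#} + r" unfolding r_def by (metis subset_mset.add_diff_inverse)
    let ?w' = "{#c, c#} + r"
    have e: "E {w} ?w'" "E {?w'} w"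
      using mult1[OF cube_square[of "{#c#}"], of r] mult1[OF square_cube[of "{#c#}"], of r]
      by (auto simp: w add_ac)
    have "E {?w'} (sq (set_mset ?w')) \<and> E {sq (set_mset ?w')} ?w'"
    proof (rule less.hyps)
      show "size ?w' < size w" by (simp add: w)
      fix d assume d: "d \<in># ?w'"
      then show "count ?w' d \<ge> 2" using less.prems(2)[of d] by (auto simp: w split: if_splits)
    qed simp
    moreover have "set_mset ?w' = set_mset w" by (simp add: w)
    ultimately show ?thesis using e cut1 by metis
  qed
qed

lemma square_iff:
  assumes "finite C" "C \<noteq> {}" "set_mset x = C" "\<And>c. c \<in># x \<Longrightarrow> count x c \<ge> 2"
  shows "E S x \<longleftrightarrow> E S (sq C)"
proof -
  have "x \<noteq> {#}" using assms by auto
  then show ?thesis using double_content[of x] assms cut1 by metis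
qed

lemma count_double: "c \<in># (x + x :: nat multiset) \<Longrightarrow> count (x + x) c \<ge> 2"
proof -
  assume "c \<in># x + x"
  then have "count x c \<ge> 1" by simp
  then show ?thesis unfolding count_union by linarith
qed

lemma double_iff: "w \<noteq> {#} \<Longrightarrow> E S (w + w) \<longleftrightarrow> E S (sq (set_mset w))"
  by (rule square_iff[OF _ _ _ count_double]) simp_all

lemma below_sq: "w \<noteq> {#} \<Longrightarrow> E S (sq (set_mset w)) \<Longrightarrow> E S w"
  using double_iff cut1[OF below_square] by blast

lemma nonempty_mset_set: "finite C \<Longrightarrow> C \<noteq> {} \<Longrightarrow> mset_set C \<noteq> {#}"
  by (simp add: mset_set_empty_iff)

text \<open>The rules that the laws provide for the words \<open>sq C\<close>. They are closure properties of the set of words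
  derivable from a fixed \<open>S\<close>.\<close>

lemma sq_absorb:
  assumes "finite C" "C \<noteq> {}" "E S (sq C)" "E S u" "u \<noteq> {#}"
  shows "E S (sq (C \<union> set_mset u))"
proof -
  have "E S (mset_set C + mset_set C + u + u)"
    by (rule cut[OF square_absorb[of "mset_set C" u]])
      (use assms in \<open>auto simp: nonempty_mset_set sq_def\<close>)
  then show ?thesis
    using double_iff[of "mset_set C + u" S] assms(1,5) by (simp add: add_ac Un_commute)
qed

lemma sq_absorb_all:
  assumes "finite C" "C \<noteq> {}" "E S (sq C)" "finite U" "\<And>u. u \<in> U \<Longrightarrow> E S u \<and> u \<noteq> {#}"
  shows "E S (sq (C \<union> \<Union> (set_mset ` U)))"
  using assms(4,5)
proof (induction U)
  case (insert u U)
  have "E S (sq ((C \<union> \<Union> (set_mset ` U)) \<union> set_mset u))"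
    by (rule sq_absorb) (use insert assms in auto)
  then show ?case by (simp add: Un_ac)
qed (use assms in auto)

lemma sq_D2:
  assumes "obeys E law_D2" "finite D" "C \<subseteq> D" "C \<noteq> {}" "E S (sq D)"
  shows "E S (sq C)"
proof -
  have f: "finite C" "D \<noteq> {}" using assms finite_subset by auto
  have "E {mset_set C + mset_set C + mset_set D + mset_set D} (sq C)"
    unfolding sq_def by (rule D2) (use assms f nonempty_mset_set in auto)
  moreover have "E S ((mset_set C + mset_set D) + (mset_set C + mset_set D))"
    using double_iff[of "mset_set C + mset_set D" S] assms f
    by (simp add: sup.absorb2 nonempty_mset_set)
  ultimately show ?thesis using cut1[of "mset_set C + mset_set C + mset_set D + mset_set D"]
    by (simp add: add_ac)
qed

lemma sq_M2:
  assumes "obeys E law_M2" "finite C" "C \<noteq> {}" "finite D" "E S (sq C)"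
  shows "E S (sq (C \<union> D))"
proof (cases "D = {}")
  case False
  have "E {sq C} (mset_set C + mset_set C + mset_set D + mset_set D)"
    unfolding sq_def by (rule M2) (use assms False nonempty_mset_set in auto)
  then have "E S (mset_set C + mset_set C + mset_set D + mset_set D)" using assms cut1 by blast
  then show ?thesis
    using double_iff[of "mset_set C + mset_set D" S] assms
    by (simp add: add_ac nonempty_mset_set)
qed (use assms in auto)

lemma sq_T2:
  assumes "obeys E law_T2" "E S {#n#}"
  shows "E S (sq {n})"
  using cut1[OF T2[OF assms(1), of "{#n#}"] assms(2)] by (simp add: sq_def)

lemma sq_M20:
  assumes "obeys E law_M20" "finite D" "C \<subseteq> B" "B \<subseteq> D" "C \<noteq> {}" "E S (sq C)" "E S (sq D)"
  shows "E S (sq B)"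
proof -
  have f: "finite C" "finite B" "D \<noteq> {}" "B \<noteq> {}"
    using assms finite_subset[OF _ assms(2)] order_trans[OF assms(3,4)] by auto
  let ?w = "mset_set C + mset_set B + mset_set D" and ?u = "mset_set C + mset_set B"
  have "E S (?w + ?w)"
    using double_iff[of ?w S] assms f by (simp add: sup.absorb2 nonempty_mset_set)
  moreover have "E {sq C, ?w + ?w} (?u + ?u)"
    using M20[OF assms(1) nonempty_mset_set nonempty_mset_set nonempty_mset_set, of C B D] assms f
    by (simp add: sq_def add_ac)
  ultimately have "E S (?u + ?u)" using assms(6) cut by blast
  then show ?thesis
    using double_iff[of ?u S] assms f by (simp add: sup.absorb2 nonempty_mset_set)
qed

lemma sq_T20:
  assumes "obeys E law_T20" "finite D" "n \<in> D" "E S {#n#}" "E S (sq D)"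
  shows "E S (sq {n})"
proof -
  let ?w = "{#n#} + mset_set D"
  have "E S (?w + ?w)"
    using double_iff[of ?w S] assms by (simp add: insert_absorb)
  moreover have "E {{#n#}, ?w + ?w} ({#n#} + {#n#})"
    using T20[OF assms(1), of "{#n#}" "mset_set D"] assms nonempty_mset_set[of D]
    by (auto simp: add_ac)
  ultimately have "E S ({#n#} + {#n#})" using assms(4) cut by blast
  then show ?thesis by (simp add: sq_def)
qed

lemma size_ge2E:
  assumes "size (w :: nat multiset) \<ge> 2"
  obtains x y where "w = x + y" "x \<noteq> {#}" "y \<noteq> {#}" "size y = size w - 1"
proof -
  obtain n w' where w: "w = add_mset n w'" using assms by (cases w) auto
  show thesis by (rule that[of "{#n#}" w']) (use assms w in auto)
qed

lemma sq_AB: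
  assumes "obeys E law_AB" "size w \<ge> 2" "E S w"
  shows "E S (sq (set_mset w))"
proof -
  obtain x y where w: "w = x + y" "x \<noteq> {#}" "y \<noteq> {#}" using assms(2) by (rule size_ge2E)
  have "E S (w + w)" using cut1[OF AB[OF assms(1) w(2,3)], of S] assms(3) by (simp add: w(1) add_ac)
  moreover have "w \<noteq> {#}" using w by auto
  ultimately show ?thesis using double_iff by simp
qed

lemma sq_ABC:
  assumes "obeys E law_ABC" "size w \<ge> 3" "E S w"
  shows "E S (sq (set_mset w))"
proof -
  obtain x y where w: "w = x + y" "x \<noteq> {#}" "y \<noteq> {#}" "size y = size w - 1"
    by (rule size_ge2E[of w]) (use assms(2) in linarith)
  obtain y' z where y: "y = y' + z" "y' \<noteq> {#}" "z \<noteq> {#}"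
    by (rule size_ge2E[of y]) (use assms(2) w(4) in linarith)
  have "E S (w + w)" using cut1[OF ABC[OF assms(1) w(2) y(2,3)], of S] assms(3) by (simp add: w(1) y(1) add_ac)
  moreover have "w \<noteq> {#}" using w by auto
  ultimately show ?thesis using double_iff by simp
qed

end

subsection \<open>Combinatorial conditions\<close>

text \<open>For each generating algebra \<open>X\<close>, the condition on \<open>S\<close> and \<open>w\<close> that is necessary for \<open>w \<le> \<Sum>S\<close>
  to hold in \<open>X\<close> and is used in derivations. In \<open>cond_AB\<close>, the elements \<open>a\<close>, \<open>b\<close>, \<open>ab\<close>, \<open>\<infinity>\<close> of \<open>S\<^sub>c(ab)\<close> are
  represented by words in the letters \<open>0\<close> and \<open>1\<close>, and valuations by substitutions.\<close>

definition cond_D2 :: "nat multiset set \<Rightarrow> nat multiset \<Rightarrow> bool" where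
  "cond_D2 S w \<longleftrightarrow> (\<exists>u\<in>S. set_mset u \<subseteq> set_mset w)"

definition cond_M2 :: "nat multiset set \<Rightarrow> nat multiset \<Rightarrow> bool" where
  "cond_M2 S w \<longleftrightarrow> set_mset w \<subseteq> \<Union> (set_mset ` S)"

definition cond_T2 :: "nat multiset set \<Rightarrow> nat multiset \<Rightarrow> bool" where
  "cond_T2 S w \<longleftrightarrow> w \<in> S \<or> (\<exists>u\<in>S. size u \<ge> 2)"

definition cond_M20 :: "nat multiset set \<Rightarrow> nat multiset \<Rightarrow> bool" where
  "cond_M20 S w \<longleftrightarrow> set_mset w \<subseteq> \<Union> (set_mset ` {u \<in> S. set_mset u \<subseteq> set_mset w})"

definition cond_T20 :: "nat multiset set \<Rightarrow> nat multiset \<Rightarrow> bool" where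
  "cond_T20 S w \<longleftrightarrow> (size w \<ge> 2 \<longrightarrow> (\<exists>u\<in>S. size u \<ge> 2 \<and> set_mset u \<subseteq> set_mset w))"

definition cond_AB :: "nat multiset set \<Rightarrow> nat multiset \<Rightarrow> bool" where
  "cond_AB S w \<longleftrightarrow> (\<forall>\<sigma>. (\<forall>n. \<sigma> n \<in> {{#0#}, {#1#}, {#0, 1#}, {#0, 0, 1, 1#}}) \<longrightarrow>
     (\<forall>u\<in>S. sub \<sigma> u = {#0, 1#}) \<longrightarrow> sub \<sigma> w = {#0, 1#})"

context base_consequence
begin

text \<open>Under \<open>law_AB\<close> a word of length at least two is worth \<open>sq\<close> of its content, so only letters and
  contents matter. To derive \<open>w\<close>, unless it belongs to \<open>S\<close>, first find a set \<open>C\<close> inside the content of \<open>w\<close> for which \<open>sq C\<close> is derivable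
  (the task of \<open>D2\<close>, \<open>T2\<close> and \<open>T20\<close>), then enlarge it to the content of \<open>w\<close>
  (the task of \<open>M2\<close> and \<open>M20\<close>). Under \<open>law_D2\<close> the order is reversed, as \<open>sq\<close> may be
  restricted to smaller contents.\<close>

lemma derive_AB_case:
  assumes S: "good S" and w: "w \<noteq> {#}" and AB: "obeys E law_AB"
    and D2: "obeys E law_D2 \<or> cond_D2 S w" and M2: "obeys E law_M2 \<or> cond_M2 S w"
    and T2: "obeys E law_T2 \<or> cond_T2 S w" and M20: "obeys E law_M20 \<or> cond_M20 S w"
    and T20: "obeys E law_T20 \<or> cond_T20 S w"
  shows "E S w"
proof -
  have S': "E S u" "u \<noteq> {#}" "set_mset u \<noteq> {}" if "u \<in> S" for u using that refl S by (auto simp: good_def)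
  have finS: "finite S" using S by (auto simp: good_def)
  have all: "E S (sq (C \<union> \<Union> (set_mset ` S)))" if "finite C" "C \<noteq> {}" "E S (sq C)" for C
    by (rule sq_absorb_all) (use that finS S' in auto)
  have long: "E S (sq (set_mset u))" if "u \<in> S" "size u \<ge> 2" for u
    using sq_AB[OF AB that(2)] S'(1)[OF that(1)] by blast
  have single: "size u \<ge> 2 \<or> (\<exists>n. u = {#n#})" if "u \<in> S \<or> u = w" for u
  proof -
    have "size u \<noteq> 0" using that S'(2)[of u] w by auto
    then have "size u = 1 \<or> size u \<ge> 2" by linarith
    then show ?thesis using size_1_singleton_mset[of u] by blast
  qed
  have fill: "E S w" if C: "finite C" "C \<noteq> {}" "E S (sq C)" "C \<subseteq> set_mset w" for C
  proof -
    have "E S (sq (set_mset w))"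
    proof (cases "obeys E law_M2")
      case True
      then show ?thesis using sq_M2[OF True C(1,2) _ C(3), of "set_mset w"] C(4) by (simp add: sup.absorb2)
    next
      case False
      then have m2: "set_mset w \<subseteq> \<Union> (set_mset ` S)" using M2 by (simp add: cond_M2_def)
      show ?thesis
      proof (cases "obeys E law_M20")
        case True
        show ?thesis
          by (rule sq_M20[OF True _ C(4) _ C(2,3) all[OF C(1-3)]]) (use C finS m2 in auto)
      next
        case False
        then have "set_mset w \<subseteq> \<Union> (set_mset ` {u \<in> S. set_mset u \<subseteq> set_mset w})"
          using M20 by (simp add: cond_M20_def)
        then have "C \<union> \<Union> (set_mset ` {u \<in> S. set_mset u \<subseteq> set_mset w}) = set_mset w"
          using C(4) by blast
        moreover have "E S (sq (C \<union> \<Union> (set_mset ` {u \<in> S. set_mset u \<subseteq> set_mset w})))"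
          by (rule sq_absorb_all) (use C finS S' in auto)
        ultimately show ?thesis by simp
      qed
    qed
    then show ?thesis by (rule below_sq[OF w])
  qed
  show ?thesis
  proof (cases "obeys E law_D2")
    case False
    then obtain u where u: "u \<in> S" "set_mset u \<subseteq> set_mset w" using D2 by (auto simp: cond_D2_def)
    show ?thesis
    proof (cases "size u \<ge> 2")
      case True
      then show ?thesis using fill[OF _ S'(3) long] u by auto
    next
      case False
      then obtain n where n: "u = {#n#}" using single[of u] u by auto
      show ?thesis
      proof (cases "size w \<ge> 2")
        case False
        then have "w = u" using single[of w] u n by auto
        then show ?thesis using u S' by auto
      next
        case w2: True
        have "E S (sq {n}) \<or> cond_T20 S w"
        proof (cases "obeys E law_T20")
          case t: True
          show ?thesis
          proof (cases "obeys E law_T2")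
            case True
            then show ?thesis using sq_T2 S'(1)[OF u(1)] n by auto
          next
            case False
            then consider "w \<in> S" | u' where "u' \<in> S" "size u' \<ge> 2"
              using T2 by (auto simp: cond_T2_def)
            then show ?thesis
            proof cases
              case 1 then show ?thesis using w2 by (auto simp: cond_T20_def)
            next
              case 2
              have "E S (sq (set_mset u' \<union> set_mset u))"
                by (rule sq_absorb) (use 2 S' u long in auto)
              then show ?thesis using sq_T20[OF t, of "set_mset u' \<union> set_mset u" n S] S'(1)[OF u(1)] n by auto
            qed
          qed
        qed (use T20 in auto)
        then show ?thesis
        proof
          assume "E S (sq {n})"
          then show ?thesis using fill[of "{n}"] u n by auto
        next
          assume "cond_T20 S w"
          then obtain u' where "u' \<in> S" "size u' \<ge> 2" "set_mset u' \<subseteq> set_mset w"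
            using w2 by (auto simp: cond_T20_def)
          then show ?thesis using fill[OF _ S'(3) long] by auto
        qed
      qed
    qed
  next
    case d2: True
    have "w \<in> S \<or> (\<exists>u\<in>S. E S (sq (set_mset u)))"
    proof (cases "obeys E law_T2")
      case True
      obtain u where u: "u \<in> S" using S by (auto simp: good_def)
      then consider "size u \<ge> 2" | n where "u = {#n#}" using single[of u] by auto
      then show ?thesis
      proof cases
        case 1 then show ?thesis using long[OF u] u by blast
      next
        case 2 then show ?thesis using sq_T2[OF True, of S n] S'(1)[OF u] u by force
      qed
    next
      case False
      then show ?thesis using T2 long by (auto simp: cond_T2_def)
    qed
    then show ?thesis
    proof
      assume "\<exists>u\<in>S. E S (sq (set_mset u))"
      then obtain u where u: "u \<in> S" "E S (sq (set_mset u))" by auto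
      have "\<exists>C. finite C \<and> set_mset w \<subseteq> C \<and> E S (sq C)"
      proof (cases "obeys E law_M2")
        case True
        show ?thesis
          using sq_M2[OF True _ S'(3)[OF u(1)] _ u(2), of "set_mset w"]
          by (intro exI[of _ "set_mset u \<union> set_mset w"]) auto
      next
        case False
        then have "set_mset w \<subseteq> \<Union> (set_mset ` S)" using M2 by (simp add: cond_M2_def)
        then show ?thesis using all[OF _ S'(3)[OF u(1)] u(2)] finS
          by (intro exI[of _ "set_mset u \<union> \<Union> (set_mset ` S)"]) auto
      qed
      then show ?thesis using sq_D2[OF d2] below_sq[OF w] w by (metis set_mset_eq_empty_iff)
    qed (use S' in auto)
  qed
qed

text \<open>Substituting \<open>x\<^sup>2\<close> for both ends of the path and \<open>x\<^sup>2y\<^sup>2\<close> for its inner vertices makes all three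
  edges equal to \<open>x\<^sup>2y\<^sup>2\<close> and the closing edge equal to \<open>x\<^sup>2\<close>.\<close>

lemma path_imp_D2:
  assumes "obeys E law_path"
  shows "obeys E law_D2"
proof -
  let ?x = "{#0#} :: nat multiset" and ?y = "{#1#} :: nat multiset"
  let ?u = "?x + ?x + ?y + ?y"
  have "E {?x + ?x + ?u, ?u + ?u, ?u + (?x + ?x)} (?x + ?x + (?x + ?x))"
    by (rule path[OF assms]) auto
  moreover have u: "?u = {#0, 1#} + {#0, 1#}" by simp
  have e: "E {?u} (sq {0, 1})" using double_iff[of "{#0, 1#}" "{?u}"] refl[of ?u "{?u}"] unfolding u by simp
  have t: "?x + ?x + ?u = {#0, 0, 1#} + {#0, 0, 1#}" "?u + ?u = {#0, 0, 1, 1#} + {#0, 0, 1, 1#}"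
    "?u + (?x + ?x) = {#0, 0, 1#} + {#0, 0, 1#}" by auto
  have "E {?u} t" if "t \<in> {?x + ?x + ?u, ?u + ?u, ?u + (?x + ?x)}" for t
    using e double_iff[of "{#0, 0, 1#}" "{?u}"] double_iff[of "{#0, 0, 1, 1#}" "{?u}"] that
    unfolding t by auto
  ultimately have "E {?u} (?x + ?x + (?x + ?x))" using cut by blast
  then have "E {?u} (?x + ?x)"
    using double_iff[of ?x "{?u}"] double_iff[of "?x + ?x" "{?u}"] by simp
  then show ?thesis by (simp add: obeys_def law_D2_def add_mset_commute)
qed

text \<open>In the remaining case the two-letter words derivable from \<open>S\<close> are the edges of a graph in which
  every walk of length three closes up, so a graph whose components are complete bipartite unless it
  has a loop. A loop makes every word derivable; otherwise the two-colourings of the graph are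
  the valuations that \<open>cond_AB\<close> speaks about.\<close>

lemma derive_path_case:
  assumes S: "good S" and w: "w \<noteq> {#}" and ABC: "obeys E law_ABC" and path: "obeys E law_path"
    and M2: "obeys E law_M2 \<or> cond_M2 S w" and AB: "cond_AB S w"
  shows "E S w"
proof (rule ccontr)
  assume nw: "\<not> E S w"
  have S': "E S u" "u \<noteq> {#}" "set_mset u \<noteq> {}" if "u \<in> S" for u using that refl S by (auto simp: good_def)
  have finS: "finite S" using S by (auto simp: good_def)
  have nosq: "\<not> E S (sq C)" if "finite C" "C \<noteq> {}" for C
  proof
    assume C: "E S (sq C)"
    have "\<exists>D. finite D \<and> set_mset w \<subseteq> D \<and> E S (sq D)"
    proof (cases "obeys E law_M2")
      case True
      show ?thesis
        using sq_M2[OF True that _ C, of "set_mset w"] that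
        by (intro exI[of _ "C \<union> set_mset w"]) auto
    next
      case False
      then have "set_mset w \<subseteq> \<Union> (set_mset ` S)" using M2 by (simp add: cond_M2_def)
      moreover have "E S (sq (C \<union> \<Union> (set_mset ` S)))"
        by (rule sq_absorb_all) (use that C finS S' in auto)
      ultimately show ?thesis using finS that
        by (intro exI[of _ "C \<union> \<Union> (set_mset ` S)"]) auto
    qed
    then show False
      using nw sq_D2[OF path_imp_D2[OF path]] below_sq[OF w] w by (metis set_mset_eq_empty_iff)
  qed
  define e where "e p q \<longleftrightarrow> E S {#p, q#}" for p q
  have sym: "e p q \<Longrightarrow> e q p" for p q by (simp add: e_def add_mset_commute)
  have irr: "\<not> e p p" for p using nosq[of "{p}"] by (simp add: e_def sq_def)
  have p4: "e p s" if "e p q" "e q r" "e r s" for p q r s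
    unfolding e_def
  proof (rule cut)
    show "E {{#p, q#}, {#q, r#}, {#r, s#}} {#p, s#}"
      using consequence.path[OF consequence_axioms assms(4), of "{#p#}" "{#q#}" "{#r#}" "{#s#}"] by (simp add: add_mset_commute)
  qed (use that in \<open>auto simp: e_def\<close>)
  have letter: "\<not> e p q" if "E S {#p#}" for p q
  proof
    assume "e p q"
    then have "E S {#p, q, q#}"
      using cut[OF letter_edge[of "{#p#}" "{#q#}"], of S] that by (auto simp: e_def add_mset_commute)
    then show False using sq_ABC[OF ABC, of "{#p, q, q#}" S] nosq[of "{p, q}"] by auto
  qed
  have short: "(\<exists>n. u = {#n#} \<and> E S {#n#}) \<or> (\<exists>p q. u = {#p, q#} \<and> e p q)" if u: "u \<in> S" for u
  proof -
    have "size u < 3" using sq_ABC[OF ABC _ S'(1)[OF u]] nosq[OF _ S'(3)[OF u]] by (meson finite_set_mset not_less)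
    moreover obtain p u' where p: "u = add_mset p u'" using S'(2)[OF u] by (cases u) auto
    ultimately have "u' = {#} \<or> (\<exists>q. u' = {#q#})"
      by (cases u') auto
    then show ?thesis using S'(1)[OF u] by (auto simp: p e_def)
  qed
  \<comment> \<open>The two sides of the component of \<open>p\<close> have least elements \<open>m p\<close> and \<open>m (m p)\<close>;
    comparing them selects one proper colouring of the whole graph.\<close>
  define m where "m p = (LEAST q. e p q)" for p
  define f where "f p \<longleftrightarrow> m (m p) < m p" for p
  have m: "e p (m p)" if "e p q" for p q unfolding m_def by (rule LeastI[of "e p", OF that])
  have swap: "m q = m (m p)" if "e p q" for p q
  proof -
    have "e q r \<longleftrightarrow> e (m p) r" for r using p4 sym m[OF that] that by meson
    then have "e q = e (m p)" by (intro ext)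
    then show ?thesis unfolding m_def[of q] m_def[of "m p"] by simp
  qed
  have ne: "m p \<noteq> m q" if "e p q" for p q
    using m[OF that] m[OF sym[OF that]] that p4 sym irr by metis
  have f: "f p \<noteq> f q" if "e p q" for p q
    using swap[OF that] swap[OF sym[OF that]] ne[OF that] by (auto simp: f_def)
  define col where "col B n = (if \<exists>q. e n q then if f n \<noteq> (n \<in> B) then {#0#} else {#1#}
      else if E S {#n#} then {#0, 1#} else {#0, 0, 1, 1 :: nat#})" for B n
  have col: "sub (col B) w = {#0, 1#}" if B: "\<And>p q. e p q \<Longrightarrow> p \<in> B \<longleftrightarrow> q \<in> B" for B
  proof (rule AB[unfolded cond_AB_def, rule_format])
    show "col B n \<in> {{#0#}, {#1#}, {#0, 1#}, {#0, 0, 1, 1#}}" for n by (auto simp: col_def)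
    fix u assume u: "u \<in> S"
    from short[OF u] show "sub (col B) u = {#0, 1#}"
    proof (elim disjE exE conjE)
      fix n assume "u = {#n#}" "E S {#n#}" then show ?thesis using letter by (auto simp: col_def)
    next
      fix p q assume pq: "u = {#p, q#}" "e p q"
      then have "f p \<noteq> f q" "p \<in> B \<longleftrightarrow> q \<in> B" "\<exists>r. e p r" "\<exists>r. e q r" using f B sym by blast+
      then show ?thesis by (auto simp: pq(1) col_def)
    qed
  qed
  have single: "E S {#n#}" if "col B n = {#0, 1#}" for B n
    using that by (auto simp: col_def split: if_splits)
  have edge: "(\<exists>r. e p r) \<and> (f p \<noteq> (p \<in> B)) = (c = 0)" if "col B p = {#c#}" for B p c
    using that by (auto simp: col_def split: if_splits)
  have colne: "col B n \<noteq> {#}" for B n by (auto simp: col_def)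
  have "sub (col {}) w = {#0, 1#}" by (rule col) simp
  from two_letters[OF w this colne] show False
  proof (elim disjE exE conjE)
    fix n assume "w = {#n#}" "col {} n = {#0, 1#}"
    then show False using nw single by blast
  next
    fix p q assume pq: "w = {#p, q#}" "col {} p = {#0#}" "col {} q = {#1#}"
    have ex: "\<exists>r. e p r" "\<exists>r. e q r" and fpq: "f p" "\<not> f q" using edge[OF pq(2)] edge[OF pq(3)] by auto
    then have mp: "e p (m p)" using m by blast
    define K where "K = {r. e p r \<or> e (m p) r}"
    have K: "r \<in> K \<longleftrightarrow> s \<in> K" if "e r s" for r s
      using that mp p4 sym unfolding K_def by (metis mem_Collect_eq)
    have "\<not> e p q" using nw by (simp add: pq(1) e_def)
    moreover have "\<not> e (m p) q" using f[OF mp] f[of "m p" q] fpq by auto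
    ultimately have "q \<notin> K" "p \<in> K" using sym[OF mp] by (auto simp: K_def)
    then have "col K p = {#1#}" "col K q = {#1#}" using ex fpq by (auto simp: col_def)
    then show False using col[of K, OF K] by (simp add: pq(1))
  qed
qed

end

section \<open>The generating algebras\<close>

lemma comm_ai_adjoin_zero:
  assumes "comm_ai S"
  shows "comm_ai (adjoin_zero S)"
proof -
  interpret comm_ai_semiring S by unfold_locales (rule assms)
  have *: "x \<in> elems (adjoin_zero S) \<longleftrightarrow> x = None \<or> (\<exists>a\<in>elems S. x = Some a)" for x
    by (auto simp: adjoin_zero_def)
  show ?thesis
    unfolding comm_ai_def ai_semiring_def
  proof (intro conjI ballI)
    fix x y z assume "x \<in> elems (adjoin_zero S)" "y \<in> elems (adjoin_zero S)" "z \<in> elems (adjoin_zero S)"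
    then show "sadd (adjoin_zero S) (sadd (adjoin_zero S) x y) z = sadd (adjoin_zero S) x (sadd (adjoin_zero S) y z)"
      "smul (adjoin_zero S) (smul (adjoin_zero S) x y) z = smul (adjoin_zero S) x (smul (adjoin_zero S) y z)"
      "smul (adjoin_zero S) x (sadd (adjoin_zero S) y z)
        = sadd (adjoin_zero S) (smul (adjoin_zero S) x y) (smul (adjoin_zero S) x z)"
      "smul (adjoin_zero S) (sadd (adjoin_zero S) x y) z
        = sadd (adjoin_zero S) (smul (adjoin_zero S) x z) (smul (adjoin_zero S) y z)"
      unfolding * by (auto simp: adjoin_zero_def laws split: option.split)
  next
    fix x y assume "x \<in> elems (adjoin_zero S)" "y \<in> elems (adjoin_zero S)"
    then show "sadd (adjoin_zero S) x y \<in> elems (adjoin_zero S)"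
      "smul (adjoin_zero S) x y \<in> elems (adjoin_zero S)"
      "sadd (adjoin_zero S) x y = sadd (adjoin_zero S) y x"
      "smul (adjoin_zero S) x y = smul (adjoin_zero S) y x"
      unfolding * by (auto simp: adjoin_zero_def closed ai_add[OF ai] mul_comm split: option.split)
  next
    fix x assume "x \<in> elems (adjoin_zero S)"
    then show "sadd (adjoin_zero S) x x = x"
      unfolding * by (auto simp: adjoin_zero_def ai_add[OF ai])
  qed (auto simp: adjoin_zero_def)
qed

lemma comm_ai_D2: "comm_ai D2" unfolding comm_ai_def ai_semiring_def D2_def by auto
lemma comm_ai_M2: "comm_ai M2" unfolding comm_ai_def ai_semiring_def M2_def by auto
lemma comm_ai_T2: "comm_ai T2" unfolding comm_ai_def ai_semiring_def T2_def by auto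

lemma comm_ai_S7: "comm_ai S7" unfolding comm_ai_def ai_semiring_def S7_def by auto

text \<open>A copy of \<open>Sc_ab\<close> on a plain enumeration.\<close>

datatype sab = SA | SB | SAB | SInf

definition Sab :: "sab alg" where
  "Sab = \<lparr>elems = UNIV, sadd = (\<lambda>x y. if x = y then x else SInf),
     smul = (\<lambda>x y. if x = SA \<and> y = SB \<or> x = SB \<and> y = SA then SAB else SInf)\<rparr>"

lemma comm_ai_Sab: "comm_ai Sab" unfolding comm_ai_def ai_semiring_def Sab_def
  by (auto; (metis sab.exhaust)?)

fun sab_elem :: "letter multiset option \<Rightarrow> sab" where
  "sab_elem None = SInf"
| "sab_elem (Some u) = (if u = {#La#} then SA else if u = {#Lb#} then SB else SAB)"

lemma letter_all: "(\<forall>l. P l) \<longleftrightarrow> P La \<and> P Lb"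
  by (metis letter.exhaust)

lemma subset_ab: "u \<noteq> {#} \<and> u \<subseteq># {#La, Lb#} \<longleftrightarrow> u \<in> {{#La#}, {#Lb#}, {#La, Lb#}}"
proof -
  have "u \<in> {{#}, {#La#}, {#Lb#}, {#La, Lb#}}" if "u \<subseteq># {#La, Lb#}"
  proof -
    have "count u La \<le> 1" "count u Lb \<le> 1"
      using mset_subset_eq_count[OF that, of La] mset_subset_eq_count[OF that, of Lb] by auto
    then have c: "count u La = 0 \<or> count u La = 1" "count u Lb = 0 \<or> count u Lb = 1" by linarith+
    then show ?thesis by (auto simp: multiset_eq_iff letter_all)
  qed
  then show ?thesis by (auto simp: add_mset_commute)
qed

lemma elems_Sc_ab: "elems Sc_ab = {None, Some {#La#}, Some {#Lb#}, Some {#La, Lb#}}"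
  unfolding Sc_ab_def Sc_def by (auto simp: subset_ab)

lemma Sc_ab_mul:
  "smul Sc_ab (Some {#La#}) (Some {#Lb#}) = Some {#La, Lb#}"
  "smul Sc_ab (Some {#Lb#}) (Some {#La#}) = Some {#La, Lb#}"
  "smul Sc_ab (Some {#La#}) (Some {#La#}) = None"
  "smul Sc_ab (Some {#Lb#}) (Some {#Lb#}) = None"
  "smul Sc_ab (Some {#La#}) (Some {#La, Lb#}) = None"
  "smul Sc_ab (Some {#Lb#}) (Some {#La, Lb#}) = None"
  "smul Sc_ab (Some {#La, Lb#}) (Some u) = None \<or> u = {#}"
  "smul Sc_ab None y = None" "smul Sc_ab x None = None"
proof -
  show "smul Sc_ab (Some {#La, Lb#}) (Some u) = None \<or> u = {#}"
    by (simp add: Sc_ab_def Sc_def)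
qed (auto simp: Sc_ab_def Sc_def subseteq_mset_def letter_all add_mset_commute split: option.split)

lemma Sc_ab_hom: "sab_elem \<in> alg_hom Sc_ab Sab" "bij_betw sab_elem (elems Sc_ab) (elems Sab)"
proof -
  have mul: "smul Sc_ab (Some {#La, Lb#}) (Some {#La#}) = None"
    "smul Sc_ab (Some {#La, Lb#}) (Some {#Lb#}) = None"
    "smul Sc_ab (Some {#La, Lb#}) (Some {#La, Lb#}) = None"
    using Sc_ab_mul(7)[of "{#La#}"] Sc_ab_mul(7)[of "{#Lb#}"] Sc_ab_mul(7)[of "{#La, Lb#}"] by simp_all
  have add: "sadd Sc_ab x y = (if x = y then x else None)" for x y
    by (simp add: Sc_ab_def Sc_def)
  show "sab_elem \<in> alg_hom Sc_ab Sab"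
    unfolding alg_hom_def
  proof (intro CollectI conjI ballI)
    fix x y assume "x \<in> elems Sc_ab" "y \<in> elems Sc_ab"
    then have x: "x = None \<or> x = Some {#La#} \<or> x = Some {#Lb#} \<or> x = Some {#La, Lb#}"
      and y: "y = None \<or> y = Some {#La#} \<or> y = Some {#Lb#} \<or> y = Some {#La, Lb#}"
      unfolding elems_Sc_ab by simp_all
    show "sab_elem (sadd Sc_ab x y) = sadd Sab (sab_elem x) (sab_elem y)"
      using x y by (elim disjE) (simp_all add: add Sab_def)
    show "sab_elem (smul Sc_ab x y) = smul Sab (sab_elem x) (sab_elem y)"
      using x y by (elim disjE) (simp_all add: Sc_ab_mul mul Sab_def)
  qed (auto simp: Sab_def)
  have "x \<in> {SA, SB, SAB, SInf}" for x by (cases x) auto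
  then have "{SA, SB, SAB, SInf} = UNIV" by blast
  then show "bij_betw sab_elem (elems Sc_ab) (elems Sab)"
    unfolding bij_betw_def elems_Sc_ab Sab_def by (simp add: insert_commute)
qed

subsection \<open>Necessary conditions\<close>

lemma le_adjoin [simp]:
  "le (adjoin_zero S) None y" "le (adjoin_zero S) (Some a) (Some b) \<longleftrightarrow> le S a b"
  "\<not> le (adjoin_zero S) (Some a) None"
  by (auto simp: le_def adjoin_zero_def split: option.split)

lemma le_two: "le D2 x y \<longleftrightarrow> x \<le> y" "le M2 x y \<longleftrightarrow> x \<le> y" "le T2 x y \<longleftrightarrow> x \<le> y"
  by (auto simp: le_def D2_def M2_def T2_def)

lemma le_Sab: "le Sab x y \<longleftrightarrow> x = y \<or> y = SInf"
  by (auto simp: le_def Sab_def)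

lemma two_ops:
  "smul D2 = min" "smul M2 = max" "smul T2 = (\<lambda>x y. 1)"
  "elems D2 = {0, 1}" "elems M2 = {0, 1}" "elems T2 = {0, 1}"
  by (simp_all add: D2_def M2_def T2_def)

lemma adjoin_ops:
  "smul (adjoin_zero S) None y = None" "smul (adjoin_zero S) x None = None"
  "smul (adjoin_zero S) (Some a) (Some b) = Some (smul S a b)"
  "elems (adjoin_zero S) = insert None (Some ` elems S)"
  by (auto simp: adjoin_zero_def split: option.split)

lemma entD:
  assumes "ent A S w" "range v \<subseteq> elems A" "z \<in> elems A" "\<And>u. u \<in> S \<Longrightarrow> le A (wval A v u) z"
  shows "le A (wval A v w) z"
  using assms unfolding ent_def by blast

text \<open>When a condition fails, a single valuation refutes \<open>w \<le> \<Sum>S\<close>. For \<open>D2\<close> and the algebras with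
  zero it sends the letters outside \<open>w\<close> to the least element, for \<open>M2\<close> it singles out the letters occurring in \<open>S\<close>,
  and for \<open>T2\<close> the letters that are themselves words of \<open>S\<close>.\<close>

lemma ent_D2:
  assumes e: "ent D2 S w" and S: "good S" "w \<noteq> {#}"
  shows "cond_D2 S w"
proof (rule ccontr)
  assume n: "\<not> cond_D2 S w"
  interpret comm_ai_semiring D2 by unfold_locales (rule comm_ai_D2)
  define v where "v n = (if n \<in># w then 1 else 0 :: nat)" for n
  have v: "range v \<subseteq> elems D2" by (auto simp: v_def two_ops)
  have val: "wval D2 v u = (if set_mset u \<subseteq> set_mset w then 1 else 0)" if "u \<noteq> {#}" for u
    using that by (induction u rule: nonempty_mset_induct) (simp_all add: wval_add[OF v] wval_single[OF v], auto simp: v_def two_ops)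
  have ne: "u \<noteq> {#}" if "u \<in> S" for u using that S by (auto simp: good_def)
  have "le D2 (wval D2 v w) 0"
    by (rule entD[OF e v]) (use n S ne in \<open>auto simp: val le_two cond_D2_def good_def two_ops\<close>)
  then show False using S by (simp add: val le_two)
qed

lemma ent_M2:
  assumes e: "ent M2 S w" and S: "good S" "w \<noteq> {#}"
  shows "cond_M2 S w"
proof (rule ccontr)
  assume n: "\<not> cond_M2 S w"
  interpret comm_ai_semiring M2 by unfold_locales (rule comm_ai_M2)
  define v where "v n = (if n \<in> \<Union> (set_mset ` S) then 0 else 1 :: nat)" for n
  have v: "range v \<subseteq> elems M2" by (auto simp: v_def two_ops)
  have val: "wval M2 v u = (if set_mset u \<subseteq> \<Union> (set_mset ` S) then 0 else 1)" if "u \<noteq> {#}" for u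
    using that by (induction u rule: nonempty_mset_induct) (simp_all add: wval_add[OF v] wval_single[OF v], auto simp: v_def two_ops)
  have "le M2 (wval M2 v w) 0"
  proof (rule entD[OF e v])
    fix u assume "u \<in> S"
    then have "u \<noteq> {#}" "set_mset u \<subseteq> \<Union> (set_mset ` S)" using S by (auto simp: good_def)
    then show "le M2 (wval M2 v u) 0" by (simp add: val le_two)
  qed (simp add: two_ops)
  then show False using S n by (simp add: val le_two cond_M2_def)
qed

lemma ent_T2:
  assumes e: "ent T2 S w" and S: "good S" "w \<noteq> {#}"
  shows "cond_T2 S w"
proof (rule ccontr)
  assume n: "\<not> cond_T2 S w"
  interpret comm_ai_semiring T2 by unfold_locales (rule comm_ai_T2)
  define v where "v n = (if {#n#} \<in> S then 0 else 1 :: nat)" for n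
  have v: "range v \<subseteq> elems T2" by (auto simp: v_def two_ops)
  have val: "wval T2 v u = (if size u \<ge> 2 then 1 else if u \<in> S then 0 else 1)" if "u \<noteq> {#}" for u
    using that
  proof (induction u rule: nonempty_mset_induct)
    case (add n u)
    then have "size u \<ge> 1" by (simp add: Suc_leI nonempty_has_size)
    then show ?case using add by (simp add: wval_add[OF v] two_ops)
  qed (simp_all add: wval_single[OF v], auto simp: v_def)
  have ne: "u \<noteq> {#}" if "u \<in> S" for u using that S by (auto simp: good_def)
  have "le T2 (wval T2 v w) 0"
    by (rule entD[OF e v]) (use n S ne in \<open>auto simp: val le_two cond_T2_def good_def two_ops\<close>)
  then show False using S n by (auto simp: val le_two cond_T2_def split: if_splits)
qed

lemma ent_M20:
  assumes e: "ent (adjoin_zero M2) S w" and S: "good S" "w \<noteq> {#}"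
  shows "cond_M20 S w"
proof (rule ccontr)
  assume n: "\<not> cond_M20 S w"
  interpret comm_ai_semiring "adjoin_zero M2" by unfold_locales (intro comm_ai_adjoin_zero comm_ai_M2)
  define U where "U = \<Union> (set_mset ` {u \<in> S. set_mset u \<subseteq> set_mset w})"
  define v where "v n = (if n \<notin># w then None else if n \<in> U then Some 0 else Some (1 :: nat))" for n
  have v: "range v \<subseteq> elems (adjoin_zero M2)" by (auto simp: v_def two_ops adjoin_ops)
  have val: "wval (adjoin_zero M2) v u = (if \<not> set_mset u \<subseteq> set_mset w then None
      else if set_mset u \<subseteq> U then Some 0 else Some 1)" if "u \<noteq> {#}" for u
    using that
    by (induction u rule: nonempty_mset_induct)
      (simp_all add: wval_add[OF v] wval_single[OF v], auto simp: v_def two_ops adjoin_ops)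
  have "le (adjoin_zero M2) (wval (adjoin_zero M2) v w) (Some 0)"
  proof (rule entD[OF e v])
    fix u assume u: "u \<in> S"
    then have "set_mset u \<subseteq> set_mset w \<Longrightarrow> set_mset u \<subseteq> U" by (auto simp: U_def)
    then show "le (adjoin_zero M2) (wval (adjoin_zero M2) v u) (Some 0)"
      using val[of u] u S by (cases "u = {#}") (auto simp: good_def le_two)
  qed (simp add: two_ops adjoin_ops)
  then show False using S n by (simp add: val le_two cond_M20_def U_def split: if_splits)
qed

lemma ent_T20:
  assumes e: "ent (adjoin_zero T2) S w" and S: "good S" "w \<noteq> {#}"
  shows "cond_T20 S w"
proof (rule ccontr)
  assume n: "\<not> cond_T20 S w"
  interpret comm_ai_semiring "adjoin_zero T2" by unfold_locales (intro comm_ai_adjoin_zero comm_ai_T2)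
  define v where "v n = (if n \<in># w then Some (0 :: nat) else None)" for n
  have v: "range v \<subseteq> elems (adjoin_zero T2)" by (auto simp: v_def two_ops adjoin_ops)
  have val: "wval (adjoin_zero T2) v u = (if \<not> set_mset u \<subseteq> set_mset w then None
      else if size u \<ge> 2 then Some 1 else Some 0)" if "u \<noteq> {#}" for u
    using that
  proof (induction u rule: nonempty_mset_induct)
    case (add n u)
    then have "size u \<ge> 1" by (simp add: Suc_leI nonempty_has_size)
    then show ?case using add by (simp add: wval_add[OF v]) (auto simp: v_def two_ops adjoin_ops)
  qed (simp_all add: wval_single[OF v], auto simp: v_def)
  have "le (adjoin_zero T2) (wval (adjoin_zero T2) v w) (Some 0)"
  proof (rule entD[OF e v])
    fix u assume u: "u \<in> S"
    then show "le (adjoin_zero T2) (wval (adjoin_zero T2) v u) (Some 0)"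
      using val[of u] S n by (cases "u = {#}") (auto simp: good_def le_two cond_T20_def)
  qed (simp add: two_ops adjoin_ops)
  then show False using S n by (simp add: val le_two cond_T20_def)
qed

fun sab_word :: "sab \<Rightarrow> nat multiset" where
  "sab_word SA = {#0#}" | "sab_word SB = {#1#}" | "sab_word SAB = {#0, 1#}"
| "sab_word SInf = {#0, 0, 1, 1#}"

lemma sab_word_nonempty: "sab_word c \<noteq> {#}" by (cases c) auto

lemma wval_Sab:
  assumes "u \<noteq> {#}" "c \<noteq> SInf"
  shows "wval Sab v u = c \<longleftrightarrow> sub (\<lambda>n. sab_word (v n)) u = sab_word c"
  using assms
proof (induction u arbitrary: c rule: nonempty_mset_induct)
  interpret comm_ai_semiring Sab by unfold_locales (rule comm_ai_Sab)
  have v: "range v \<subseteq> elems Sab" by (simp add: Sab_def)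
  case (single n) then show ?case by (cases "v n"; cases c) (auto simp: wval_single[OF v])
next
  interpret comm_ai_semiring Sab by unfold_locales (rule comm_ai_Sab)
  have v: "range v \<subseteq> elems Sab" by (simp add: Sab_def)
  case (add n u)
  let ?s = "sub (\<lambda>n. sab_word (v n)) u"
  have s: "?s \<noteq> {#}" using add(1) sub_nonempty[of "\<lambda>n. sab_word (v n)"] sab_word_nonempty by auto
  have ih: "wval Sab v u = SA \<longleftrightarrow> ?s = {#0#}" "wval Sab v u = SB \<longleftrightarrow> ?s = {#1#}"
    "wval Sab v u = SAB \<longleftrightarrow> ?s = {#0, 1#}" using add.IH[of SA] add.IH[of SB] add.IH[of SAB] by auto
  have m: "wval Sab v (add_mset n u) = smul Sab (v n) (wval Sab v u)" by (rule wval_add[OF v add(1)])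
  show ?case unfolding m sub_simps
    using s ih add.prems
    by (cases "v n"; cases c; cases "wval Sab v u") (auto simp: Sab_def add_eq_conv_ex add_mset_eq_single)
qed

text \<open>Products in \<open>S\<^sub>c(ab)\<close> are \<open>ab\<close> or \<open>\<infinity>\<close>, so only single letters can take the values \<open>a\<close> and \<open>b\<close>.\<close>

lemma Sab_letter:
  assumes "u \<noteq> {#}" "wval Sab v u = c" "c = SA \<or> c = SB"
  shows "\<exists>n. u = {#n#} \<and> v n = c"
proof -
  interpret comm_ai_semiring Sab by unfold_locales (rule comm_ai_Sab)
  have v: "range v \<subseteq> elems Sab" by (simp add: Sab_def)
  obtain n u' where u: "u = add_mset n u'" using assms(1) by (cases u) auto
  have "u' = {#}"
  proof (rule ccontr)
    assume "u' \<noteq> {#}"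
    then have "wval Sab v u = smul Sab (v n) (wval Sab v u')" by (simp add: u wval_add[OF v])
    then show False using assms by (auto simp: Sab_def split: if_splits)
  qed
  then show ?thesis using assms u by (auto simp: wval_single[OF v])
qed

lemma ent_Sab_iff:
  assumes S: "good S" and w: "w \<noteq> {#}"
  shows "ent Sab S w \<longleftrightarrow> cond_AB S w"
proof
  assume e: "ent Sab S w"
  show "cond_AB S w" unfolding cond_AB_def
  proof (intro allI impI)
    fix \<sigma> :: "nat \<Rightarrow> nat multiset"
    assume \<sigma>: "\<forall>n. \<sigma> n \<in> {{#0#}, {#1#}, {#0, 1#}, {#0, 0, 1, 1#}}" and u: "\<forall>u\<in>S. sub \<sigma> u = {#0, 1#}"
    have "\<exists>v. \<forall>n. \<sigma> n = sab_word (v n)"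
    proof (rule choice, rule allI)
      fix n show "\<exists>c. \<sigma> n = sab_word c" using \<sigma>[rule_format, of n] sab_word.simps by (metis empty_iff insert_iff)
    qed
    then obtain v where v: "\<sigma> = (\<lambda>n. sab_word (v n))" by auto
    have "le Sab (wval Sab v w) SAB"
    proof (rule entD[OF e])
      fix x assume x: "x \<in> S"
      then have "x \<noteq> {#}" using S by (auto simp: good_def)
      then have "wval Sab v x = SAB" using u x wval_Sab[of x SAB v] by (simp add: v)
      then show "le Sab (wval Sab v x) SAB" by (simp add: le_Sab)
    qed (auto simp: Sab_def)
    then show "sub \<sigma> w = {#0, 1#}" using wval_Sab[OF w, of SAB v] by (simp add: v le_Sab)
  qed
next
  assume c: "cond_AB S w"
  interpret comm_ai_semiring Sab by unfold_locales (rule comm_ai_Sab)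
  have v: "range v \<subseteq> elems Sab" for v :: "nat \<Rightarrow> sab" by (simp add: Sab_def)
  have ne: "u \<noteq> {#}" if "u \<in> S" for u using that S by (auto simp: good_def)
  have top: "wval Sab v w = SAB" if "\<And>u. u \<in> S \<Longrightarrow> wval Sab v u = SAB" for v
  proof -
    have "sub (\<lambda>n. sab_word (v n)) w = {#0, 1#}"
    proof (rule c[unfolded cond_AB_def, rule_format])
      show "sab_word (v n) \<in> {{#0#}, {#1#}, {#0, 1#}, {#0, 0, 1, 1#}}" for n by (cases "v n") auto
      show "sub (\<lambda>n. sab_word (v n)) u = {#0, 1#}" if "u \<in> S" for u
        using wval_Sab[OF ne[OF that], of SAB v] \<open>\<And>u. u \<in> S \<Longrightarrow> wval Sab v u = SAB\<close>[OF that] by simp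
    qed
    then show ?thesis using wval_Sab[OF w, of SAB v] by simp
  qed
  show "ent Sab S w" unfolding ent_def
  proof (intro allI impI ballI)
    fix v :: "nat \<Rightarrow> sab" and z
    assume u: "\<forall>u\<in>S. le Sab (wval Sab v u) z"
    show "le Sab (wval Sab v w) z"
    proof (cases "z = SInf \<or> z = SAB")
      case True then show ?thesis using top[of v] u by (auto simp: le_Sab)
    next
      case False
      then have z: "z = SA \<or> z = SB" by (cases z) auto
      define v' where "v' n = (if v n = z then SAB else SInf)" for n
      have "wval Sab v' w = SAB"
      proof (rule top)
        fix u' assume u': "u' \<in> S"
        then have "wval Sab v u' = z" using u z by (auto simp: le_Sab)
        from Sab_letter[OF ne[OF u'] this z] show "wval Sab v' u' = SAB"
          by (auto simp: wval_single[OF v] v'_def)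
      qed
      then have sw: "sub (\<lambda>n. sab_word (v' n)) w = {#0, 1#}" using wval_Sab[OF w, of SAB v'] by simp
      from two_letters[OF w sw sab_word_nonempty] obtain n where "w = {#n#}" "sab_word (v' n) = {#0, 1#}"
        by (auto simp: v'_def split: if_splits)
      then show ?thesis by (auto simp: v'_def wval_single[OF v] le_Sab split: if_splits)
    qed
  qed
qed

section \<open>Splitting\<close>

definition doubled :: "nat multiset \<Rightarrow> bool" where
  "doubled x \<longleftrightarrow> x \<noteq> {#} \<and> (\<forall>c\<in>#x. 2 \<le> count x c)"

context base_consequence
begin

lemma subst_asg:
  assumes "E S w" "{#} \<notin> S" "w \<noteq> {#}" "x \<noteq> {#}" "y \<noteq> {#}" "z \<noteq> {#}" "t \<noteq> {#}"
  shows "E (sub (asg x y z t) ` S) (sub (asg x y z t) w)"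
  by (rule subst) (use assms in \<open>auto simp: asg_def\<close>)

lemma same_content: "doubled x \<Longrightarrow> doubled y \<Longrightarrow> set_mset x = set_mset y \<Longrightarrow> E {x} y"
  using double_content[of x] double_content[of y] cut1[of "sq (set_mset x)" y "{x}"]
  unfolding doubled_def by auto

text \<open>A map from an algebra \<open>X\<close> to words that is multiplicative up to derivability turns a valuation
  in \<open>X\<close> into a substitution, so a valuation refuting \<open>S \<turnstile> w\<close> in \<open>X\<close> produces a derivable
  consequence between words of the form \<open>\<iota> a\<close>.\<close>

lemma split_ent:
  assumes X: "comm_ai X"
    and \<iota>: "\<And>a. \<iota> a \<noteq> {#}"
    and mul: "\<And>a b. a \<in> elems X \<Longrightarrow> b \<in> elems X \<Longrightarrow> doubled (\<iota> a + \<iota> b) \<and> doubled (\<iota> (smul X a b))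
        \<and> set_mset (\<iota> a + \<iota> b) = set_mset (\<iota> (smul X a b))"
    and ref: "\<And>z b. z \<in> elems X \<Longrightarrow> b \<in> elems X \<Longrightarrow> \<not> le X b z \<Longrightarrow>
        E (\<iota> ` {a \<in> elems X. le X a z}) (\<iota> b) \<Longrightarrow> obeys E l"
    and S: "good S" "w \<noteq> {#}" "E S w" and l: "\<not> obeys E l"
  shows "ent X S w"
  unfolding ent_def
proof (intro allI impI ballI)
  fix v :: "nat \<Rightarrow> 'a" and z
  assume v: "range v \<subseteq> elems X" and z: "z \<in> elems X" "\<forall>u\<in>S. le X (wval X v u) z"
  interpret X: comm_ai_semiring X by unfold_locales (rule X)
  let ?\<sigma> = "\<lambda>n. \<iota> (v n)"
  have eq: "E {sub ?\<sigma> u} (\<iota> (wval X v u)) \<and> E {\<iota> (wval X v u)} (sub ?\<sigma> u)" if "u \<noteq> {#}" for u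
    using that
  proof (induction u rule: nonempty_mset_induct)
    case (single n) then show ?case by (simp add: X.wval_single[OF v] refl)
  next
    case (add n u)
    let ?a = "\<iota> (v n)" and ?b = "\<iota> (wval X v u)"
    have "sub ?\<sigma> u \<noteq> {#}" by (rule sub_nonempty) (use \<iota> add in auto)
    then have 1: "E {?a + sub ?\<sigma> u} (?a + ?b)" "E {?a + ?b} (?a + sub ?\<sigma> u)"
      using add.IH \<iota> by (auto intro!: mult1)
    have ve: "v n \<in> elems X" using v by auto
    note m = mul[OF ve X.wval_cl[OF v, of u]]
    have "E {?a + ?b} (\<iota> (smul X (v n) (wval X v u)))" "E {\<iota> (smul X (v n) (wval X v u))} (?a + ?b)"
      by (rule same_content; use m in simp)+
    then show ?case unfolding sub_simps X.wval_add[OF v add(1)] using 1 cut1 by blast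
  qed
  show "le X (wval X v w) z"
  proof (rule ccontr)
    assume n: "\<not> le X (wval X v w) z"
    have "E (sub ?\<sigma> ` S) (sub ?\<sigma> w)"
      by (rule subst) (use S \<iota> in \<open>auto simp: good_def\<close>)
    then have "E (\<iota> ` {a \<in> elems X. le X a z}) (sub ?\<sigma> w)"
    proof (rule cut)
      fix x assume "x \<in> sub ?\<sigma> ` S"
      then obtain u where u: "u \<in> S" "x = sub ?\<sigma> u" by auto
      then have "u \<noteq> {#}" using S by (auto simp: good_def)
      have "\<iota> (wval X v u) \<in> \<iota> ` {a \<in> elems X. le X a z}"
        using u z X.wval_cl[OF v] by blast
      from cut1[OF conjunct2[OF eq[OF \<open>u \<noteq> {#}\<close>]] refl[OF this]]
      show "E (\<iota> ` {a \<in> elems X. le X a z}) x" unfolding u(2) .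
    qed
    then have "E (\<iota> ` {a \<in> elems X. le X a z}) (\<iota> (wval X v w))"
      by (rule cut1[OF conjunct1[OF eq[OF S(2)]]])
    then show False using ref[OF z(1) X.wval_cl[OF v] n] l by blast
  qed
qed

lemma two_chain:
  assumes "z \<in> {0, 1 :: nat}" "b \<in> {0, 1}" "\<not> b \<le> z"
  shows "z = 0" "b = 1" "{a \<in> {0, 1}. a \<le> z} = {0}"
  using assms by auto

lemma split_D2:
  assumes S: "good S" "w \<noteq> {#}" "E S w" and l: "\<not> obeys E law_D2"
  shows "ent D2 S w"
proof (rule split_ent[OF comm_ai_D2 _ _ _ S l])
  let ?i = "\<lambda>a. if a = 0 then {#0, 0, 1, 1#} else {#0, 0#}"
  show "?i a \<noteq> {#}" for a by simp
  show "doubled (?i a + ?i b) \<and> doubled (?i (smul D2 a b))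
      \<and> set_mset (?i a + ?i b) = set_mset (?i (smul D2 a b))"
    if "a \<in> elems D2" "b \<in> elems D2" for a b
    using that by (auto simp: two_ops doubled_def)
  show "obeys E law_D2" if "z \<in> elems D2" "b \<in> elems D2" "\<not> le D2 b z"
    "E (?i ` {a \<in> elems D2. le D2 a z}) (?i b)" for z b
    using two_chain[of z b] that by (simp add: two_ops le_two obeys_def law_D2_def)
qed

lemma split_M2:
  assumes S: "good S" "w \<noteq> {#}" "E S w" and l: "\<not> obeys E law_M2"
  shows "ent M2 S w"
proof (rule split_ent[OF comm_ai_M2 _ _ _ S l])
  let ?i = "\<lambda>a. if a = 0 then {#0, 0#} else {#0, 0, 1, 1#}"
  show "?i a \<noteq> {#}" for a by simp
  show "doubled (?i a + ?i b) \<and> doubled (?i (smul M2 a b))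
      \<and> set_mset (?i a + ?i b) = set_mset (?i (smul M2 a b))"
    if "a \<in> elems M2" "b \<in> elems M2" for a b
    using that by (auto simp: two_ops doubled_def)
  show "obeys E law_M2" if "z \<in> elems M2" "b \<in> elems M2" "\<not> le M2 b z"
    "E (?i ` {a \<in> elems M2. le M2 a z}) (?i b)" for z b
    using two_chain[of z b] that by (simp add: two_ops le_two obeys_def law_M2_def)
qed

lemma split_T2:
  assumes S: "good S" "w \<noteq> {#}" "E S w" and l: "\<not> obeys E law_T2"
  shows "ent T2 S w"
proof (rule split_ent[OF comm_ai_T2 _ _ _ S l])
  let ?i = "\<lambda>a. if a = 0 then {#0#} else {#0, 0#}"
  show "?i a \<noteq> {#}" for a by simp
  show "doubled (?i a + ?i b) \<and> doubled (?i (smul T2 a b))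
      \<and> set_mset (?i a + ?i b) = set_mset (?i (smul T2 a b))"
    if "a \<in> elems T2" "b \<in> elems T2" for a b
    using that by (auto simp: two_ops doubled_def)
  show "obeys E law_T2" if "z \<in> elems T2" "b \<in> elems T2" "\<not> le T2 b z"
    "E (?i ` {a \<in> elems T2. le T2 a z}) (?i b)" for z b
    using two_chain[of z b] that by (simp add: two_ops le_two obeys_def law_T2_def)
qed

lemma split_M20:
  assumes S: "good S" "w \<noteq> {#}" "E S w" and l: "\<not> obeys E law_M20"
  shows "ent (adjoin_zero M2) S w"
proof (rule split_ent[OF comm_ai_adjoin_zero[OF comm_ai_M2] _ _ _ S l])
  let ?i = "\<lambda>a. case a of None \<Rightarrow> {#0, 0, 1, 1, 2, 2#} | Some b \<Rightarrow> if b = 0 then {#0, 0#} else {#0, 0, 1, 1#}"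
  let ?X = "adjoin_zero M2"
  have X: "a = None \<or> a = Some 0 \<or> a = Some 1" if "a \<in> elems ?X" for a
    using that by (auto simp: adjoin_ops two_ops)
  show "?i a \<noteq> {#}" for a by (auto split: option.split)
  show "doubled (?i a + ?i b) \<and> doubled (?i (smul ?X a b)) \<and> set_mset (?i a + ?i b) = set_mset (?i (smul ?X a b))"
    if "a \<in> elems ?X" "b \<in> elems ?X" for a b
    using X[OF that(1)] X[OF that(2)] by (auto simp: adjoin_ops two_ops doubled_def)
  have goal: "obeys E law_M20" if "E T {#0, 0, 1, 1#}" "T \<subseteq> {{#0, 0#}, {#0, 0, 1, 1, 2, 2#}}" for T
    using mono[OF that] by (simp add: obeys_def law_M20_def)
  show "obeys E law_M20" if z: "z \<in> elems ?X" "b \<in> elems ?X" "\<not> le ?X b z"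
    and e: "E (?i ` {a \<in> elems ?X. le ?X a z}) (?i b)" for z b
  proof -
    consider "z = None" "b = Some 0" | "z = None" "b = Some 1" | "z = Some 0" "b = Some 1"
      using X[OF z(1)] X[OF z(2)] z(3) by (auto simp: le_two)
    then show ?thesis
    proof cases
      case 1
      have "{a \<in> elems ?X. le ?X a z} = {None}" using X 1 by (auto simp: adjoin_ops)
      then have "E {{#0, 0, 1, 1, 2, 2#}} {#0, 0#}" using e 1 by simp
      from subst_asg[OF this, of "{#0, 1#}" "{#1#}" "{#2#}" "{#2#}"]
      have "E {{#0, 1, 0, 1, 1, 1, 2, 2#}} {#0, 1, 0, 1#}" by (simp add: add_mset_commute)
      moreover have "E {{#0, 0, 1, 1, 2, 2#}} {#0, 1, 0, 1, 1, 1, 2, 2#}"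
        by (rule same_content) (auto simp: doubled_def)
      ultimately have "E {{#0, 0, 1, 1, 2, 2#}} {#0, 1, 0, 1#}" by (rule cut1)
      then show ?thesis by (intro goal[of "{{#0, 0, 1, 1, 2, 2#}}"]) (auto simp: add_mset_commute)
    next
      case 2
      have "{a \<in> elems ?X. le ?X a z} = {None}" using X 2 by (auto simp: adjoin_ops)
      then show ?thesis using e 2 by (intro goal[of "{{#0, 0, 1, 1, 2, 2#}}"]) auto
    next
      case 3
      have "{a \<in> elems ?X. le ?X a z} = {None, Some 0}" using X 3 by (auto simp: adjoin_ops two_ops le_two)
      then show ?thesis using e 3 by (intro goal[of "{{#0, 0, 1, 1, 2, 2#}, {#0, 0#}}"]) auto
    qed
  qed
qed

lemma split_T20:
  assumes S: "good S" "w \<noteq> {#}" "E S w" and l: "\<not> obeys E law_T20"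
  shows "ent (adjoin_zero T2) S w"
proof (rule split_ent[OF comm_ai_adjoin_zero[OF comm_ai_T2] _ _ _ S l])
  let ?i = "\<lambda>a. case a of None \<Rightarrow> {#0, 0, 1, 1#} | Some b \<Rightarrow> if b = 0 then {#0#} else {#0, 0#}"
  let ?X = "adjoin_zero T2"
  have X: "a = None \<or> a = Some 0 \<or> a = Some 1" if "a \<in> elems ?X" for a
    using that by (auto simp: adjoin_ops two_ops)
  show "?i a \<noteq> {#}" for a by (auto split: option.split)
  show "doubled (?i a + ?i b) \<and> doubled (?i (smul ?X a b)) \<and> set_mset (?i a + ?i b) = set_mset (?i (smul ?X a b))"
    if "a \<in> elems ?X" "b \<in> elems ?X" for a b
    using X[OF that(1)] X[OF that(2)] by (auto simp: adjoin_ops two_ops doubled_def)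
  have goal: "obeys E law_T20" if "E T {#0, 0#}" "T \<subseteq> {{#0#}, {#0, 0, 1, 1#}}" for T
    using mono[OF that] by (simp add: obeys_def law_T20_def)
  show "obeys E law_T20" if z: "z \<in> elems ?X" "b \<in> elems ?X" "\<not> le ?X b z"
    and e: "E (?i ` {a \<in> elems ?X. le ?X a z}) (?i b)" for z b
  proof -
    consider "z = None" "b = Some 0" | "z = None" "b = Some 1" | "z = Some 0" "b = Some 1"
      using X[OF z(1)] X[OF z(2)] z(3) by (auto simp: le_two)
    then show ?thesis
    proof cases
      case 1
      have "{a \<in> elems ?X. le ?X a z} = {None}" using X 1 by (auto simp: adjoin_ops)
      then have "E {{#0, 0, 1, 1#}} {#0#}" using e 1 by simp
      from mult1[OF this, of "{#0#}"] have "E {{#0, 0, 0, 1, 1#}} {#0, 0#}" by (simp add: add_mset_commute)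
      moreover have "E {{#0, 0, 1, 1#}} {#0, 0, 0, 1, 1#}"
        by (rule same_content) (auto simp: doubled_def)
      ultimately have "E {{#0, 0, 1, 1#}} {#0, 0#}" by (rule cut1)
      then show ?thesis by (intro goal[of "{{#0, 0, 1, 1#}}"]) auto
    next
      case 2
      have "{a \<in> elems ?X. le ?X a z} = {None}" using X 2 by (auto simp: adjoin_ops)
      then show ?thesis using e 2 by (intro goal[of "{{#0, 0, 1, 1#}}"]) auto
    next
      case 3
      have "{a \<in> elems ?X. le ?X a z} = {None, Some 0}" using X 3 by (auto simp: adjoin_ops two_ops le_two)
      then show ?thesis using e 3 by (intro goal[of "{{#0, 0, 1, 1#}, {#0#}}"]) auto
    qed
  qed
qed

lemma drop_repeated:
  assumes "set_mset r \<subseteq> set_mset p" "p \<noteq> {#}"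
  shows "E {p + r} p"
  using assms(1)
proof (induction r)
  case empty then show ?case by (simp add: refl)
next
  case (add c r)
  then obtain p' where p: "p = add_mset c p'" by (metis insert_subset mset_add set_mset_add_mset_insert)
  have "E {(p' + r) + ({#c#} + {#c#})} ((p' + r) + {#c#})"
    by (rule mult1[OF below_square]) auto
  then have "E {p + add_mset c r} (p + r)" by (simp add: p add_ac)
  moreover have "E {p + r} p" by (rule add.IH) (use add.prems in auto)
  ultimately show ?case using cut1 by blast
qed

lemma rename_derivation:
  assumes "E {{#0, 1, 2#}} q" "q \<noteq> {#}" "x \<noteq> {#}" "y \<noteq> {#}" "z \<noteq> {#}"
  shows "E {x + y + z} (sub (asg x y z x) q)"
  using subst_asg[OF assms(1) _ assms(2), of x y z x] assms by (simp add: add_ac)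

lemma repeated_subset:
  assumes "2 \<le> count q a" "set_mset r \<subseteq> set_mset q" "a \<notin># r" "\<And>x. count r x \<le> 1"
  shows "add_mset a (add_mset a r) \<subseteq># q"
proof (rule mset_subset_eqI)
  fix x
  show "count (add_mset a (add_mset a r)) x \<le> count q x"
  proof (cases "x = a")
    case True
    then show ?thesis using assms(1,3) by (simp add: not_in_iff)
  next
    case False
    show ?thesis
    proof (cases "x \<in># r")
      case True
      then have "x \<in># q" using assms(2) by blast
      then have "count q x > 0" by simp
      then have "count r x \<le> count q x" using assms(4)[of x] by linarith
      then show ?thesis using False by simp
    next
      case n: False
      then show ?thesis using False by (simp add: not_in_iff)
    qed
  qed
qed

text \<open>If \<open>xy\<close> lies above any other word in \<open>x\<close> and \<open>y\<close>, then \<open>law_AB\<close> follows. Dropping repetitions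
  reduces that word to \<open>x\<close> or \<open>x\<^sup>2y\<close>, up to exchanging the letters. From \<open>x\<close> the law arises
  by the base law for \<open>xy + x + y\<close>; from \<open>x\<^sup>2y\<close> it arises by applying the inequality to both letters in turn.\<close>

lemma pair_rigid:
  assumes q: "E {{#0, 1#}} q" "q \<noteq> {#}" "set_mset q \<subseteq> {0, 1}" "q \<noteq> {#0, 1#}"
  shows "obeys E law_AB"
proof -
  have swap: "E {{#1, 0#}} (sub (asg {#1#} {#0#} {#0#} {#0#}) p)" if "E {{#0, 1#}} p" "p \<noteq> {#}" for p
    using subst_asg[OF that(1) _ that(2), of "{#1#}" "{#0#}" "{#0#}" "{#0#}"]
    by (simp add: add_mset_commute)
  have comm: "{#1, 0 :: nat#} = {#0, 1#}" by (rule add_mset_commute)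
  have goal: "obeys E law_AB" if "E {{#0, 1#}} {#0, 0, 1, 1#}"
    using that by (simp add: obeys_def law_AB_def)
  have three: "obeys E law_AB" if e: "E {{#0, 1#}} {#0, 0, 1#}"
  proof -
    have "E {{#0, 1#}} {#1, 1, 0#}" using swap[OF e] unfolding comm by (simp add: asg_def add_mset_commute)
    from mult1[OF this, of "{#0#}"] have "E {{#0, 0, 1#}} {#0, 1, 1, 0#}" by (simp add: add_mset_commute)
    then have "E {{#0, 1#}} {#0, 1, 1, 0#}" using e by (rule cut1)
    moreover have "{#0, 1, 1, 0 :: nat#} = {#0, 0, 1, 1#}" by (simp add: multiset_eq_iff)
    ultimately show ?thesis by (intro goal) (simp only:)
  qed
  have one: "obeys E law_AB" if e: "E {{#0, 1#}} {#0#}"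
  proof -
    have "E {{#0, 1#}} {#1#}" using swap[OF e] unfolding comm by (simp add: asg_def)
    then have "E {{#0, 1#}} ({#0#} + {#0#} + {#1#} + {#1#})"
      by (intro cut[OF pair_letters[of "{#0#}" "{#1#}"]]) (use e refl in auto)
    moreover have "{#0#} + {#0#} + {#1#} + {#1 :: nat#} = {#0, 0, 1, 1#}" by (simp add: multiset_eq_iff)
    ultimately show ?thesis by (intro goal) (simp only:)
  qed
  have drop: "E {{#0, 1#}} p" if "p \<subseteq># q" "set_mset q \<subseteq> set_mset p" for p
  proof -
    have "q = p + (q - p)" using that(1) by simp
    moreover have "set_mset (q - p) \<subseteq> set_mset p" using that(2) in_diffD by fastforce
    moreover have "p \<noteq> {#}" using that q(2) by auto
    ultimately show ?thesis using drop_repeated[of "q - p" p] cut1[OF _ q(1)] by metis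
  qed
  consider "set_mset q = {0}" | "set_mset q = {1}" | "set_mset q = {0, 1}"
    using q(2,3) unfolding set_mset_eq_empty_iff[symmetric] by blast
  then show ?thesis
  proof cases
    case 1 then show ?thesis by (intro one drop) simp_all
  next
    case 2
    then have "E {{#0, 1#}} {#1#}" by (intro drop) simp_all
    from swap[OF this] show ?thesis unfolding comm by (intro one) (simp add: asg_def)
  next
    case 3
    have "count q 0 \<ge> 2 \<or> count q 1 \<ge> 2"
    proof (rule ccontr)
      assume n: "\<not> ?thesis"
      have "count q n = count {#0, 1#} n" for n
      proof (cases "n \<in> {0, 1}")
        case True
        then have "n \<in># q" unfolding 3 .
        then have "count q n > 0" by (rule count_greater_zero_iff[THEN iffD2])
        moreover have "count q n < 2" using True n by (elim insertE) (simp_all add: not_le)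
        ultimately have "count q n = 1" by linarith
        then show ?thesis using True by (elim insertE) simp_all
      next
        case False
        then have "n \<notin># q" unfolding 3 .
        then have "count q n = 0" by (rule count_eq_zero_iff[THEN iffD2])
        then show ?thesis using False by simp
      qed
      then have "q = {#0, 1#}" by (rule multiset_eqI)
      then show False using q(4) by simp
    qed
    then show ?thesis
    proof
      assume c: "count q 0 \<ge> 2"
      have "add_mset 0 (add_mset 0 {#1#}) \<subseteq># q"
        by (rule repeated_subset[OF c]) (simp_all add: 3)
      then show ?thesis by (intro three drop) (simp_all add: 3)
    next
      assume c: "count q 1 \<ge> 2"
      have "add_mset 1 (add_mset 1 {#0#}) \<subseteq># q"
        by (rule repeated_subset[OF c]) (simp_all add: 3)
      then have "E {{#0, 1#}} {#1, 1, 0#}" by (intro drop) (simp_all add: 3)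
      from swap[OF this] show ?thesis unfolding comm by (intro three) (simp add: asg_def add_mset_commute)
    qed
  qed
qed

text \<open>The analogue of \<open>pair_rigid\<close> for \<open>xyz\<close>: the other word is reduced to \<open>x\<close>, \<open>xy\<close> or \<open>x\<^sup>2yz\<close>, up to
  permuting the letters, and the base laws for \<open>xyz + x + y + z\<close> and for \<open>xyz + xy + xz + yz\<close> apply to the first
  two.\<close>

lemma triple_rigid:
  assumes q: "E {{#0, 1, 2#}} q" "q \<noteq> {#}" "set_mset q \<subseteq> {0, 1, 2}" "q \<noteq> {#0, 1, 2#}"
  shows "obeys E law_ABC"
proof -
  let ?x = "{#0#} :: nat multiset" and ?y = "{#1#} :: nat multiset" and ?z = "{#2#} :: nat multiset"
  have w: "{#0, 1, 2#} = ?x + ?y + ?z" by simp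
  have goal: "obeys E law_ABC" if "E {?x + ?y + ?z} (?x + ?x + ?y + ?y + ?z + ?z)"
    using that by (simp add: obeys_def law_ABC_def add_mset_commute)
  have three: "obeys E law_ABC"
    if e: "\<And>x y z. x \<noteq> {#} \<Longrightarrow> y \<noteq> {#} \<Longrightarrow> z \<noteq> {#} \<Longrightarrow> E {x + y + z} (x + x + y + z)"
  proof -
    have 1: "E {?x + ?y + ?z} (?x + ?x + ?y + ?z)" by (rule e) auto
    have "E {?y + ?x + ?z} (?y + ?y + ?x + ?z)" by (rule e) auto
    from mult1[OF this, of ?x] have 2: "E {?x + ?x + ?y + ?z} (?x + ?x + ?y + ?y + ?z)"
      by (simp add: add_mset_commute)
    have "E {?z + ?y + ?x} (?z + ?z + ?y + ?x)" by (rule e) auto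
    from mult1[OF this, of "?x + ?y"]
    have 3: "E {?x + ?x + ?y + ?y + ?z} (?x + ?x + ?y + ?y + ?z + ?z)"
      by (simp add: add_mset_commute)
    show ?thesis by (rule goal[OF cut1[OF 3 cut1[OF 2 1]]])
  qed
  have two: "obeys E law_ABC"
    if e: "\<And>x y z. x \<noteq> {#} \<Longrightarrow> y \<noteq> {#} \<Longrightarrow> z \<noteq> {#} \<Longrightarrow> E {x + y + z} (x + y)"
  proof -
    have "E {?x + ?y + ?z} (?x + ?y)" by (rule e) auto
    moreover have "E {?x + ?z + ?y} (?x + ?z)" by (rule e) auto
    moreover have "E {?y + ?z + ?x} (?y + ?z)" by (rule e) auto
    ultimately show ?thesis
      by (intro goal cut[OF triple_pairs[of ?x ?y ?z]]) (auto simp: refl add_mset_commute)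
  qed
  have one: "obeys E law_ABC"
    if e: "\<And>x y z. x \<noteq> {#} \<Longrightarrow> y \<noteq> {#} \<Longrightarrow> z \<noteq> {#} \<Longrightarrow> E {x + y + z} x"
  proof -
    have "E {?x + ?y + ?z} ?x" by (rule e) auto
    moreover have "E {?y + ?z + ?x} ?y" by (rule e) auto
    moreover have "E {?z + ?y + ?x} ?z" by (rule e) auto
    ultimately show ?thesis
      by (intro goal cut[OF triple_letters[of ?x ?y ?z]]) (auto simp: refl add_mset_commute)
  qed
  have drop: "E {{#0, 1, 2#}} p" if "p \<subseteq># q" "set_mset q \<subseteq> set_mset p" for p
  proof -
    have "q = p + (q - p)" using that(1) by simp
    moreover have "set_mset (q - p) \<subseteq> set_mset p" using that(2) in_diffD by fastforce
    moreover have "p \<noteq> {#}" using that q(2) by auto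
    ultimately show ?thesis using drop_repeated[of "q - p" p] cut1[OF _ q(1)] by metis
  qed
  have inst: "E {x + y + z} (sub (asg x y z x) p)"
    if "E {{#0, 1, 2#}} p" "p \<noteq> {#}" "x \<noteq> {#}" "y \<noteq> {#}" "z \<noteq> {#}" for p x y z
    by (rule rename_derivation[OF that])
  have sub: "mset_set (set_mset q) \<subseteq># q" by (intro mset_subset_eqI) (auto simp: count_mset_set')
  have base: "E {{#0, 1, 2#}} (mset_set (set_mset q))" by (rule drop[OF sub]) simp
  have "set_mset q \<in> {{0}, {1}, {2}, {0, 1}, {0, 2}, {1, 2}, {0, 1, 2}}"
  proof -
    have "set_mset q \<noteq> {}" using q(2) by simp
    moreover have "set_mset q = (if 0 \<in># q then {0} else {}) \<union> (if 1 \<in># q then {1} else {})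
        \<union> (if 2 \<in># q then {2} else {})" using q(3) by auto
    ultimately show ?thesis by (cases "0 \<in># q"; cases "1 \<in># q"; cases "2 \<in># q") (simp_all add: insert_commute)
  qed
  then consider "set_mset q = {0}" | "set_mset q = {1}" | "set_mset q = {2}" | "set_mset q = {0, 1}"
    | "set_mset q = {0, 2}" | "set_mset q = {1, 2}" | "set_mset q = {0, 1, 2}" by blast
  then show ?thesis
  proof cases
    case 1
    show ?thesis by (rule one) (use inst[OF base, of x y z for x y z] 1 in simp)
  next
    case 2
    show ?thesis
    proof (rule one)
      fix x y z :: "nat multiset" assume "x \<noteq> {#}" "y \<noteq> {#}" "z \<noteq> {#}"
      then show "E {x + y + z} x" using inst[OF base, of y x z] 2 by (simp add: add_ac)
    qed
  next
    case 3
    show ?thesis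
    proof (rule one)
      fix x y z :: "nat multiset" assume "x \<noteq> {#}" "y \<noteq> {#}" "z \<noteq> {#}"
      then show "E {x + y + z} x" using inst[OF base, of y z x] 3 by (simp add: add_ac)
    qed
  next
    case 4
    show ?thesis
    proof (rule two)
      fix x y z :: "nat multiset" assume "x \<noteq> {#}" "y \<noteq> {#}" "z \<noteq> {#}"
      then show "E {x + y + z} (x + y)" using inst[OF base, of x y z] 4 by (simp add: add_ac)
    qed
  next
    case 5
    show ?thesis
    proof (rule two)
      fix x y z :: "nat multiset" assume "x \<noteq> {#}" "y \<noteq> {#}" "z \<noteq> {#}"
      then show "E {x + y + z} (x + y)" using inst[OF base, of x z y] 5 by (simp add: add_ac)
    qed
  next
    case 6
    show ?thesis
    proof (rule two)
      fix x y z :: "nat multiset" assume "x \<noteq> {#}" "y \<noteq> {#}" "z \<noteq> {#}"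
      then show "E {x + y + z} (x + y)" using inst[OF base, of z x y] 6 by (simp add: add_ac)
    qed
  next
    case 7
    have "\<exists>c\<in>{0, 1, 2}. count q c \<ge> 2"
    proof (rule ccontr)
      assume n: "\<not> ?thesis"
      have "count q n = count {#0, 1, 2#} n" for n
      proof (cases "n \<in> {0, 1, 2}")
        case True
        then have "n \<in># q" unfolding 7 .
        then have "count q n > 0" by (rule count_greater_zero_iff[THEN iffD2])
        moreover have "count q n < 2" using True n by (elim insertE) (simp_all add: not_le)
        ultimately have "count q n = 1" by linarith
        then show ?thesis using True by (elim insertE) simp_all
      next
        case False
        then have "n \<notin># q" unfolding 7 .
        then have "count q n = 0" by (rule count_eq_zero_iff[THEN iffD2])
        then show ?thesis using False by simp
      qed
      then have "q = {#0, 1, 2#}" by (rule multiset_eqI)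
      then show False using q(4) by simp
    qed
    then consider "count q 0 \<ge> 2" | "count q 1 \<ge> 2" | "count q 2 \<ge> 2" by auto
    then show ?thesis
    proof cases
      case 1
      have "add_mset 0 (add_mset 0 {#1, 2#}) \<subseteq># q"
        by (rule repeated_subset[OF 1]) (simp_all add: 7)
      then have d: "E {{#0, 1, 2#}} {#0, 0, 1, 2#}" by (intro drop) (auto simp: 7)
      show ?thesis
      proof (rule three)
        fix x y z :: "nat multiset" assume "x \<noteq> {#}" "y \<noteq> {#}" "z \<noteq> {#}"
        then show "E {x + y + z} (x + x + y + z)" using inst[OF d, of x y z] by (simp add: add_ac)
      qed
    next
      case 2
      have "add_mset 1 (add_mset 1 {#0, 2#}) \<subseteq># q"
        by (rule repeated_subset[OF 2]) (simp_all add: 7)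
      then have d: "E {{#0, 1, 2#}} {#1, 1, 0, 2#}" by (intro drop) (auto simp: 7)
      show ?thesis
      proof (rule three)
        fix x y z :: "nat multiset" assume "x \<noteq> {#}" "y \<noteq> {#}" "z \<noteq> {#}"
        then show "E {x + y + z} (x + x + y + z)" using inst[OF d, of y x z] by (simp add: add_ac)
      qed
    next
      case 3
      have "add_mset 2 (add_mset 2 {#0, 1#}) \<subseteq># q"
        by (rule repeated_subset[OF 3]) (simp_all add: 7)
      then have d: "E {{#0, 1, 2#}} {#2, 2, 0, 1#}" by (intro drop) (auto simp: 7)
      show ?thesis
      proof (rule three)
        fix x y z :: "nat multiset" assume "x \<noteq> {#}" "y \<noteq> {#}" "z \<noteq> {#}"
        then show "E {x + y + z} (x + x + y + z)" using inst[OF d, of y z x] by (simp add: add_ac)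
      qed
    qed
  qed
qed

lemma set_mset_sub: "set_mset (sub \<sigma> w) = (\<Union>n\<in>set_mset w. set_mset (\<sigma> n))"
  by (induction w) auto

text \<open>In other words, \<open>S\<^sub>c(ab)\<close> and \<open>S\<^sub>c(abc)\<close> satisfy all consequences of a variety that fails the
  respective law, with valuations expressed as substitutions.\<close>

lemma rigid_AB:
  assumes "E S w" "good S" "w \<noteq> {#}" "\<not> obeys E law_AB"
    and \<sigma>: "\<And>n. \<sigma> n \<noteq> {#} \<and> set_mset (\<sigma> n) \<subseteq> {0, 1}"
    and "\<And>u. u \<in> S \<Longrightarrow> sub \<sigma> u = {#0, 1#}"
  shows "sub \<sigma> w = {#0, 1#}"
proof -
  have "E (sub \<sigma> ` S) (sub \<sigma> w)" by (rule subst) (use assms in \<open>auto simp: good_def\<close>)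
  then have "E {{#0, 1#}} (sub \<sigma> w)" by (rule mono) (use assms in auto)
  moreover have "set_mset (sub \<sigma> w) \<subseteq> {0, 1}" using \<sigma> by (auto simp: set_mset_sub)
  moreover have "sub \<sigma> w \<noteq> {#}" by (rule sub_nonempty) (use \<sigma> assms in auto)
  ultimately show ?thesis using pair_rigid assms(4) by blast
qed

lemma rigid_ABC:
  assumes "E S w" "good S" "w \<noteq> {#}" "\<not> obeys E law_ABC"
    and \<sigma>: "\<And>n. \<sigma> n \<noteq> {#} \<and> set_mset (\<sigma> n) \<subseteq> {0, 1, 2}"
    and "\<And>u. u \<in> S \<Longrightarrow> sub \<sigma> u = {#0, 1, 2#}"
  shows "sub \<sigma> w = {#0, 1, 2#}"
proof -
  have "E (sub \<sigma> ` S) (sub \<sigma> w)" by (rule subst) (use assms in \<open>auto simp: good_def\<close>)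
  then have "E {{#0, 1, 2#}} (sub \<sigma> w)" by (rule mono) (use assms in auto)
  moreover have "set_mset (sub \<sigma> w) \<subseteq> {0, 1, 2}" using \<sigma> by (auto simp: set_mset_sub)
  moreover have "sub \<sigma> w \<noteq> {#}" by (rule sub_nonempty) (use \<sigma> assms in auto)
  ultimately show ?thesis using triple_rigid assms(4) by blast
qed

lemma split_AB:
  assumes "good S" "w \<noteq> {#}" "E S w" "\<not> obeys E law_AB"
  shows "cond_AB S w"
  unfolding cond_AB_def
proof (intro allI impI)
  fix \<sigma> :: "nat \<Rightarrow> nat multiset"
  assume *: "\<forall>n. \<sigma> n \<in> {{#0#}, {#1#}, {#0, 1#}, {#0, 0, 1, 1#}}" "\<forall>u\<in>S. sub \<sigma> u = {#0, 1#}"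
  have "\<sigma> n \<noteq> {#} \<and> set_mset (\<sigma> n) \<subseteq> {0, 1}" for n using *(1)[rule_format, of n] by auto
  then show "sub \<sigma> w = {#0, 1#}"
    by (intro rigid_AB[OF assms(3,1,2,4)]) (use *(2) in auto)
qed

end

section \<open>Determination by six laws\<close>

definition six_laws :: "law list" where
  "six_laws = [law_D2, law_M2, law_T2, law_M20, law_T20, law_AB]"

text \<open>Tameness turns out to be equivalent to being finitely based, for subvarieties of \<open>V(S\<^sub>7\<^sup>0)\<close>.\<close>

definition tame :: "(nat multiset set \<Rightarrow> nat multiset \<Rightarrow> bool) \<Rightarrow> bool" where
  "tame E \<longleftrightarrow> obeys E law_AB \<or> (obeys E law_ABC \<and> obeys E law_path)"

text \<open>A law that fails in \<open>E\<close> fails in \<open>E'\<close>, so \<open>E'\<close> is contained in the consequence relation of the algebra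
  split by it; the condition for this algebra therefore holds, and for every law either the law or the condition is
  available to derive \<open>w\<close> in \<open>E\<close>.\<close>

theorem tame_determined:
  assumes E: "base_consequence E" "tame E" and E': "base_consequence E'"
    and le: "\<And>l. l \<in> set six_laws \<Longrightarrow> obeys E' l \<Longrightarrow> obeys E l"
    and S: "good S" "w \<noteq> {#}" and e: "E' S w"
  shows "E S w"
proof -
  interpret E: base_consequence E by fact
  interpret E': base_consequence E' by fact
  have D2: "obeys E law_D2 \<or> cond_D2 S w"
    using le[of law_D2] E'.split_D2[OF S e] ent_D2[OF _ S] by (auto simp: six_laws_def)
  have M2: "obeys E law_M2 \<or> cond_M2 S w"
    using le[of law_M2] E'.split_M2[OF S e] ent_M2[OF _ S] by (auto simp: six_laws_def)
  have T2: "obeys E law_T2 \<or> cond_T2 S w"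
    using le[of law_T2] E'.split_T2[OF S e] ent_T2[OF _ S] by (auto simp: six_laws_def)
  have M20: "obeys E law_M20 \<or> cond_M20 S w"
    using le[of law_M20] E'.split_M20[OF S e] ent_M20[OF _ S] by (auto simp: six_laws_def)
  have T20: "obeys E law_T20 \<or> cond_T20 S w"
    using le[of law_T20] E'.split_T20[OF S e] ent_T20[OF _ S] by (auto simp: six_laws_def)
  show ?thesis
  proof (cases "obeys E law_AB")
    case True
    then show ?thesis by (rule E.derive_AB_case[OF S _ D2 M2 T2 M20 T20])
  next
    case False
    then have "cond_AB S w" using le[of law_AB] E'.split_AB[OF S e] by (auto simp: six_laws_def)
    moreover have "obeys E law_ABC" "obeys E law_path" using E(2) False by (auto simp: tame_def)
    ultimately show ?thesis using E.derive_path_case[OF S _ _ M2] by blast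
  qed
qed

section \<open>Hypergraphs without exact transversals that are locally forests\<close>

subsection \<open>Colourings of hyperforests\<close>

definition leaf_edge :: "'v set set \<Rightarrow> 'v set \<Rightarrow> bool" where
  "leaf_edge F e \<longleftrightarrow> e \<in> F \<and> (\<exists>p\<in>e. \<forall>e'\<in>F - {e}. e \<inter> e' \<subseteq> {p})"

definition hyperforest :: "'v set set \<Rightarrow> bool" where
  "hyperforest F \<longleftrightarrow> finite F \<and> (\<forall>e\<in>F. card e = 3) \<and> (\<forall>F'\<subseteq>F. F' \<noteq> {} \<longrightarrow> (\<exists>e. leaf_edge F' e))"

definition rainbow :: "('v \<Rightarrow> nat) \<Rightarrow> 'v set set \<Rightarrow> bool" where
  "rainbow c F \<longleftrightarrow> (\<forall>v. c v < 3) \<and> (\<forall>e\<in>F. inj_on c e)"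

text \<open>A leaf edge \<open>{p, q, r}\<close> meets the rest of the forest in \<open>p\<close> only, so any colouring of the rest
  extends to it in two ways, by permuting the two remaining colours on \<open>q\<close> and \<open>r\<close>.\<close>

lemma rainbow_extend:
  assumes e: "e = {p, q, r}" "p \<noteq> q" "p \<noteq> r" "q \<noteq> r" "\<forall>e'\<in>F - {e}. e \<inter> e' \<subseteq> {p}"
    and c: "rainbow c (F - {e})" and ab: "{c p, a, b} = {0, 1, 2}"
  shows "rainbow (c(q := a, r := b)) F"
proof -
  have dist: "a < 3" "b < 3" "c p \<noteq> a" "c p \<noteq> b" "a \<noteq> b"
  proof -
    have "a \<in> {0, 1, 2}" "b \<in> {0, 1, 2}" using ab by blast+
    then show "a < 3" "b < 3" by auto
    have "card {c p, a, b} = 3" unfolding ab by simp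
    then show "c p \<noteq> a" "c p \<noteq> b" "a \<noteq> b" by (auto simp: card_insert_if split: if_splits)
  qed
  have "inj_on (c(q := a, r := b)) e'" if "e' \<in> F" for e'
  proof (cases "e' = e")
    case True
    then show ?thesis using dist e by auto
  next
    case False
    then have "q \<notin> e'" "r \<notin> e'" "inj_on c e'" using that e c unfolding rainbow_def by blast+
    then show ?thesis by (auto simp: inj_on_def)
  qed
  then show ?thesis using c dist by (auto simp: rainbow_def)
qed

lemma rainbow_less: "rainbow c F \<Longrightarrow> c v < 3"
  by (simp add: rainbow_def)

lemma two_colours:
  assumes "x < (3 :: nat)"
  obtains a b where "{x, a, b} = {0, 1, 2}" "\<And>y. y < 3 \<Longrightarrow> y \<noteq> x \<Longrightarrow> y = a \<or> y = b" "a \<noteq> b"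
    "{x, b, a} = {0, 1, 2}"
proof -
  consider "x = 0" | "x = 1" | "x = 2" using assms by linarith
  then show thesis
  proof cases
    case 1
    show thesis
    proof (rule that[of 1 2])
      show "y = 1 \<or> y = 2" if "y < 3" "y \<noteq> x" for y using that 1 by linarith
      show "{x, 1, 2} = {0, 1, 2}" "{x, 2, 1} = {0, 1, 2}" unfolding 1 by blast+
    qed simp
  next
    case 2
    show thesis
    proof (rule that[of 0 2])
      show "y = 0 \<or> y = 2" if "y < 3" "y \<noteq> x" for y using that 2 by linarith
      show "{x, 0, 2} = {0, 1, 2}" "{x, 2, 0} = {0, 1, 2}" unfolding 2 by (rule set_eqI, simp, presburger)+
    qed simp
  next
    case 3
    show thesis
    proof (rule that[of 0 1])
      show "y = 0 \<or> y = 1" if "y < 3" "y \<noteq> x" for y using that 3 by linarith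
      show "{x, 0, 1} = {0, 1, 2}" "{x, 1, 0} = {0, 1, 2}" unfolding 3 by (rule set_eqI, simp, presburger)+
    qed simp
  qed
qed

text \<open>By induction over leaf edges. A private vertex can take any colour other than that of the vertex shared
  with the rest, and the colour of the latter can be separated from any other by the induction hypothesis.\<close>

lemma hyperforest_colouring:
  assumes "hyperforest F"
  shows "(\<forall>u v. u \<noteq> v \<longrightarrow> (\<exists>c. rainbow c F \<and> c u \<noteq> c v)) \<and>
    (\<forall>u v w. u \<noteq> v \<longrightarrow> u \<noteq> w \<longrightarrow> v \<noteq> w \<longrightarrow> {u, v, w} \<notin> F \<longrightarrow>
       (\<exists>c. rainbow c F \<and> \<not> inj_on c {u, v, w}))"
  using assms
proof (induction "card F" arbitrary: F rule: less_induct)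
  case less
  have fin: "finite F" using less.prems by (simp add: hyperforest_def)
  show ?case
  proof (cases "F = {}")
    case True
    have sep: "\<exists>c. rainbow c F \<and> c u \<noteq> c v" if "u \<noteq> v" for u v
      by (rule exI[of _ "\<lambda>x. if x = u then 0 else 1"]) (use True that in \<open>auto simp: rainbow_def\<close>)
    have tri: "\<exists>c. rainbow c F \<and> \<not> inj_on c {u, v, w}" if "u \<noteq> v" for u v w
      by (rule exI[of _ "\<lambda>x. 0"]) (use True that in \<open>auto simp: rainbow_def\<close>)
    show ?thesis by (intro conjI allI impI) (erule sep, erule tri)
  next
    case False
    then obtain e p where e: "e \<in> F" "p \<in> e" and leaf: "\<forall>e'\<in>F - {e}. e \<inter> e' \<subseteq> {p}"
      using less.prems unfolding hyperforest_def leaf_edge_def by (metis subset_refl)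
    have "card e = 3" using e less.prems by (auto simp: hyperforest_def)
    then have "card (e - {p}) = 2" using e by (simp add: card.infinite)
    then obtain q r where qr: "e - {p} = {q, r}" "q \<noteq> r" by (auto simp: card_2_iff)
    then have epqr: "e = {p, q, r}" "p \<noteq> q" "p \<noteq> r" using e by auto
    let ?G = "F - {e}"
    have G: "hyperforest ?G" using less.prems unfolding hyperforest_def by (meson Diff_subset finite_Diff subset_iff)
    have lt': "card ?G < card F" using e fin by (meson card_Diff1_less)
    note IH = less.hyps[OF lt' G]
    have IH1: "\<exists>c. rainbow c ?G \<and> c u \<noteq> c v" if "u \<noteq> v" for u v
      using IH[THEN conjunct1, rule_format, OF that] .
    have IH2: "\<exists>c. rainbow c ?G \<and> \<not> inj_on c {u, v, w}"
      if "u \<noteq> v" "u \<noteq> w" "v \<noteq> w" "{u, v, w} \<notin> ?G" for u v w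
      using IH[THEN conjunct2, rule_format, OF that] .
    have ext: "rainbow (c(q := a, r := b)) F" if "rainbow c ?G" "{c p, a, b} = {0, 1, 2}" for c a b
      by (rule rainbow_extend[OF epqr qr(2) leaf that])
    \<comment> \<open>The private vertex \<open>q\<close> may be given any colour other than that of \<open>p\<close>; by symmetry so may \<open>r\<close>.\<close>
    have choose: "\<exists>d. rainbow d F \<and> d x = y \<and> (\<forall>z. z \<noteq> q \<longrightarrow> z \<noteq> r \<longrightarrow> d z = c z)"
      if c: "rainbow c ?G" and x: "x = q \<or> x = r" and y: "y < 3" "y \<noteq> c p" for c x y
    proof -
      obtain b where ab: "{c p, y, b} = {0, 1, 2}" "{c p, b, y} = {0, 1, 2}"
        using two_colours[OF rainbow_less[OF c, of p]] y by metis
      from x show ?thesis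
      proof
        assume "x = q"
        then show ?thesis using ext[OF c ab(1)] qr(2) by (intro exI[of _ "c(q := y, r := b)"]) simp
      next
        assume "x = r"
        then show ?thesis using ext[OF c ab(2)] qr(2) by (intro exI[of _ "c(q := b, r := y)"]) simp
      qed
    qed
    have base: "\<exists>d. rainbow d F \<and> (\<forall>z. z \<noteq> q \<longrightarrow> z \<noteq> r \<longrightarrow> d z = c z)" if c: "rainbow c ?G" for c
    proof -
      obtain a b where "{c p, a, b} = {0, 1, 2}"
        using two_colours[OF rainbow_less[OF c, of p]] by metis
      then show ?thesis using ext[OF c] by (intro exI[of _ "c(q := a, r := b)"]) simp
    qed
    have inj_e: "d p \<noteq> d q" "d p \<noteq> d r" "d q \<noteq> d r" if "rainbow d F" for d
      using that e(1) epqr qr(2) unfolding rainbow_def by (auto dest!: bspec[of _ _ e])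
    have sep1: "\<exists>c. rainbow c F \<and> c x \<noteq> c v" if x: "x = q \<or> x = r" and v: "v \<noteq> x" for x v
    proof (cases "v \<in> e")
      case True
      obtain c where "rainbow c ?G" using IH1[OF v] by blast
      then obtain d where "rainbow d F" using base by blast
      then show ?thesis using inj_e[of d] True x v epqr by (intro exI[of _ d]) force
    next
      case False
      obtain c where c: "rainbow c ?G" using IH1[OF v] by blast
      have "\<exists>y < 3. y \<noteq> c p \<and> y \<noteq> c v" by presburger
      then obtain y where y: "y < 3" "y \<noteq> c p" "y \<noteq> c v" by (elim exE conjE)
      obtain d where d: "rainbow d F" "d x = y" "\<forall>z. z \<noteq> q \<longrightarrow> z \<noteq> r \<longrightarrow> d z = c z"
        using choose[OF c x y(1,2)] by (elim exE conjE)
      moreover have "d v = c v" using d(3) False epqr(1) by simp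
      ultimately show ?thesis using y(3) by (intro exI[of _ d]) simp
    qed
    have sep: "\<exists>c. rainbow c F \<and> c u \<noteq> c v" if "u \<noteq> v" for u v
    proof (cases "u = q \<or> u = r \<or> v = q \<or> v = r")
      case True
      then show ?thesis using sep1[of u v] sep1[of v u] that by metis
    next
      case False
      obtain c where "rainbow c ?G" "c u \<noteq> c v" using IH1[OF \<open>u \<noteq> v\<close>] by (elim exE conjE)
      then show ?thesis using base[of c] False by metis
    qed
    have tri1: "\<exists>c. rainbow c F \<and> c u = c v"
      if u: "u = q \<or> u = r" and v: "v \<noteq> p" "v \<noteq> q" "v \<noteq> r" for u v
    proof -
      obtain c where c: "rainbow c ?G" "c v \<noteq> c p" using IH1[OF v(1)] by blast
      then show ?thesis using choose[OF c(1) u rainbow_less[OF c(1)] c(2)] v by metis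
    qed
    have tri: "\<exists>c. rainbow c F \<and> \<not> inj_on c {u, v, w}"
      if ne: "u \<noteq> v" "u \<noteq> w" "v \<noteq> w" "{u, v, w} \<notin> F" for u v w
    proof (cases "{u, v, w} \<inter> {q, r} = {}")
      case True
      obtain c where "rainbow c ?G" "\<not> inj_on c {u, v, w}" using IH2[OF ne(1-3)] ne(4) by (metis DiffD1)
      moreover obtain d where "rainbow d F" "\<forall>z. z \<noteq> q \<longrightarrow> z \<noteq> r \<longrightarrow> d z = c z"
        using base[OF calculation(1)] by blast
      moreover have "inj_on d {u, v, w} = inj_on c {u, v, w}"
        by (rule inj_on_cong) (use calculation True in auto)
      ultimately show ?thesis by metis
    next
      case False
      then obtain x where x: "x \<in> {u, v, w}" "x = q \<or> x = r" by auto
      have "\<not> {u, v, w} \<subseteq> e"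
      proof
        assume "{u, v, w} \<subseteq> e"
        moreover have "card {u, v, w} = 3" using ne by simp
        ultimately have "{u, v, w} = e" using \<open>card e = 3\<close> by (metis card.infinite card_subset_eq zero_neq_numeral)
        then show False using e ne(4) by simp
      qed
      then obtain y where y: "y \<in> {u, v, w}" "y \<notin> e" by auto
      then obtain c where "rainbow c F" "c x = c y" using tri1[OF x(2), of y] epqr by auto
      moreover have "x \<noteq> y" using x y epqr by auto
      ultimately show ?thesis using x y by (metis inj_onD)
    qed
    show ?thesis by (intro conjI allI impI) (erule sep, rule tri)
  qed
qed

subsection \<open>A hypergraph from truncated power series over the two-element field\<close>

text \<open>Reduced words are the monomials of the algebra over the two-element field with generators
  \<open>X\<^sub>0, X\<^sub>1, X\<^sub>2\<close> subject to \<open>X\<^sub>i\<^sup>2 = 0\<close>, truncated above degree \<open>d\<close>; an element is the set of its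
  monomials. \<open>step d i\<close> is left multiplication by \<open>1 + X\<^sub>i\<close>, an involution on the set \<open>units d\<close> of
  elements with constant term one.\<close>

definition reduced :: "nat \<Rightarrow> nat list set" where
  "reduced d = {w. length w \<le> d \<and> set w \<subseteq> {..<3} \<and> distinct_adj w}"

definition units :: "nat \<Rightarrow> nat list set set" where
  "units d = {f. f \<subseteq> reduced d \<and> [] \<in> f}"

definition step :: "nat \<Rightarrow> nat \<Rightarrow> nat list set \<Rightarrow> nat list set" where
  "step d i f = {w \<in> reduced d. (w \<in> f) \<noteq> (w \<noteq> [] \<and> hd w = i \<and> tl w \<in> f)}"

lemma in_step: "w \<in> step d i f \<longleftrightarrow> w \<in> reduced d \<and> (w \<in> f) \<noteq> (w \<noteq> [] \<and> hd w = i \<and> tl w \<in> f)"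
  by (simp add: step_def)

lemma finite_reduced: "finite (reduced d)"
proof (rule finite_subset)
  show "reduced d \<subseteq> {w. set w \<subseteq> {..<3} \<and> length w \<le> d}" by (auto simp: reduced_def)
qed (simp add: finite_lists_length_le)

lemma Nil_reduced: "[] \<in> reduced d" by (simp add: reduced_def)

lemma reduced_tl: "i # w \<in> reduced d \<Longrightarrow> w \<in> reduced d"
  by (cases w) (auto simp: reduced_def)

lemma reduced_take: "w \<in> reduced d \<Longrightarrow> take n w \<in> reduced d"
  unfolding reduced_def
  by (auto simp: distinct_adj_conv_nth dest: in_set_takeD)

lemma step_units: "f \<in> units d \<Longrightarrow> step d i f \<in> units d"
  by (auto simp: units_def in_step Nil_reduced)

lemma step_step:
  assumes "f \<subseteq> reduced d"
  shows "step d i (step d i f) = f"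
proof (rule set_eqI)
  fix w
  show "w \<in> step d i (step d i f) \<longleftrightarrow> w \<in> f"
  proof (cases "w \<in> reduced d")
    case True
    show ?thesis
    proof (cases "w \<noteq> [] \<and> hd w = i")
      case t: True
      then obtain w' where w: "w = i # w'" by (cases w) auto
      have r: "w' \<in> reduced d" using reduced_tl True w by simp
      have "\<not> (w' \<noteq> [] \<and> hd w' = i)" using True w by (cases w') (auto simp: reduced_def)
      then have "w' \<in> step d i f \<longleftrightarrow> w' \<in> f" using r by (auto simp: in_step)
      then show ?thesis using True by (auto simp: w in_step)
    qed (use True in \<open>auto simp: in_step\<close>)
  qed (use assms in \<open>auto simp: in_step\<close>)
qed

lemma foldr_step_units: "f \<in> units d \<Longrightarrow> foldr (step d) is f \<in> units d"
  by (induction "is") (auto simp: step_units)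

text \<open>Left multiplication by a product of generators is multiplication by its value at \<open>1\<close>.\<close>

lemma foldr_step_product:
  assumes f: "f \<subseteq> reduced d" and w: "w \<in> reduced d"
  shows "(of_bool (w \<in> foldr (step d) is f) :: bit) =
    (\<Sum>n\<le>length w. of_bool (take n w \<in> foldr (step d) is {[]}) * of_bool (drop n w \<in> f))"
  using w
proof (induction "is" arbitrary: w)
  case Nil
  have "(\<Sum>n\<le>length w. of_bool (take n w \<in> {[]}) * of_bool (drop n w \<in> f) :: bit)
      = (\<Sum>n\<le>length w. if n = 0 then of_bool (w \<in> f) else 0)"
    by (rule sum.cong) auto
  then show ?case by simp
next
  case (Cons i "is")
  let ?C = "foldr (step d) is {[]}" and ?T = "foldr (step d) is f"
  have xor: "(of_bool (a \<noteq> b) :: bit) = of_bool a + of_bool b" for a b by (cases a; cases b) auto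
  have mem: "(of_bool (x \<in> step d i g) :: bit) = of_bool (x \<in> g) + of_bool (x \<noteq> [] \<and> hd x = i \<and> tl x \<in> g)"
    if "x \<in> reduced d" for x g using that unfolding xor[symmetric] by (simp add: in_step)
  have "(\<Sum>n\<le>length w. of_bool (take n w \<in> step d i ?C) * of_bool (drop n w \<in> f) :: bit)
      = (\<Sum>n\<le>length w. of_bool (take n w \<in> ?C) * of_bool (drop n w \<in> f))
      + (\<Sum>n\<le>length w. of_bool (take n w \<noteq> [] \<and> hd (take n w) = i \<and> tl (take n w) \<in> ?C) * of_bool (drop n w \<in> f))"
    unfolding sum.distrib[symmetric]
    by (rule sum.cong) (simp_all only: mem[OF reduced_take[OF Cons.prems]] distrib_right)
  also have "(\<Sum>n\<le>length w. of_bool (take n w \<in> ?C) * of_bool (drop n w \<in> f)) = (of_bool (w \<in> ?T) :: bit)"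
    by (rule Cons.IH[OF Cons.prems, symmetric])
  also have "(\<Sum>n\<le>length w. of_bool (take n w \<noteq> [] \<and> hd (take n w) = i \<and> tl (take n w) \<in> ?C)
       * of_bool (drop n w \<in> f)) = (of_bool (w \<noteq> [] \<and> hd w = i \<and> tl w \<in> ?T) :: bit)"
  proof (cases w)
    case Nil then show ?thesis by simp
  next
    case (Cons a w')
    have "w' \<in> reduced d" using reduced_tl Cons.prems Cons by simp
    note ih = Cons.IH[OF this]
    let ?G = "\<lambda>n. of_bool (take n w \<noteq> [] \<and> hd (take n w) = i \<and> tl (take n w) \<in> ?C)
       * of_bool (drop n w \<in> f) :: bit"
    have "?G (Suc n) = of_bool (a = i) * (of_bool (take n w' \<in> ?C) * of_bool (drop n w' \<in> f))" for n
      by (cases "a = i") (simp_all add: Cons)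
    moreover have "(\<Sum>n\<le>length w. ?G n) = ?G 0 + (\<Sum>n\<le>length w'. ?G (Suc n))"
      unfolding Cons length_Cons by (rule sum.atMost_Suc_shift)
    ultimately have "(\<Sum>n\<le>length w. ?G n) = ?G 0 + of_bool (a = i) * of_bool (w' \<in> ?T)"
      by (simp only: sum_distrib_left[symmetric] ih)
    then show ?thesis by (cases "a = i") (simp_all add: Cons)
  qed
  finally show ?case by (simp add: mem[OF Cons.prems])
qed

text \<open>A product of generators \<open>1 + X\<^sub>i\<close> has no monomial longer than itself and, when the indices form
  a reduced word, has this word as a monomial. In particular it is not \<open>1\<close>.\<close>

lemma foldr_step_one_length: "w \<in> foldr (step d) is {[]} \<Longrightarrow> length w \<le> length is"
proof (induction "is" arbitrary: w)
  case (Cons i "is")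
  from Cons.prems have "w \<in> foldr (step d) is {[]} \<or> w \<noteq> [] \<and> tl w \<in> foldr (step d) is {[]}"
    by (auto simp: in_step)
  then show ?case using Cons.IH[of w] Cons.IH[of "tl w"] by auto
qed auto

lemma foldr_step_one_self: "is \<in> reduced d \<Longrightarrow> is \<in> foldr (step d) is {[]}"
proof (induction "is")
  case (Cons i "is")
  then have "is \<in> foldr (step d) is {[]}" using reduced_tl by blast
  moreover have "i # is \<notin> foldr (step d) is {[]}" using foldr_step_one_length by fastforce
  ultimately show ?case using Cons.prems by (simp add: in_step)
qed auto

text \<open>Nonempty reduced products of generators of length at most \<open>d\<close> act without fixed points: at a
  monomial of least positive degree in the product, multiplication changes the coefficient of a unit.\<close>

lemma no_fixed_point:
  assumes "is \<in> reduced d" "is \<noteq> []" and f: "f \<in> units d"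
  shows "foldr (step d) is f \<noteq> f"
proof
  assume fixed: "foldr (step d) is f = f"
  let ?C = "foldr (step d) is {[]}"
  have "{[]} \<in> units d" by (simp add: units_def Nil_reduced)
  then have C: "[] \<in> ?C" "?C \<subseteq> reduced d" using foldr_step_units[of "{[]}"] by (auto simp: units_def)
  have "\<exists>p. p \<in> ?C \<and> p \<noteq> []" using foldr_step_one_self[OF assms(1)] assms(2) by blast
  then obtain p where p: "p \<in> ?C" "p \<noteq> []" and least: "\<And>q. q \<in> ?C \<Longrightarrow> q \<noteq> [] \<Longrightarrow> length p \<le> length q"
    using ex_has_least_nat[of "\<lambda>p. p \<in> ?C \<and> p \<noteq> []" _ length] by blast
  have fs: "f \<subseteq> reduced d" "[] \<in> f" using f by (auto simp: units_def)
  have pr: "p \<in> reduced d" using p C by blast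
  let ?g = "\<lambda>n. of_bool (take n p \<in> ?C) * of_bool (drop n p \<in> f) :: bit"
  have "?g n = 0" if "n \<in> {..length p} - {0, length p}" for n
  proof -
    have "length (take n p) < length p" "take n p \<noteq> []" using that p(2) by auto
    then have "take n p \<notin> ?C" using least by fastforce
    then show ?thesis by simp
  qed
  then have "(\<Sum>n\<le>length p. ?g n) = (\<Sum>n\<in>{0, length p}. ?g n)"
    by (intro sum.mono_neutral_right) auto
  also have "\<dots> = of_bool (p \<in> f) + 1" using p C fs by simp
  finally have "(of_bool (p \<in> f) :: bit) = of_bool (p \<in> f) + 1"
    using foldr_step_product[OF fs(1) pr, of "is"] fixed by simp
  then show False by (cases "p \<in> f") auto
qed

definition edge_at :: "nat \<Rightarrow> nat list set \<Rightarrow> nat list set set" where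
  "edge_at d g = (\<lambda>i. step d i g) ` {..<3}"

context
  fixes d :: nat
  assumes d: "d \<ge> 4"
begin

lemma word_reduced:
  assumes "set w \<subseteq> {..<3}" "distinct_adj w" "length w \<le> 4"
  shows "w \<in> reduced d"
  using assms d by (simp add: reduced_def)

lemma step_inj_label:
  assumes "g \<in> units d" "i < 3" "j < 3" "step d i g = step d j g"
  shows "i = j"
proof (rule ccontr)
  assume "i \<noteq> j"
  then have "[i, j] \<in> reduced d" using assms by (intro word_reduced) auto
  from no_fixed_point[OF this _ assms(1)] have "step d i (step d j g) \<noteq> g" by simp
  moreover have "step d i (step d i g) = g" using assms(1) by (intro step_step) (simp add: units_def)
  ultimately show False using assms(4) by simp
qed

lemma step_inj: "g \<in> units d \<Longrightarrow> g' \<in> units d \<Longrightarrow> step d i g = step d i g' \<Longrightarrow> g = g'"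
  by (metis (no_types, lifting) mem_Collect_eq step_step units_def)

lemma card_edge_at: "g \<in> units d \<Longrightarrow> card (edge_at d g) = 3"
  unfolding edge_at_def using step_inj_label by (subst card_image) (auto simp: inj_on_def)

lemma edge_at_inj:
  assumes "g \<in> units d" "g' \<in> units d" "edge_at d g = edge_at d g'"
  shows "g = g'"
proof (rule ccontr)
  assume ne: "g \<noteq> g'"
  have mem: "\<exists>j<3. step d i g = step d j g'" if "i < 3" for i
  proof -
    have "step d i g \<in> edge_at d g" using that by (simp add: edge_at_def)
    then have "step d i g \<in> edge_at d g'" by (simp only: assms(3))
    then show ?thesis by (auto simp: edge_at_def)
  qed
  have lt: "(0 :: nat) < 3" "(1 :: nat) < 3" by simp_all
  from mem[OF lt(1)] obtain j where j: "j < 3" "step d 0 g = step d j g'" by (elim exE conjE)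
  from mem[OF lt(2)] obtain l where l: "l < 3" "step d 1 g = step d l g'" by (elim exE conjE)
  have u: "g \<subseteq> reduced d" "g' \<subseteq> reduced d" using assms by (auto simp: units_def)
  have "j \<noteq> 0" "l \<noteq> 1" using step_inj[OF assms(1,2)] ne j l by auto
  moreover have "j \<noteq> l" using step_inj_label[OF assms(1), of 0 1] j l by auto
  ultimately have "[0, j, l, 1] \<in> reduced d" using j l by (intro word_reduced) auto
  from no_fixed_point[OF this _ assms(1)]
  have "step d 0 (step d j (step d l (step d 1 g))) \<noteq> g" by simp
  moreover have "step d l (step d 1 g) = g'" "step d j (step d 0 g) = g'"
    using j l step_step[OF u(2)] by simp_all
  ultimately show False using j(2) step_step[OF u(1), of 0] step_step[OF u(2)] by simp
qed

text \<open>A set of edges without a leaf admits an infinite walk that never backtracks, neither at an edge nor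
  at a vertex. When it returns to an edge, the labels read off form a reduced product with a fixed point.\<close>

lemma leaf_exists:
  assumes F: "F \<subseteq> edge_at d ` units d" "F \<noteq> {}" "finite F" "2 * card F \<le> d"
  shows "\<exists>e. leaf_edge F e"
proof (rule ccontr)
  assume nl: "\<nexists>e. leaf_edge F e"
  define G where "G = {g \<in> units d. edge_at d g \<in> F}"
  have FG: "F = edge_at d ` G" using F(1) by (auto simp: G_def)
  have injG: "inj_on (edge_at d) G" using edge_at_inj by (auto simp: inj_on_def G_def)
  have G: "finite G" "card G = card F" using FG injG F(3) finite_image_iff card_image by metis+
  have walk: "\<exists>i i' g'. i < 3 \<and> i' < 3 \<and> i \<noteq> j \<and> i \<noteq> i' \<and> g' \<in> G \<and> g' = step d i' (step d i g)"
    if g: "g \<in> G" and j: "j < 3" for g j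
  proof -
    have gu: "g \<in> units d" "edge_at d g \<in> F" using g by (auto simp: G_def)
    have "step d j g \<in> edge_at d g" using j by (auto simp: edge_at_def)
    then obtain e' where e': "e' \<in> F" "e' \<noteq> edge_at d g" "\<not> edge_at d g \<inter> e' \<subseteq> {step d j g}"
    proof -
      have "\<not> leaf_edge F (edge_at d g)" using nl by simp
      then have "\<exists>e'\<in>F - {edge_at d g}. \<not> edge_at d g \<inter> e' \<subseteq> {step d j g}"
        unfolding leaf_edge_def using gu(2) \<open>step d j g \<in> edge_at d g\<close> by simp
      then show thesis using that by blast
    qed
    then obtain x where x: "x \<in> edge_at d g" "x \<in> e'" "x \<noteq> step d j g" by blast
    obtain g' where g': "g' \<in> G" "e' = edge_at d g'" using e' FG by auto
    obtain i i' where i: "i < 3" "x = step d i g" "i' < 3" "x = step d i' g'"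
      using x g' by (auto simp: edge_at_def)
    have "i \<noteq> j" using i x by auto
    moreover have "i \<noteq> i'" using step_inj[OF gu(1), of g' i] i g' e'(2) by (auto simp: G_def)
    moreover have "g' = step d i' (step d i g)"
      using i g' step_step[of g' d i'] by (simp add: G_def units_def)
    ultimately show ?thesis using i g' by blast
  qed
  obtain g0 where g0: "g0 \<in> G" using F(2) FG by auto
  have "\<exists>f. \<forall>n. (fst (f n) \<in> G \<and> snd (f n) < 3) \<and>
      (\<exists>i<3. i \<noteq> snd (f n) \<and> i \<noteq> snd (f (Suc n)) \<and> fst (f (Suc n)) = step d (snd (f (Suc n))) (step d i (fst (f n))))"
  proof (rule dependent_nat_choice)
    show "\<exists>x. fst x \<in> G \<and> snd x < (3 :: nat)" using g0 by (intro exI[of _ "(g0, 0)"]) simp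
    fix x :: "nat list set \<times> nat" and n :: nat
    assume x: "fst x \<in> G \<and> snd x < 3"
    then obtain i i' g' where "i < 3" "i' < 3" "i \<noteq> snd x" "i \<noteq> i'" "g' \<in> G" "g' = step d i' (step d i (fst x))"
      using walk[of "fst x" "snd x"] by blast
    then show "\<exists>y. (fst y \<in> G \<and> snd y < 3) \<and> (\<exists>i<3. i \<noteq> snd x \<and> i \<noteq> snd y \<and> fst y = step d (snd y) (step d i (fst x)))"
      by (intro exI[of _ "(g', i')"]) auto
  qed
  then obtain f where f: "\<forall>n. (fst (f n) \<in> G \<and> snd (f n) < 3) \<and>
      (\<exists>i<3. i \<noteq> snd (f n) \<and> i \<noteq> snd (f (Suc n)) \<and> fst (f (Suc n)) = step d (snd (f (Suc n))) (step d i (fst (f n))))" ..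
  have seg: "\<exists>w. length w = 2 * Suc m \<and> distinct_adj w \<and> set w \<subseteq> {..<3} \<and> hd w = snd (f (p + Suc m))
      \<and> foldr (step d) w (fst (f p)) = fst (f (p + Suc m))" for p m
  proof (induction m)
    case 0
    obtain i where "i < 3" "i \<noteq> snd (f (Suc p))" "fst (f (Suc p)) = step d (snd (f (Suc p))) (step d i (fst (f p)))"
      using f by blast
    then show ?case using f[rule_format, of "Suc p"]
      by (intro exI[of _ "[snd (f (Suc p)), i]"]) auto
  next
    case (Suc m)
    then obtain w where w: "length w = 2 * Suc m" "distinct_adj w" "set w \<subseteq> {..<3}" "hd w = snd (f (p + Suc m))"
      "foldr (step d) w (fst (f p)) = fst (f (p + Suc m))" by blast
    obtain i where i: "i < 3" "i \<noteq> snd (f (p + Suc m))" "i \<noteq> snd (f (Suc (p + Suc m)))"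
      "fst (f (Suc (p + Suc m))) = step d (snd (f (Suc (p + Suc m)))) (step d i (fst (f (p + Suc m))))"
      using f by blast
    obtain a w' where aw: "w = a # w'" using w(1) by (cases w) auto
    show ?case
      using w i f[rule_format, of "Suc (p + Suc m)"] unfolding aw
      by (intro exI[of _ "snd (f (Suc (p + Suc m))) # i # a # w'"]) auto
  qed
  have "\<not> inj_on (\<lambda>n. fst (f n)) {..card F}"
  proof
    assume "inj_on (\<lambda>n. fst (f n)) {..card F}"
    then have "card {..card F} \<le> card G"
      by (rule card_inj_on_le) (use f G in auto)
    then show False using G by simp
  qed
  then obtain p q where "p \<le> card F" "q \<le> card F" "p \<noteq> q" "fst (f p) = fst (f q)"
    by (auto simp: inj_on_def)
  then obtain p q where pq: "p < q" "q \<le> card F" "fst (f p) = fst (f q)"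
    by (metis linorder_neqE_nat)
  obtain m where m: "q = p + Suc m" using pq(1) less_iff_Suc_add by auto
  obtain w where w: "length w = 2 * Suc m" "distinct_adj w" "set w \<subseteq> {..<3}"
    "foldr (step d) w (fst (f p)) = fst (f q)" using seg[of m p] unfolding m by blast
  have "w \<in> reduced d" "w \<noteq> []" using w pq m F(4) by (auto simp: reduced_def)
  moreover have "fst (f p) \<in> units d" using f by (auto simp: G_def)
  ultimately show False using no_fixed_point w(4) pq(3) by metis
qed

lemma three_ndvd_two_power: "\<not> 3 dvd (2 :: nat) ^ n"
proof (induction n)
  case (Suc n)
  have "3 dvd x" if "3 dvd 2 * x" for x :: nat using that by presburger
  from this[of "2 ^ n"] Suc show ?case unfolding power_Suc by (rule contrapos_nn[rotated])
qed simp

text \<open>Every vertex lies on three edges, so a set meeting every edge exactly once would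
  have a third of the number of edges as its size, which is a power of two.\<close>

lemma no_exact_transversal:
  "\<not> (\<exists>A. \<forall>e\<in>edge_at d ` units d. card (e \<inter> A) = 1)"
proof
  assume "\<exists>A. \<forall>e\<in>edge_at d ` units d. card (e \<inter> A) = 1"
  then obtain A where A: "\<And>g. g \<in> units d \<Longrightarrow> card (edge_at d g \<inter> A) = 1" by blast
  have U: "units d = insert [] ` Pow (reduced d - {[]})"
  proof
    show "units d \<subseteq> insert [] ` Pow (reduced d - {[]})"
    proof
      fix f assume "f \<in> units d"
      then have "f = insert [] (f - {[]})" "f - {[]} \<in> Pow (reduced d - {[]})" by (auto simp: units_def)
      then show "f \<in> insert [] ` Pow (reduced d - {[]})" by blast
    qed
  qed (auto simp: units_def Nil_reduced)
  have fin: "finite (units d)" unfolding U using finite_reduced by simp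
  have "inj_on (insert []) (Pow (reduced d - {[]}))"
  proof (rule inj_onI)
    fix x y assume "x \<in> Pow (reduced d - {[]})" "y \<in> Pow (reduced d - {[]})" "insert [] x = insert [] y"
    moreover from this have "[] \<notin> x" "[] \<notin> y" by auto
    ultimately show "x = y" by (meson insert_ident)
  qed
  then have card: "card (units d) = 2 ^ card (reduced d - {[]})"
    unfolding U by (simp add: card_image card_Pow finite_reduced)
  have one: "(\<Sum>i<3. of_bool (step d i g \<in> A)) = (1 :: nat)" if g: "g \<in> units d" for g
  proof -
    have "inj_on (\<lambda>i. step d i g) {..<3}" using step_inj_label[OF g] by (auto simp: inj_on_def)
    then have "card (edge_at d g \<inter> A) = card {i. i < 3 \<and> step d i g \<in> A}"
    proof -
      assume i: "inj_on (\<lambda>i. step d i g) {..<3}"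
      have "edge_at d g \<inter> A = (\<lambda>i. step d i g) ` {i. i < 3 \<and> step d i g \<in> A}"
        by (auto simp: edge_at_def)
      moreover have "inj_on (\<lambda>i. step d i g) {i. i < 3 \<and> step d i g \<in> A}"
        using i by (rule inj_on_subset) auto
      ultimately show ?thesis by (simp add: card_image)
    qed
    moreover have "(\<Sum>i<3. of_bool (step d i g \<in> A)) = card {i. i < 3 \<and> step d i g \<in> A}"
      by (simp add: sum_of_bool_eq) (rule arg_cong[where f = card], auto)
    ultimately show ?thesis using A[OF g] by simp
  qed
  have row: "(\<Sum>g\<in>units d. of_bool (step d i g \<in> A)) = card (units d \<inter> A)" for i
  proof -
    have "(\<Sum>g\<in>units d. of_bool (step d i g \<in> A)) = card {g \<in> units d. step d i g \<in> A}"
      using fin by (simp add: sum_of_bool_eq) (rule arg_cong[where f = card], auto)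
    also have "\<dots> = card (units d \<inter> A)"
    proof (rule bij_betw_same_card[of "step d i"], rule bij_betwI[where g = "step d i"])
      show "step d i \<in> {g \<in> units d. step d i g \<in> A} \<rightarrow> units d \<inter> A" using step_units by auto
      show "step d i \<in> units d \<inter> A \<rightarrow> {g \<in> units d. step d i g \<in> A}"
        using step_units step_step by (auto simp: units_def)
    qed (auto intro!: step_step simp: units_def)
    finally show ?thesis .
  qed
  have "card (units d) = (\<Sum>g\<in>units d. \<Sum>i<3. of_bool (step d i g \<in> A))"
  proof -
    have "(\<Sum>g\<in>units d. \<Sum>i<3. of_bool (step d i g \<in> A)) = (\<Sum>g\<in>units d. (1 :: nat))"
      by (rule sum.cong[OF refl one])
    then show ?thesis by simp
  qed
  also have "\<dots> = (\<Sum>i<3. \<Sum>g\<in>units d. of_bool (step d i g \<in> A))" by (rule sum.swap)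
  also have "\<dots> = 3 * card (units d \<inter> A)" by (simp add: row)
  finally have "3 dvd (2 :: nat) ^ card (reduced d - {[]})" using card by simp
  then show False using three_ndvd_two_power by (rule notE[rotated])
qed

end

theorem local_forest_without_exact_transversal:
  "\<exists>H :: nat set set. finite H \<and> (\<forall>e\<in>H. card e = 3) \<and>
     (\<forall>F\<subseteq>H. F \<noteq> {} \<longrightarrow> card F \<le> k \<longrightarrow> (\<exists>e. leaf_edge F e)) \<and> \<not> (\<exists>A. \<forall>e\<in>H. card (e \<inter> A) = 1)"
proof -
  define d where "d = 2 * k + 4"
  have d: "d \<ge> 4" by (simp add: d_def)
  let ?H = "edge_at d ` units d"
  have fin: "finite (units d)"
    by (rule finite_subset[of _ "Pow (reduced d)"]) (auto simp: units_def finite_reduced)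
  obtain \<phi> :: "nat list set \<Rightarrow> nat" where \<phi>: "inj_on \<phi> (units d)"
    using finite_imp_inj_to_nat_seg[OF fin] by blast
  have sub: "e \<subseteq> units d" if "e \<in> ?H" for e using that step_units by (auto simp: edge_at_def)
  have inj: "inj_on \<phi> e" if "e \<in> ?H" for e using \<phi> sub[OF that] by (rule inj_on_subset)
  show ?thesis
  proof (intro exI[of _ "(`) \<phi> ` ?H"] conjI ballI allI impI)
    show "finite ((`) \<phi> ` ?H)" using fin by simp
    show "card e = 3" if "e \<in> (`) \<phi> ` ?H" for e
      using that card_edge_at[OF d] inj by (auto simp: card_image)
  next
    fix F assume F: "F \<subseteq> (`) \<phi> ` ?H" "F \<noteq> {}" "card F \<le> k"
    then obtain F' where F': "F' \<subseteq> ?H" "F = (`) \<phi> ` F'" by (meson subset_imageE)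
    have injF: "inj_on ((`) \<phi>) F'"
      using inj_on_image_Pow[OF \<phi>] by (rule inj_on_subset) (use F' sub in blast)
    then have "card F = card F'" using F' by (simp add: card_image)
    then have "2 * card F' \<le> d" using F by (simp add: d_def)
    moreover have "finite F'" using F'(1) fin finite_subset by blast
    ultimately obtain e p where e: "e \<in> F'" "p \<in> e" "\<forall>e'\<in>F' - {e}. e \<inter> e' \<subseteq> {p}"
      using leaf_exists[OF d F'(1)] F(2) F'(2) unfolding leaf_edge_def by auto
    show "\<exists>e. leaf_edge F e"
      unfolding leaf_edge_def
    proof (intro exI[of _ "\<phi> ` e"] conjI bexI[of _ "\<phi> p"] ballI)
      fix e' assume "e' \<in> F - {\<phi> ` e}"
      then obtain e'' where e'': "e'' \<in> F'" "e' = \<phi> ` e''" "e'' \<noteq> e" using F'(2) by auto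
      have "\<phi> ` e \<inter> \<phi> ` e'' = \<phi> ` (e \<inter> e'')"
        by (rule inj_on_image_Int[OF \<phi> sub sub, symmetric]) (use F'(1) e(1) e''(1) in auto)
      then show "\<phi> ` e \<inter> e' \<subseteq> {\<phi> p}" using e(3) e'' by auto
    qed (use e F'(2) in auto)
  next
    show "\<not> (\<exists>A. \<forall>e\<in>(`) \<phi> ` ?H. card (e \<inter> A) = 1)"
    proof
      assume "\<exists>A. \<forall>e\<in>(`) \<phi> ` ?H. card (e \<inter> A) = 1"
      then obtain A where A0: "\<forall>e\<in>(`) \<phi> ` ?H. card (e \<inter> A) = 1" ..
      have A: "card (\<phi> ` e \<inter> A) = 1" if "e \<in> ?H" for e using bspec[OF A0 imageI[OF that]] .
      have "card (e \<inter> \<phi> -` A) = 1" if "e \<in> ?H" for e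
      proof -
        have "\<phi> ` e \<inter> A = \<phi> ` (e \<inter> \<phi> -` A)" by auto
        moreover have "inj_on \<phi> (e \<inter> \<phi> -` A)" using inj[OF that] by (rule inj_on_subset) auto
        ultimately show ?thesis using A[OF that] by (simp add: card_image)
      qed
      then show False using no_exact_transversal[OF d] by blast
    qed
  qed
qed

section \<open>Nonfinitely based varieties\<close>

subsection \<open>Finite algebras satisfying the identities in few letters\<close>

lemma satisfies_inj:
  assumes A: "ai_semiring A" and h: "h \<in> alg_hom A B" "inj_on h (elems A)" and sat: "satisfies B e"
  shows "satisfies A e"
  unfolding satisfies_def
proof (intro allI impI)
  fix v :: "nat \<Rightarrow> 'a" assume v: "range v \<subseteq> elems A"
  then have "range (h \<circ> v) \<subseteq> elems B" using h unfolding alg_hom_def by auto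
  then have "h (eval_tm A v (fst e)) = h (eval_tm A v (snd e))"
    using eval_hom[OF A h(1) v] sat unfolding satisfies_def by simp
  then show "eval_tm A v (fst e) = eval_tm A v (snd e)"
    using h(2) eval_closed[OF A v] by (meson inj_onD)
qed

lemma satisfies_copies: "A \<in> copies B \<Longrightarrow> satisfies A e \<longleftrightarrow> satisfies B e"
proof -
  assume "A \<in> copies B"
  then obtain h where h: "ai_semiring A" "h \<in> alg_hom A B" "inj_on h (elems A)" "h ` elems A = elems B"
    by (auto simp: copies_def bij_betw_def)
  show ?thesis using satisfies_inj[OF h(1-3)] satisfies_image[OF h(1,2,4)] by metis
qed

lemma copies_nonempty:
  fixes B :: "'b alg"
  assumes inf: "infinite (UNIV :: 'u set)" and B: "ai_semiring B" "finite (elems B)"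
  shows "\<exists>A :: 'u alg. A \<in> copies B"
proof -
  obtain T :: "'u set" where T: "finite T" "card T = card (elems B)"
    using infinite_arbitrarily_large[OF inf, of "card (elems B)"] by auto
  then obtain g where "bij_betw g (elems B) T" using B(2) by (metis finite_same_card_bij)
  then have g: "inj_on g (elems B)" by (simp add: bij_betw_def)
  define g' where "g' = the_inv_into (elems B) g"
  have g': "g' (g x) = x" if "x \<in> elems B" for x using g that by (simp add: g'_def the_inv_into_f_f)
  define A where "A = \<lparr>elems = g ` elems B, sadd = (\<lambda>x y. g (sadd B (g' x) (g' y))),
    smul = (\<lambda>x y. g (smul B (g' x) (g' y)))\<rparr>"
  have gh: "g \<in> alg_hom B A" unfolding alg_hom_def A_def by (auto simp: g')
  have "ai_semiring A" by (rule ai_semiring_image[OF B(1) gh]) (simp add: A_def)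
  moreover have "g' \<in> alg_hom A B" unfolding alg_hom_def A_def using ai_closed[OF B(1)] by (auto simp: g')
  moreover have "bij_betw g' (elems A) (elems B)"
    by (rule bij_betwI[where g = g]) (auto simp: A_def g')
  ultimately show ?thesis unfolding copies_def by blast
qed

definition identity_of :: "nat multiset set \<Rightarrow> nat multiset \<Rightarrow> tm \<times> tm" where
  "identity_of S w = (let t = SOME t. words t = S in (t, Sum t (prodtm (sorted_list_of_multiset w))))"

lemma satisfies_identity_of:
  assumes "comm_ai A" "good S" "w \<noteq> {#}"
  shows "satisfies A (identity_of S w) \<longleftrightarrow> ent A S w"
proof -
  interpret comm_ai_semiring A by unfold_locales fact
  define t where "t = (SOME t. words t = S)"
  have t: "words t = S" unfolding t_def by (rule someI_ex) (use words_surj assms(2) in \<open>auto simp: good_def\<close>)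
  have "sorted_list_of_multiset w \<noteq> []" using assms(3) by (metis mset.simps(1) mset_sorted_list_of_multiset)
  then have w: "words (prodtm (sorted_list_of_multiset w)) = {w}" by (simp add: words_prodtm)
  have "identity_of S w = (t, Sum t (prodtm (sorted_list_of_multiset w)))"
    by (simp add: identity_of_def t_def Let_def)
  then show ?thesis by (auto simp: satisfies_iff_ent t w ent_refl)
qed

definition letters_below :: "nat \<Rightarrow> nat multiset set \<Rightarrow> nat multiset \<Rightarrow> bool" where
  "letters_below k S w \<longleftrightarrow> \<Union> (set_mset ` S) \<union> set_mset w \<subseteq> {..<k}"

text \<open>A finite basis involves finitely many letters, so an algebra satisfying all identities in
  those letters lies in the variety.\<close>

lemma finite_basis_criterion:
  fixes W :: "'u alg set"
  assumes inf: "infinite (UNIV :: 'u set)" and W: "\<And>A. A \<in> W \<Longrightarrow> comm_ai A"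
    and fb: "finitely_based W"
  shows "\<exists>k. \<forall>B :: 'b alg. comm_ai B \<longrightarrow> finite (elems B) \<longrightarrow>
     (\<forall>S w. good S \<longrightarrow> w \<noteq> {#} \<longrightarrow> letters_below k S w \<longrightarrow> Ent W S w \<longrightarrow> ent B S w) \<longrightarrow>
     (\<forall>S w. good S \<longrightarrow> w \<noteq> {#} \<longrightarrow> Ent W S w \<longrightarrow> ent B S w)"
proof -
  obtain E where E: "finite E" "W = {A. ai_semiring A \<and> (\<forall>e\<in>E. satisfies A e)}"
    using fb unfolding finitely_based_def by auto
  define L where "L = (\<Union>e\<in>E. \<Union> (set_mset ` words (fst e)) \<union> \<Union> (set_mset ` words (snd e)))"
  have "finite L" using E(1) finite_words by (auto simp: L_def)
  then obtain k where k: "L \<subseteq> {..<k}"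
    using finite_nat_set_iff_bounded[of L] by auto
  show ?thesis
  proof (intro exI[of _ k] allI impI)
    fix B :: "'b alg" and S w
    assume B: "comm_ai B" "finite (elems B)"
      and loc: "\<forall>S w. good S \<longrightarrow> w \<noteq> {#} \<longrightarrow> letters_below k S w \<longrightarrow> Ent W S w \<longrightarrow> ent B S w"
      and S: "good S" "w \<noteq> {#}" "Ent W S w"
    interpret B: comm_ai_semiring B by unfold_locales (rule B(1))
    have "satisfies B e" if "e \<in> E" for e
    proof -
      obtain s t where e: "e = (s, t)" by fastforce
      have "holds_in W (s, t)" using E(2) that e unfolding holds_in_def by blast
      then have st: "\<forall>w\<in>words t. Ent W (words s) w" "\<forall>w\<in>words s. Ent W (words t) w"
        using holds_in_iff_Ent[of W s t] W by blast+
      have sub: "\<Union> (set_mset ` words s) \<subseteq> {..<k}" "\<Union> (set_mset ` words t) \<subseteq> {..<k}"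
        using k that unfolding L_def e by force+
      have lb: "letters_below k (words a) x"
        if "x \<in> words b" "\<Union> (set_mset ` words a) \<subseteq> {..<k}" "\<Union> (set_mset ` words b) \<subseteq> {..<k}" for a b x
      proof -
        have "set_mset x \<subseteq> \<Union> (set_mset ` words b)" using that(1) by (rule UN_upper)
        from subset_trans[OF this that(3)] that(2) show ?thesis by (simp add: letters_below_def)
      qed
      have ne: "x \<noteq> {#}" if "x \<in> words b" for x b using that empty_notin_words[of b] by (cases "x = {#}") simp_all
      have "ent B (words s) x" if "x \<in> words t" for x
        using loc[rule_format, OF good_words ne[OF that] lb[OF that sub]] st(1) that by simp
      moreover have "ent B (words t) x" if "x \<in> words s" for x
        using loc[rule_format, OF good_words ne[OF that] lb[OF that sub(2,1)]] st(2) that by simp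
      ultimately show ?thesis unfolding e B.satisfies_iff_ent by blast
    qed
    moreover obtain A :: "'u alg" where A: "A \<in> copies B" using copies_nonempty[OF inf B.ai B(2)] by blast
    ultimately have AW: "A \<in> W" unfolding E(2) using satisfies_copies[OF A] A by (simp add: copies_def)
    have "ent A S w" using S(3) AW by (simp add: Ent_def)
    then have "satisfies A (identity_of S w)"
      by (rule satisfies_identity_of[OF W[OF AW] S(1,2), THEN iffD2])
    then show "ent B S w" unfolding satisfies_copies[OF A] satisfies_identity_of[OF B(1) S(1,2)] .
  qed
qed

lemma wval_cong: 
  assumes "comm_ai A" "range v \<subseteq> elems A" "range v' \<subseteq> elems A" "u \<noteq> {#}" "\<And>n. n \<in># u \<Longrightarrow> v n = v' n"
  shows "wval A v u = wval A v' u"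
proof -
  interpret comm_ai_semiring A by unfold_locales fact
  show ?thesis using assms(4,5)
    by (induction u rule: nonempty_mset_induct)
      (simp_all add: wval_add[OF assms(2)] wval_add[OF assms(3)] wval_single[OF assms(2)] wval_single[OF assms(3)])
qed

subsection \<open>Consequences valid in \<open>S\<^sub>7\<^sup>0\<close>\<close>

abbreviation S70 :: "s7 option alg" where "S70 \<equiv> adjoin_zero S7"

lemma smul_S7: "smul S7 x y = (if x = S7_one then y else if y = S7_one then x else S7_inf)"
  by (simp add: S7_def)

lemma comm_ai_S70: "comm_ai S70" by (rule comm_ai_adjoin_zero[OF comm_ai_S7])

text \<open>If all words of \<open>S\<close> have the value \<open>a\<close> in \<open>S\<^sub>7\<close>, then the letters that are not sent to \<open>1\<close>
  meet every word of \<open>S\<close> exactly once. When no such set of letters exists, the value \<open>a\<close>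
  is excluded, and the remaining values are handled by the contents of words.\<close>

lemma ent_S70_no_transversal:
  assumes S: "good S" and w: "w \<noteq> {#}" "set_mset w = \<Union> (set_mset ` S)"
    and nt: "\<And>A. \<exists>u\<in>S. size (filter_mset (\<lambda>n. n \<in> A) u) \<noteq> 1"
  shows "ent S70 S w"
  unfolding ent_def
proof (intro allI impI ballI)
  fix v :: "nat \<Rightarrow> s7 option" and z
  assume v: "range v \<subseteq> elems S70" and z: "\<forall>u\<in>S. le S70 (wval S70 v u) z"
  interpret comm_ai_semiring S70 by unfold_locales (rule comm_ai_S70)
  have none: "wval S70 v u = None \<longleftrightarrow> (\<exists>n\<in>#u. v n = None)" if "u \<noteq> {#}" for u
    using that
  proof (induction u rule: nonempty_mset_induct)
    case (add n u)
    then show ?case by (cases "v n"; cases "wval S70 v u") (auto simp: wval_add[OF v] adjoin_ops)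
  qed (simp add: wval_single[OF v])
  have one: "wval S70 v u = Some S7_one \<longleftrightarrow> (\<forall>n\<in>#u. v n = Some S7_one)" if "u \<noteq> {#}" for u
    using that
  proof (induction u rule: nonempty_mset_induct)
    case (add n u)
    then show ?case by (cases "v n"; cases "wval S70 v u") (auto simp: wval_add[OF v] adjoin_ops smul_S7)
  qed (simp add: wval_single[OF v])
  have a: "size (filter_mset (\<lambda>n. v n \<noteq> Some S7_one) u) = 1" if "u \<noteq> {#}" "wval S70 v u = Some S7_a" for u
    using that
  proof (induction u rule: nonempty_mset_induct)
    case (add n u)
    from add.prems have "v n = Some S7_one \<and> wval S70 v u = Some S7_a \<or> v n = Some S7_a \<and> wval S70 v u = Some S7_one"
      by (cases "v n"; cases "wval S70 v u") (auto simp: wval_add[OF v add(1)] adjoin_ops smul_S7 split: if_splits)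
    then show ?case
    proof
      assume h: "v n = Some S7_a \<and> wval S70 v u = Some S7_one"
      then have "filter_mset (\<lambda>n. v n \<noteq> Some S7_one) u = {#}" using one[OF add(1)] by (simp add: filter_mset_eq_conv)
      then show ?thesis using h by simp
    qed (use add.IH in simp)
  qed (simp add: wval_single[OF v])
  have ne: "u \<noteq> {#}" if "u \<in> S" for u using S that by (auto simp: good_def)
  have flat: "le S7 x y \<longleftrightarrow> x = y \<or> y = S7_inf" for x y by (auto simp: le_def S7_def)
  show "le S70 (wval S70 v w) z"
  proof (cases "\<exists>n\<in>#w. v n = None")
    case True
    then have "wval S70 v w = None" using none[OF w(1)] by simp
    then show ?thesis by simp
  next
    case False
    have some: "wval S70 v u \<noteq> None" if "u \<in> S" for u using none[OF ne[OF that]] False w(2) that by blast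
    obtain u0 where "u0 \<in> S" using S by (auto simp: good_def)
    then obtain c where c: "z = Some c" using z some by (cases z) (auto, metis le_adjoin(3) option.exhaust)
    have val: "wval S70 v u = Some c \<or> c = S7_inf" if "u \<in> S" for u
      using z some that unfolding c by (metis flat le_adjoin(2) option.exhaust)
    show ?thesis
    proof (cases c)
      case S7_one
      then have "\<forall>n\<in>#w. v n = Some S7_one" using val one ne w(2) by auto
      then show ?thesis using one[OF w(1)] c S7_one by (simp add: flat)
    next
      case S7_a
      then have "size (filter_mset (\<lambda>n. v n \<noteq> Some S7_one) u) = 1" if "u \<in> S" for u using val a ne that by auto
      then show ?thesis using nt[of "{n. v n \<noteq> Some S7_one}"] by auto
    next
      case S7_inf
      then show ?thesis using c by (cases "wval S70 v w") (auto simp: flat)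
    qed
  qed
qed

subsection \<open>The odd cycle algebras\<close>

text \<open>\<open>Vs P\<close> is a sum of vertices. The single element \<open>Edge\<close> is the value of all edges and of their sums; sets of
  vertices cannot be identified in this way, since distributivity has to hold for vertices with a common
  neighbour.\<close>

datatype cyc = Vs "nat set" | Edge | Bad

definition adj :: "nat \<Rightarrow> nat \<Rightarrow> nat \<Rightarrow> bool" where
  "adj N i j \<longleftrightarrow> j = Suc i \<or> i = Suc j \<or> i = 0 \<and> j = N - 1 \<or> i = N - 1 \<and> j = 0"

fun cyc_add :: "cyc \<Rightarrow> cyc \<Rightarrow> cyc" where
  "cyc_add (Vs P) (Vs Q) = Vs (P \<union> Q)"
| "cyc_add Edge Edge = Edge"
| "cyc_add _ _ = Bad"

fun cyc_mul :: "nat \<Rightarrow> cyc \<Rightarrow> cyc \<Rightarrow> cyc" where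
  "cyc_mul N (Vs P) (Vs Q) = (if \<forall>i\<in>P. \<forall>j\<in>Q. adj N i j then Edge else Bad)"
| "cyc_mul N _ _ = Bad"

definition cyc_alg :: "nat \<Rightarrow> cyc alg" where
  "cyc_alg N = \<lparr>elems = Vs ` {P. P \<noteq> {} \<and> P \<subseteq> {..<N}} \<union> {Edge, Bad}, sadd = cyc_add, smul = cyc_mul N\<rparr>"

lemma cyc_mul_Bad: "cyc_mul N x Bad = Bad" "cyc_mul N x Edge = Bad" "cyc_mul N Bad x = Bad" "cyc_mul N Edge x = Bad"
  by (cases x; simp)+

lemma cyc_mul_range: "cyc_mul N x y = Edge \<or> cyc_mul N x y = Bad"
  by (cases x; cases y) auto

lemma cyc_mul_mul: "cyc_mul N (cyc_mul N x y) z = Bad" "cyc_mul N z (cyc_mul N x y) = Bad"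
  using cyc_mul_range[of N x y] by (auto simp: cyc_mul_Bad)

lemma comm_ai_cyc: "comm_ai (cyc_alg N)"
proof -
  have mc: "cyc_mul N x y = cyc_mul N y x" for x y
    by (cases x; cases y) (auto simp: adj_def)
  have d: "cyc_mul N x (cyc_add y z) = cyc_add (cyc_mul N x y) (cyc_mul N x z)" for x y z
    by (cases x; cases y; cases z) (auto simp: cyc_mul_Bad)
  have ac: "cyc_add (cyc_add x y) z = cyc_add x (cyc_add y z)" for x y z
    by (cases x; cases y; cases z) (auto simp: Un_assoc)
  have c: "cyc_add x y = cyc_add y x" for x y by (cases x; cases y) (auto simp: Un_commute)
  have i: "cyc_add x x = x" for x by (cases x) auto
  have cl: "cyc_add x y \<in> elems (cyc_alg N)" "cyc_mul N x y \<in> elems (cyc_alg N)"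
    if "x \<in> elems (cyc_alg N)" "y \<in> elems (cyc_alg N)" for x y
    using that cyc_mul_range[of N x y] by (auto simp: cyc_alg_def)
  have d': "cyc_mul N (cyc_add x y) z = cyc_add (cyc_mul N x z) (cyc_mul N y z)" for x y z
    using d[of z x y] by (simp only: mc[of _ z])
  have ops: "sadd (cyc_alg N) = cyc_add" "smul (cyc_alg N) = cyc_mul N" by (simp_all add: cyc_alg_def)
  have "elems (cyc_alg N) \<noteq> {}" by (simp add: cyc_alg_def)
  then show ?thesis
    unfolding comm_ai_def ai_semiring_def ops
    by (intro conjI ballI) (assumption | rule cl ac d d' c i mc | simp only: cyc_mul_mul)+
qed

lemma le_cyc: "le (cyc_alg N) x Bad" "le (cyc_alg N) x Edge \<longleftrightarrow> x = Edge"
  "le (cyc_alg N) x (Vs Q) \<longleftrightarrow> (\<exists>P\<subseteq>Q. x = Vs P)"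
  by (cases x; auto simp: le_def cyc_alg_def)+

text \<open>A word with a value other than \<open>Bad\<close> has length at most two.\<close>

lemma wval_cyc:
  assumes v: "range v \<subseteq> elems (cyc_alg N)" and u: "u \<noteq> {#}" "wval (cyc_alg N) v u \<noteq> Bad"
  shows "(\<exists>n. u = {#n#} \<and> wval (cyc_alg N) v u = v n) \<or>
    (\<exists>p q P Q. u = {#p, q#} \<and> v p = Vs P \<and> v q = Vs Q \<and> (\<forall>i\<in>P. \<forall>j\<in>Q. adj N i j) \<and> wval (cyc_alg N) v u = Edge)"
proof -
  interpret comm_ai_semiring "cyc_alg N" by unfold_locales (rule comm_ai_cyc)
  have sm: "smul (cyc_alg N) = cyc_mul N" by (simp add: cyc_alg_def)
  obtain n u' where n: "u = add_mset n u'" using u(1) by (cases u) auto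
  show ?thesis
  proof (cases u')
    case empty then show ?thesis by (simp add: n wval_single[OF v])
  next
    case (add m u'')
    show ?thesis
    proof (cases "u'' = {#}")
      case True
      then have m: "wval (cyc_alg N) v u = cyc_mul N (v n) (v m)"
        by (simp add: n add wval_add[OF v] wval_single[OF v] sm)
      then obtain P Q where "v n = Vs P" "v m = Vs Q" using u(2) by (cases "v n"; cases "v m") auto
      then show ?thesis using m u(2) True by (auto simp: n add split: if_splits)
    next
      case False
      then have "wval (cyc_alg N) v u = cyc_mul N (v n) (cyc_mul N (v m) (wval (cyc_alg N) v u''))"
        by (simp add: n add wval_add[OF v] sm)
      then show ?thesis using u(2) by (simp add: cyc_mul_mul)
    qed
  qed
qed

lemma size_cyc:
  assumes "range v \<subseteq> elems (cyc_alg N)" "u \<noteq> {#}" "wval (cyc_alg N) v u \<noteq> Bad"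
  shows "size u \<le> 2"
  using wval_cyc[OF assms] by auto

lemma Vs_cyc:
  assumes "range v \<subseteq> elems (cyc_alg N)" "v n = Vs P"
  shows "P \<noteq> {}" "P \<subseteq> {..<N}"
proof -
  have "Vs P \<in> elems (cyc_alg N)" using assms by (metis rangeI subsetD)
  then show "P \<noteq> {}" "P \<subseteq> {..<N}" by (auto simp: cyc_alg_def)
qed

definition cycle_edges :: "nat \<Rightarrow> nat multiset set" where
  "cycle_edges N = (\<lambda>i. {#i, Suc i#}) ` {i. Suc i < N} \<union> {{#0, N - 1#}}"

text \<open>A set meeting every edge of a cycle exactly once alternates along the cycle, which is impossible when the length is
  odd. In the cycle algebra itself the product of three or more vertices is \<open>Bad\<close>.\<close>

lemma cycle_consequence:
  assumes "odd N" "N \<ge> 3"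
  shows "ent S70 (cycle_edges N) (mset_set {..<N})"
    and "\<not> ent (cyc_alg N) (cycle_edges N) (mset_set {..<N})"
    and "good (cycle_edges N)" "mset_set {..<N} \<noteq> {#}"
proof -
  have "finite {i. Suc i < N}" by (rule finite_subset[of _ "{..<N}"]) auto
  then show g: "good (cycle_edges N)" and ne: "mset_set {..<N} \<noteq> {#}"
    using assms by (auto simp: good_def cycle_edges_def mset_set_empty_iff lessThan_empty_iff)
  have U: "\<Union> (set_mset ` cycle_edges N) = {..<N}"
  proof
    show "{..<N} \<subseteq> \<Union> (set_mset ` cycle_edges N)"
    proof
      fix i assume "i \<in> {..<N}"
      then have "Suc i < N \<or> i = N - 1" by auto
      then show "i \<in> \<Union> (set_mset ` cycle_edges N)" by (auto simp: cycle_edges_def)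
    qed
  qed (use assms in \<open>auto simp: cycle_edges_def\<close>)
  show "ent S70 (cycle_edges N) (mset_set {..<N})"
  proof (rule ent_S70_no_transversal[OF g ne])
    fix A :: "nat set"
    show "\<exists>u\<in>cycle_edges N. size (filter_mset (\<lambda>n. n \<in> A) u) \<noteq> 1"
    proof (rule ccontr)
      assume "\<not> ?thesis"
      then have one: "size (filter_mset (\<lambda>n. n \<in> A) u) = 1" if "u \<in> cycle_edges N" for u using that by blast
      have "(Suc i \<in> A) \<noteq> (i \<in> A)" if "Suc i < N" for i
        using one[of "{#i, Suc i#}"] that by (auto simp: cycle_edges_def split: if_splits)
      then have "(i \<in> A) = ((0 \<in> A) = even i)" if "i < N" for i using that by (induction i) auto
      from this[of "N - 1"] have "(N - 1 \<in> A) = (0 \<in> A)" using assms by auto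
      then show False using one[of "{#0, N - 1#}"] by (auto simp: cycle_edges_def split: if_splits)
    qed
  qed (simp add: U)
  define v where "v n = (if n < N then Vs {n} else Bad)" for n
  have v: "range v \<subseteq> elems (cyc_alg N)" by (auto simp: v_def cyc_alg_def)
  interpret comm_ai_semiring "cyc_alg N" by unfold_locales (rule comm_ai_cyc)
  show "\<not> ent (cyc_alg N) (cycle_edges N) (mset_set {..<N})"
  proof
    assume e: "ent (cyc_alg N) (cycle_edges N) (mset_set {..<N})"
    have "le (cyc_alg N) (wval (cyc_alg N) v (mset_set {..<N})) Edge"
    proof (rule entD[OF e v])
      fix u assume "u \<in> cycle_edges N"
      then consider i where "u = {#i, Suc i#}" "Suc i < N" | "u = {#0, N - 1#}"
        by (auto simp: cycle_edges_def)
      then show "le (cyc_alg N) (wval (cyc_alg N) v u) Edge"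
        using assms
        by cases (simp_all add: wval_add[OF v] wval_single[OF v] le_cyc, auto simp: v_def cyc_alg_def adj_def)
    qed (simp add: cyc_alg_def)
    then have "wval (cyc_alg N) v (mset_set {..<N}) = Edge" by (simp add: le_cyc)
    then have "size (mset_set {..<N}) \<le> 2" by (intro size_cyc[OF v ne]) simp
    then show False using assms by simp
  qed
qed

text \<open>A map from few letters to a long cycle misses a vertex, so the graph formed by the two-letter
  words that it maps to edges is bipartite. In the absence of \<open>law_AB\<close> and \<open>law_path\<close>, a word
  derivable from a bipartite graph is one of the given words: otherwise the graph could be folded
  onto a path of length three that the word closes up.\<close>

lemma cycle_local:
  assumes "base_consequence E" "\<not> obeys E law_AB" "\<not> obeys E law_path"
    and N: "odd N" "k < N" and S: "good S" "w \<noteq> {#}" "letters_below k S w" and e: "E S w"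
  shows "ent (cyc_alg N) S w"
  unfolding ent_def
proof (intro allI impI ballI)
  interpret base_consequence E by fact
  fix v :: "nat \<Rightarrow> cyc" and z
  assume v: "range v \<subseteq> elems (cyc_alg N)" and z: "\<forall>u\<in>S. le (cyc_alg N) (wval (cyc_alg N) v u) z"
  interpret C: comm_ai_semiring "cyc_alg N" by unfold_locales (rule comm_ai_cyc)
  have ne: "u \<noteq> {#}" if "u \<in> S" for u using S that by (auto simp: good_def)
  have "w \<in> S" if zB: "z \<noteq> Bad"
  proof (cases "z = Edge")
    case False
    then obtain Q where Q: "z = Vs Q" using zB by (cases z) auto
    define \<sigma> where "\<sigma> n = (if {#n#} \<in> S then {#0, 1#} else {#0, 0, 1, 1 :: nat#})" for n
    have "sub \<sigma> w = {#0, 1#}"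
    proof (rule rigid_AB[OF e S(1,2) assms(2)])
      fix u assume u: "u \<in> S"
      then obtain P where "wval (cyc_alg N) v u = Vs P" using z by (auto simp: Q le_cyc)
      then obtain n where "u = {#n#}" using wval_cyc[OF v ne[OF u]] by auto
      then show "sub \<sigma> u = {#0, 1#}" using u by (simp add: \<sigma>_def)
    qed (auto simp: \<sigma>_def)
    moreover have "\<sigma> n \<noteq> {#}" for n by (simp add: \<sigma>_def)
    ultimately consider n where "w = {#n#}" "\<sigma> n = {#0, 1#}" | p where "\<sigma> p = {#0#}"
      using two_letters[OF S(2)] by blast
    then show ?thesis by cases (auto simp: \<sigma>_def split: if_splits)
  next
    case True
    define pt where "pt n = (SOME i. \<exists>P. v n = Vs P \<and> i \<in> P)" for n
    have pt: "pt n \<in> P" if "v n = Vs P" for n P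
    proof -
      have "P \<noteq> {}" using Vs_cyc[OF v that] by simp
      then have "\<exists>i. \<exists>P. v n = Vs P \<and> i \<in> P" using that by auto
      from someI_ex[OF this] show ?thesis using that by (auto simp: pt_def)
    qed
    have ptN: "pt n < N" if "v n = Vs P" for n P
    proof -
      have "P \<subseteq> {..<N}" using Vs_cyc[OF v that] by simp
      then show ?thesis using pt[OF that] by auto
    qed
    have "card (pt ` {..<k}) < card {..<N}" using card_image_le[of "{..<k}" pt] N(2) by simp
    then have "\<not> {..<N} \<subseteq> pt ` {..<k}" using card_mono[of "pt ` {..<k}" "{..<N}"] by auto
    then obtain m where m: "m < N" "m \<notin> pt ` {..<k}" by auto
    define \<chi> where "\<chi> n \<longleftrightarrow> (even (pt n)) \<noteq> (pt n > m)" for n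
    have words: "(\<exists>n. u = {#n#} \<and> v n = Edge) \<or> (\<exists>p q. u = {#p, q#} \<and> v p \<noteq> Edge \<and> v q \<noteq> Edge \<and> \<chi> p \<and> \<not> \<chi> q)"
      if u: "u \<in> S" for u
    proof -
      have val: "wval (cyc_alg N) v u = Edge" using z u by (auto simp: True le_cyc)
      have lt: "n < k" if "n \<in># u" for n using S(3) u that by (auto simp: letters_below_def)
      from wval_cyc[OF v ne[OF u]] val consider n where "u = {#n#}" "v n = Edge"
        | p q P Q where "u = {#p, q#}" "v p = Vs P" "v q = Vs Q" "\<forall>i\<in>P. \<forall>j\<in>Q. adj N i j" by auto
      then show ?thesis
      proof cases
        case 2
        have a: "adj N (pt p) (pt q)" using 2 pt by blast
        have nm: "pt p \<noteq> m" "pt q \<noteq> m" using m(2) lt[of p] lt[of q] 2(1) by auto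
        have "\<chi> p \<noteq> \<chi> q" using a nm ptN[OF 2(2)] ptN[OF 2(3)] N(1) m(1)
          unfolding \<chi>_def adj_def by (elim disjE conjE) auto
        then show ?thesis using 2 by (metis add_mset_commute cyc.distinct(1))
      qed auto
    qed
    have vert: "v n \<noteq> Edge \<Longrightarrow> {#n#} \<notin> S" "n \<in> \<Union> (set_mset ` S) \<Longrightarrow> {#n#} \<notin> S \<Longrightarrow> v n \<noteq> Edge" for n
      using words by fastforce+
    define \<sigma> where "\<sigma> n = (if {#n#} \<in> S then {#0, 1#} else if n \<in> \<Union> (set_mset ` S)
       then if \<chi> n then {#0#} else {#1#} else {#0, 0, 1, 1 :: nat#})" for n
    have "sub \<sigma> w = {#0, 1#}"
    proof (rule rigid_AB[OF e S(1,2) assms(2)])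
      fix u assume u: "u \<in> S"
      from words[OF u] show "sub \<sigma> u = {#0, 1#}"
      proof (elim disjE exE conjE)
        fix n assume "u = {#n#}" then show ?thesis using u by (simp add: \<sigma>_def)
      next
        fix p q assume pq: "u = {#p, q#}" "v p \<noteq> Edge" "v q \<noteq> Edge" "\<chi> p" "\<not> \<chi> q"
        have "p \<in> \<Union> (set_mset ` S)" "q \<in> \<Union> (set_mset ` S)" using u pq(1) by (auto intro!: bexI[of _ u])
        then have "\<sigma> p = {#0#}" "\<sigma> q = {#1#}" using pq vert(1) by (simp_all add: \<sigma>_def)
        then show ?thesis by (simp add: pq(1))
      qed
    qed (auto simp: \<sigma>_def)
    moreover have "\<sigma> n \<noteq> {#}" for n by (simp add: \<sigma>_def)
    ultimately consider n where "w = {#n#}" "\<sigma> n = {#0, 1#}" | p q where "w = {#p, q#}" "\<sigma> p = {#0#}" "\<sigma> q = {#1#}"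
      using two_letters[OF S(2)] by blast
    then show ?thesis
    proof cases
      case 1 then show ?thesis by (auto simp: \<sigma>_def split: if_splits)
    next
      case 2
      then have \<chi>: "\<chi> p" "\<not> \<chi> q" and ns: "{#p#} \<notin> S" "{#q#} \<notin> S"
        by (auto simp: \<sigma>_def split: if_splits)
      show ?thesis
      proof (rule ccontr)
        assume wS: "w \<notin> S"
        define \<tau> where "\<tau> n = (if {#n#} \<in> S then {#1, 2#} else if n = p then {#0#} else if n = q then {#3#}
          else if \<chi> n then {#2#} else {#1 :: nat#})" for n
        have e1: "E (sub \<tau> ` S) (sub \<tau> w)"
          by (rule subst) (use S e in \<open>auto simp: good_def \<tau>_def\<close>)
        have e2: "sub \<tau> w = {#0, 3#}" using \<chi> ns by (auto simp: 2(1) \<tau>_def)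
        have e3: "sub \<tau> ` S \<subseteq> {{#0, 1#}, {#1, 2#}, {#2, 3#}}"
        proof
          fix x assume "x \<in> sub \<tau> ` S"
          then obtain u where u: "u \<in> S" "x = sub \<tau> u" by auto
          from words[OF u(1)] show "x \<in> {{#0, 1#}, {#1, 2#}, {#2, 3#}}"
          proof (elim disjE exE conjE)
            fix n assume "u = {#n#}" then show ?thesis using u by (simp add: \<tau>_def)
          next
            fix r s assume rs: "u = {#r, s#}" "v r \<noteq> Edge" "v s \<noteq> Edge" "\<chi> r" "\<not> \<chi> s"
            have "\<not> (r = p \<and> s = q)" using wS u(1) rs(1) 2(1) by auto
            moreover have "\<tau> r = (if r = p then {#0#} else {#2#})" "\<tau> s = (if s = q then {#3#} else {#1#})"
              using rs vert(1) \<chi> by (auto simp: \<tau>_def)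
            ultimately show ?thesis by (auto simp: u(2) rs(1) add_mset_commute)
          qed
        qed
        have "E {{#0, 1#}, {#1, 2#}, {#2, 3#}} {#0, 3#}" using mono[OF e1 e3] unfolding e2 .
        then show False using assms(3) by (simp add: obeys_def law_path_def)
      qed
    qed
  qed
  then show "le (cyc_alg N) (wval (cyc_alg N) v w) z" using z le_cyc(1) by (cases "z = Bad") auto
qed

lemma finite_cyc: "finite (elems (cyc_alg N))"
  by (simp add: cyc_alg_def)

theorem not_finitely_based_cycle:
  fixes W :: "'u alg set"
  assumes inf: "infinite (UNIV :: 'u set)" and W: "\<And>A. A \<in> W \<Longrightarrow> comm_ai A" "base_consequence (Ent W)"
    and S70: "\<And>S w. good S \<Longrightarrow> w \<noteq> {#} \<Longrightarrow> ent S70 S w \<Longrightarrow> Ent W S w"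
    and n: "\<not> obeys (Ent W) law_AB" "\<not> obeys (Ent W) law_path"
  shows "\<not> finitely_based W"
proof
  assume "finitely_based W"
  from finite_basis_criterion[OF inf W(1) this, where ?'b = cyc]
  obtain k where k: "\<forall>B :: cyc alg. comm_ai B \<longrightarrow> finite (elems B) \<longrightarrow>
     (\<forall>S w. good S \<longrightarrow> w \<noteq> {#} \<longrightarrow> letters_below k S w \<longrightarrow> Ent W S w \<longrightarrow> ent B S w) \<longrightarrow>
     (\<forall>S w. good S \<longrightarrow> w \<noteq> {#} \<longrightarrow> Ent W S w \<longrightarrow> ent B S w)" ..
  define N where "N = 2 * k + 3"
  have N: "odd N" "k < N" "N \<ge> 3" by (simp_all add: N_def)
  note cyc = cycle_consequence[OF N(1,3)]
  have "ent (cyc_alg N) (cycle_edges N) (mset_set {..<N})"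
  proof (rule k[rule_format, OF comm_ai_cyc finite_cyc])
    show "ent (cyc_alg N) S w" if "good S" "w \<noteq> {#}" "letters_below k S w" "Ent W S w" for S w
      by (rule cycle_local[OF W(2) n N(1,2) that])
  qed (use cyc S70 in auto)
  then show False using cycle_consequence(2)[OF N(1,3)] by blast
qed

subsection \<open>The hypergraph algebras\<close>

text \<open>\<open>Co v\<close> is the common value of the products \<open>uw\<close> over all edges \<open>{u, v, w}\<close>, and \<open>Top\<close> that
  of the products of the three vertices of an edge.\<close>

datatype hyp = Vx nat | Co nat | Top | Inf

fun hyp_mul :: "nat set set \<Rightarrow> hyp \<Rightarrow> hyp \<Rightarrow> hyp" where
  "hyp_mul H (Vx u) (Vx v) = (if \<exists>w. {u, v, w} \<in> H then Co (THE w. {u, v, w} \<in> H) else Inf)"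
| "hyp_mul H (Vx u) (Co v) = (if u = v then Top else Inf)"
| "hyp_mul H (Co u) (Vx v) = (if u = v then Top else Inf)"
| "hyp_mul H _ _ = Inf"

definition hyp_alg :: "nat set set \<Rightarrow> hyp alg" where
  "hyp_alg H = \<lparr>elems = Vx ` \<Union>H \<union> Co ` \<Union>H \<union> {Top, Inf},
     sadd = (\<lambda>x y. if x = y then x else Inf), smul = hyp_mul H\<rparr>"

locale linear_hypergraph =
  fixes H :: "nat set set"
  assumes finite_H: "finite H" and card_H: "e \<in> H \<Longrightarrow> card e = 3"
    and linear: "e \<in> H \<Longrightarrow> e' \<in> H \<Longrightarrow> e \<noteq> e' \<Longrightarrow> \<exists>p. e \<inter> e' \<subseteq> {p}"
begin

lemma edge_distinct: "{u, v, w} \<in> H \<Longrightarrow> u \<noteq> v \<and> u \<noteq> w \<and> v \<noteq> w"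
  using card_H[of "{u, v, w}"] by (auto simp: card_insert_if split: if_splits)

lemma edge_cases:
  assumes "e \<in> H"
  obtains u v w where "e = {u, v, w}" "u \<noteq> v" "u \<noteq> w" "v \<noteq> w"
proof -
  from card_H[OF assms] obtain u v w where "e = {u, v, w} \<and> u \<noteq> v \<and> v \<noteq> w \<and> u \<noteq> w"
    unfolding card_3_iff by blast
  then show thesis using that by blast
qed

lemma same_edge:
  assumes "e \<in> H" "e' \<in> H" "a \<noteq> b" "a \<in> e" "b \<in> e" "a \<in> e'" "b \<in> e'"
  shows "e = e'"
proof (rule ccontr)
  assume "e \<noteq> e'"
  then obtain p where "e \<inter> e' \<subseteq> {p}" using linear[OF assms(1,2)] by blast
  then show False using assms(3-7) by blast
qed

lemma third_unique:
  assumes "{u, v, w} \<in> H" "{u, v, w'} \<in> H"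
  shows "w = w'"
proof -
  have d: "u \<noteq> v" "w \<noteq> u" "w \<noteq> v" using edge_distinct[OF assms(1)] by auto
  have "{u, v, w} = {u, v, w'}" by (rule same_edge[OF assms d(1)]) auto
  then show ?thesis using d by blast
qed

lemma mul_Vx: "hyp_mul H (Vx u) (Vx v) = Co w \<longleftrightarrow> {u, v, w} \<in> H"
proof
  assume "{u, v, w} \<in> H"
  moreover from this have "(THE w. {u, v, w} \<in> H) = w" using third_unique by blast
  ultimately show "hyp_mul H (Vx u) (Vx v) = Co w" by auto
next
  assume e: "hyp_mul H (Vx u) (Vx v) = Co w"
  then obtain w' where w': "{u, v, w'} \<in> H" by (auto split: if_splits)
  then have "(THE w. {u, v, w} \<in> H) = w'" using third_unique by blast
  then show "{u, v, w} \<in> H" using e w' by (auto split: if_splits)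
qed

lemma mul_Vx_cases: "(\<exists>w. hyp_mul H (Vx u) (Vx v) = Co w \<and> {u, v, w} \<in> H)
    \<or> hyp_mul H (Vx u) (Vx v) = Inf \<and> (\<forall>w. {u, v, w} \<notin> H)"
proof (cases "\<exists>w. {u, v, w} \<in> H")
  case True
  then obtain w where "{u, v, w} \<in> H" ..
  then show ?thesis using mul_Vx by blast
qed simp

lemma mul_Inf: "hyp_mul H x Inf = Inf" "hyp_mul H Inf x = Inf" by (cases x; simp)+

lemma mul_comm_hyp: "hyp_mul H x y = hyp_mul H y x"
  by (cases x; cases y) (auto simp: insert_commute)

lemma mul_not_Vx: "hyp_mul H x y \<noteq> Vx u"
  by (cases x; cases y) auto

text \<open>Both bracketings of a triple product are \<open>Top\<close> on edges and \<open>Inf\<close> otherwise; this gives associativity.\<close>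

lemma mul3: "hyp_mul H (hyp_mul H x y) z =
    (if \<exists>u v w. x = Vx u \<and> y = Vx v \<and> z = Vx w \<and> {u, v, w} \<in> H then Top else Inf)"
proof (cases "\<exists>u v w. x = Vx u \<and> y = Vx v \<and> z = Vx w")
  case True
  then obtain u v w where xyz: "x = Vx u" "y = Vx v" "z = Vx w" by blast
  from mul_Vx_cases[of u v] show ?thesis
  proof
    assume "\<exists>w. hyp_mul H (Vx u) (Vx v) = Co w \<and> {u, v, w} \<in> H"
    then obtain w' where w': "hyp_mul H (Vx u) (Vx v) = Co w'" "{u, v, w'} \<in> H" by blast
    have "w' = w \<longleftrightarrow> {u, v, w} \<in> H" using w'(2) third_unique by blast
    then show ?thesis by (simp add: xyz w'(1) del: hyp_mul.simps(1))
  next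
    assume "hyp_mul H (Vx u) (Vx v) = Inf \<and> (\<forall>w. {u, v, w} \<notin> H)"
    then show ?thesis by (simp add: xyz)
  qed
next
  case False
  have "hyp_mul H (hyp_mul H x y) z = Inf"
  proof (cases "\<exists>u v. x = Vx u \<and> y = Vx v")
    case True
    then obtain u v where uv: "x = Vx u" "y = Vx v" by blast
    then have "\<forall>w. z \<noteq> Vx w" using False by blast
    then show ?thesis using mul_Vx_cases[of u v] unfolding uv by (cases z) (auto simp del: hyp_mul.simps(1))
  next
    case False
    then have "hyp_mul H x y = Top \<or> hyp_mul H x y = Inf" by (cases x; cases y) auto
    then show ?thesis by (cases z) auto
  qed
  then show ?thesis using False by auto
qed

text \<open>Since sums of distinct elements are \<open>Inf\<close>, distributivity amounts to this cancellation property. It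
  needs two edges to share at most one vertex.\<close>

lemma mul_cancel:
  assumes "hyp_mul H x y = hyp_mul H x z" "hyp_mul H x y \<noteq> Inf"
  shows "y = z"
proof (cases x)
  case (Vx u)
  show ?thesis
  proof (cases y)
    case y: (Vx v)
    obtain w where w: "hyp_mul H x y = Co w" "{u, v, w} \<in> H" using mul_Vx_cases[of u v] assms(2) Vx y by auto
    show ?thesis
    proof (cases z)
      case z: (Vx v')
      have "{u, v', w} \<in> H" using w(1) assms(1) mul_Vx[of u v' w] Vx z by simp
      then have "{u, w, v'} \<in> H" "{u, w, v} \<in> H" using w(2) by (simp_all add: insert_commute)
      then show ?thesis using third_unique y z by blast
    qed (use w assms(1) Vx in \<open>auto split: if_splits\<close>)
  next
    case y: (Co v)
    then have "hyp_mul H x y = Top" "u = v" using assms(2) Vx by (auto split: if_splits)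
    then show ?thesis using assms(1) Vx y by (cases z) (auto split: if_splits)
  qed (use assms Vx in auto)
next
  case (Co u)
  then show ?thesis using assms by (cases y; cases z) (auto split: if_splits)
qed (use assms in auto)

lemma comm_ai_hyp: "comm_ai (hyp_alg H)"
proof -
  let ?add = "\<lambda>x y. if x = y then x else Inf"
  have ops: "sadd (hyp_alg H) = ?add" "smul (hyp_alg H) = hyp_mul H" by (simp_all add: hyp_alg_def)
  have assoc: "hyp_mul H (hyp_mul H x y) z = hyp_mul H x (hyp_mul H y z)" for x y z
  proof -
    have *: "{u, v, w} \<in> H \<longleftrightarrow> {v, w, u} \<in> H" for u v w by (simp add: insert_commute)
    show ?thesis unfolding mul_comm_hyp[of x "hyp_mul H y z"] mul3 using * by metis
  qed
  have dist: "hyp_mul H x (?add y z) = ?add (hyp_mul H x y) (hyp_mul H x z)" for x y z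
  proof (cases "y = z")
    case False
    then have "hyp_mul H x z = Inf" if "hyp_mul H x y = hyp_mul H x z" using mul_cancel[of x y z] that by metis
    then show ?thesis using False by (auto simp: mul_Inf)
  qed simp
  have dist': "hyp_mul H (?add y z) x = ?add (hyp_mul H y x) (hyp_mul H z x)" for x y z
    using dist[of x y z] by (simp only: mul_comm_hyp[of _ x])
  have cl: "?add x y \<in> elems (hyp_alg H)" "hyp_mul H x y \<in> elems (hyp_alg H)"
    if "x \<in> elems (hyp_alg H)" "y \<in> elems (hyp_alg H)" for x y
  proof -
    show "?add x y \<in> elems (hyp_alg H)" using that by (auto simp: hyp_alg_def)
    show "hyp_mul H x y \<in> elems (hyp_alg H)"
    proof (cases "hyp_mul H x y")
      case (Co w)
      then obtain u v where "x = Vx u" "y = Vx v" by (cases x; cases y) (auto split: if_splits)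
      then have "{u, v, w} \<in> H" using Co mul_Vx by simp
      then have "w \<in> \<Union>H" by blast
      then show ?thesis by (simp add: Co hyp_alg_def)
    qed (use mul_not_Vx in \<open>auto simp: hyp_alg_def\<close>)
  qed
  have "elems (hyp_alg H) \<noteq> {}" by (simp add: hyp_alg_def)
  then show ?thesis
    unfolding comm_ai_def ai_semiring_def ops
    by (intro conjI ballI) (assumption | rule cl assoc dist dist' mul_comm_hyp | simp)+
qed

lemma finite_hyp: "finite (elems (hyp_alg H))"
proof -
  have "finite e" if "e \<in> H" for e using card_H[OF that] by (metis card.infinite zero_neq_numeral)
  then show ?thesis using finite_H by (simp add: hyp_alg_def)
qed

lemma le_hyp: "le (hyp_alg H) x y \<longleftrightarrow> x = y \<or> y = Inf"
  by (auto simp: le_def hyp_alg_def)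

lemma wval_hyp_Top:
  assumes v: "range v \<subseteq> elems (hyp_alg H)" and u: "u \<noteq> {#}"
  shows "wval (hyp_alg H) v u = Top \<longleftrightarrow> (\<exists>n. u = {#n#} \<and> v n = Top)
    \<or> (\<exists>p q x. u = {#p, q#} \<and> v p = Vx x \<and> v q = Co x)
    \<or> (\<exists>p q r a b c. u = {#p, q, r#} \<and> v p = Vx a \<and> v q = Vx b \<and> v r = Vx c \<and> {a, b, c} \<in> H)"
    (is "_ \<longleftrightarrow> ?R")
proof -
  interpret comm_ai_semiring "hyp_alg H" by unfold_locales (rule comm_ai_hyp)
  have sm: "smul (hyp_alg H) = hyp_mul H" by (simp add: hyp_alg_def)
  have three: "wval (hyp_alg H) v {#p, q, r#} = hyp_mul H (hyp_mul H (v p) (v q)) (v r)" for p q r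
  proof -
    have "wval (hyp_alg H) v {#p, q, r#} = hyp_mul H (v p) (hyp_mul H (v q) (v r))"
      by (simp add: wval_add[OF v] wval_single[OF v] sm)
    also have "\<dots> = hyp_mul H (hyp_mul H (v q) (v r)) (v p)" by (rule mul_comm_hyp)
    also have "\<dots> = hyp_mul H (hyp_mul H (v p) (v q)) (v r)"
    proof -
      have *: "{a, b, c} \<in> H \<longleftrightarrow> {b, c, a} \<in> H" for a b c by (simp add: insert_commute)
      show ?thesis unfolding mul3 using * by metis
    qed
    finally show ?thesis .
  qed
  show ?thesis
  proof
    assume T: "wval (hyp_alg H) v u = Top"
    obtain p u1 where p: "u = add_mset p u1" using u by (cases u) auto
    show ?R
    proof (cases u1)
      case empty then show ?thesis using T by (simp add: p wval_single[OF v])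
    next
      case q: (add q u2)
      show ?thesis
      proof (cases u2)
        case empty
        then have "hyp_mul H (v p) (v q) = Top" using T by (simp add: p q wval_add[OF v] wval_single[OF v] sm)
        then have "(\<exists>x. v p = Vx x \<and> v q = Co x) \<or> (\<exists>x. v q = Vx x \<and> v p = Co x)"
          by (cases "v p"; cases "v q") (auto split: if_splits)
        then show ?thesis using empty by (auto simp: p q add_mset_commute)
      next
        case r: (add r u3)
        show ?thesis
        proof (cases "u3 = {#}")
          case True
          then have "hyp_mul H (hyp_mul H (v p) (v q)) (v r) = Top" using T three by (simp add: p q r)
          then show ?thesis unfolding mul3 using True by (auto simp: p q r split: if_splits)
        next
          case False
          then have "hyp_mul H (v p) (hyp_mul H (v q) (hyp_mul H (v r) (wval (hyp_alg H) v u3))) = Top"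
            using T by (simp add: p q r wval_add[OF v] sm)
          then have "hyp_mul H (hyp_mul H (v q) (hyp_mul H (v r) (wval (hyp_alg H) v u3))) (v p) = Top"
            by (simp add: mul_comm_hyp)
          then show ?thesis unfolding mul3 using mul_not_Vx by (metis hyp.distinct(11))
        qed
      qed
    qed
  next
    assume ?R
    then show "wval (hyp_alg H) v u = Top"
    proof (elim disjE exE conjE)
      fix p q r a b c assume "u = {#p, q, r#}" "v p = Vx a" "v q = Vx b" "v r = Vx c" "{a, b, c} \<in> H"
      then show ?thesis using three[of p q r] mul3[of "v p" "v q" "v r"] by auto
    qed (simp_all add: wval_add[OF v] wval_single[OF v] sm)
  qed
qed

end

lemma three_colours:
  assumes "a < (3 :: nat)" "b < 3" "c < 3"
  shows "{#a, b, c#} = {#0, 1, 2#} \<longleftrightarrow> a \<noteq> b \<and> a \<noteq> c \<and> b \<noteq> c"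
proof -
  have "a = 0 \<or> a = 1 \<or> a = 2" "b = 0 \<or> b = 1 \<or> b = 2" "c = 0 \<or> c = 1 \<or> c = 2" using assms by linarith+
  then show ?thesis by (elim disjE) (simp_all add: multiset_eq_iff, (metis zero_neq_numeral)+)
qed

fun hyp_word :: "(nat \<Rightarrow> nat) \<Rightarrow> hyp \<Rightarrow> nat multiset" where
  "hyp_word c (Vx x) = {#c x#}"
| "hyp_word c (Co x) = {#0, 1, 2#} - {#c x#}"
| "hyp_word c Top = {#0, 1, 2#}"
| "hyp_word c Inf = {#0, 0, 1, 1, 2, 2#}"

lemma hyp_word_props:
  assumes "c x < 3"
  shows "size (hyp_word c (Co x)) = 2" "add_mset (c x) (hyp_word c (Co x)) = {#0, 1, 2#}"
    "set_mset (hyp_word c (Co x)) \<subseteq> {0, 1, 2}"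
proof -
  have m: "c x \<in># {#0, 1, 2#}" using assms by auto
  show "size (hyp_word c (Co x)) = 2" using m by (simp add: size_Diff_singleton)
  show "add_mset (c x) (hyp_word c (Co x)) = {#0, 1, 2#}" using m by simp
  show "set_mset (hyp_word c (Co x)) \<subseteq> {0, 1, 2}" by (auto dest: in_diffD)
qed

lemma word_forms:
  assumes "w \<noteq> {#}" "size w \<le> 3"
  obtains n where "w = {#n#}" | p q where "w = {#p, q#}" | p q r where "w = {#p, q, r#}"
proof -
  obtain p w1 where p: "w = add_mset p w1" using assms(1) by (cases w) auto
  show thesis
  proof (cases w1)
    case empty then show thesis using that(1) p by simp
  next
    case q: (add q w2)
    show thesis
    proof (cases w2)
      case empty then show thesis using that(2) p q by simp
    next
      case r: (add r w3)
      then have "w3 = {#}" using assms(2) by (simp add: p q)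
      then show thesis using that(3) p q r by simp
    qed
  qed
qed

context linear_hypergraph
begin

text \<open>The vertices named by the values of few letters span a hyperforest. Each of its colourings with
  three colours is a substitution taking the words of value \<open>Top\<close> to \<open>xyz\<close>; as the colourings separate
  vertices and non-edges, a word taken to \<open>xyz\<close> by all of them has the value \<open>Top\<close>.\<close>

lemma hyp_local_Top:
  assumes leaf: "\<And>F. F \<subseteq> H \<Longrightarrow> F \<noteq> {} \<Longrightarrow> card F \<le> K \<Longrightarrow> \<exists>e. leaf_edge F e"
    and E: "base_consequence E" "\<not> obeys E law_ABC" and k: "k * k \<le> K"
    and S: "good S" "w \<noteq> {#}" "letters_below k S w" and e: "E S w"
    and v: "range v \<subseteq> elems (hyp_alg H)" and Top: "\<And>u. u \<in> S \<Longrightarrow> wval (hyp_alg H) v u = Top"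
  shows "wval (hyp_alg H) v w = Top"
proof -
  interpret E: base_consequence E by fact
  define V where "V = {x. \<exists>n<k. v n = Vx x \<or> v n = Co x}"
  define F where "F = {e \<in> H. \<exists>a b. a \<in> V \<and> b \<in> V \<and> a \<noteq> b \<and> a \<in> e \<and> b \<in> e}"
  have FH: "F \<subseteq> H" by (auto simp: F_def)
  have finF: "finite F" using FH finite_H finite_subset by blast
  have cardV: "finite V \<and> card V \<le> k"
  proof -
    define lab where "lab n = (case v n of Vx x \<Rightarrow> x | Co x \<Rightarrow> x | _ \<Rightarrow> 0)" for n
    have "V \<subseteq> lab ` {..<k}" unfolding V_def lab_def by (force simp: image_iff)
    then show ?thesis using card_mono[of "lab ` {..<k}" V] card_image_le[of "{..<k}" lab] finite_subset by fastforce
  qed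
  have cardF: "card F \<le> K"
  proof -
    have "\<exists>ab. fst ab \<in> V \<and> snd ab \<in> V \<and> fst ab \<noteq> snd ab \<and> fst ab \<in> e \<and> snd ab \<in> e" if "e \<in> F" for e
      using that by (auto simp: F_def)
    then obtain f where f: "\<And>e. e \<in> F \<Longrightarrow> fst (f e) \<in> V \<and> snd (f e) \<in> V \<and> fst (f e) \<noteq> snd (f e)
        \<and> fst (f e) \<in> e \<and> snd (f e) \<in> e" by metis
    have "inj_on f F"
    proof (rule inj_onI)
      fix e e' assume ee: "e \<in> F" "e' \<in> F" "f e = f e'"
      show "e = e'"
        by (rule same_edge[of e e' "fst (f e)" "snd (f e)"]) (use f[OF ee(1)] f[OF ee(2)] ee FH in auto)
    qed
    moreover have "f ` F \<subseteq> V \<times> V" using f by (simp add: image_subset_iff mem_Times_iff)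
    ultimately have "card F \<le> card (V \<times> V)" using cardV by (intro card_inj_on_le) auto
    also have "\<dots> \<le> k * k" using cardV by (simp add: card_cartesian_product mult_le_mono)
    finally show ?thesis using k by simp
  qed
  have forest: "hyperforest F"
    unfolding hyperforest_def
  proof (intro conjI ballI allI impI)
    show "\<exists>e. leaf_edge F' e" if "F' \<subseteq> F" "F' \<noteq> {}" for F'
      by (rule leaf) (use that FH cardF card_mono[OF finF that(1)] in auto)
  qed (use finF FH card_H in auto)
  note col = hyperforest_colouring[OF forest]
  have sep: "\<exists>c. rainbow c F \<and> c a \<noteq> c b" if "a \<noteq> b" for a b
    using col[THEN conjunct1, rule_format, OF that] .
  have tri: "\<exists>c. rainbow c F \<and> \<not> inj_on c {a, b, d}" if "a \<noteq> b" "a \<noteq> d" "b \<noteq> d" "{a, b, d} \<notin> F" for a b d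
    using col[THEN conjunct2, rule_format, OF that] .
  define \<sigma> where "\<sigma> c n = (if n < k then hyp_word c (v n) else {#0, 0, 1, 1, 2, 2#})" for c n
  have lt: "n < k" if "n \<in># u" "u \<in> S \<or> u = w" for n u using S(3) that by (auto simp: letters_below_def)
  have ne: "u \<noteq> {#}" if "u \<in> S" for u using S that by (auto simp: good_def)
  have full: "sub (\<sigma> c) w = {#0, 1, 2#}" and sne: "\<And>n. \<sigma> c n \<noteq> {#}" if c: "rainbow c F" for c
  proof -
    have c3: "c x < 3" for x using rainbow_less[OF c] .
    have p: "\<sigma> c n \<noteq> {#} \<and> set_mset (\<sigma> c n) \<subseteq> {0, 1, 2}" for n
    proof (cases "n < k")
      case True
      show ?thesis
      proof (cases "v n")
        case (Vx x)
        have "c x = 0 \<or> c x = 1 \<or> c x = 2" using c3[of x] by linarith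
        then show ?thesis using True Vx by (auto simp: \<sigma>_def)
      next
        case (Co x)
        then have "\<sigma> c n = hyp_word c (Co x)" using True by (simp add: \<sigma>_def)
        moreover have "hyp_word c (Co x) \<noteq> {#}" using hyp_word_props(1)[of c x, OF c3] by (metis size_empty zero_neq_numeral)
        ultimately show ?thesis using hyp_word_props(3)[of c x, OF c3] by simp
      qed (use True in \<open>auto simp: \<sigma>_def\<close>)
    qed (auto simp: \<sigma>_def)
    then show "\<And>n. \<sigma> c n \<noteq> {#}" by blast
    show "sub (\<sigma> c) w = {#0, 1, 2#}"
    proof (rule E.rigid_ABC[OF e S(1,2) E(2) p])
      fix u assume u: "u \<in> S"
      have l: "\<And>n. n \<in># u \<Longrightarrow> n < k" using lt u by blast
      from Top[OF u] show "sub (\<sigma> c) u = {#0, 1, 2#}"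
        unfolding wval_hyp_Top[OF v ne[OF u]]
      proof (elim disjE exE conjE)
        fix n assume "u = {#n#}" "v n = Top" then show ?thesis using l[of n] by (simp add: \<sigma>_def)
      next
        fix p q x assume h: "u = {#p, q#}" "v p = Vx x" "v q = Co x"
        then have "sub (\<sigma> c) u = add_mset (c x) (hyp_word c (Co x))" using l[of p] l[of q] by (simp add: \<sigma>_def)
        then show ?thesis using hyp_word_props(2)[of c x, OF c3] by simp
      next
        fix p q r a b d
        assume h: "u = {#p, q, r#}" "v p = Vx a" "v q = Vx b" "v r = Vx d" "{a, b, d} \<in> H"
        have "p < k" "q < k" "r < k" using l by (auto simp: h(1))
        then have s: "sub (\<sigma> c) u = {#c a, c b, c d#}" "a \<in> V" "b \<in> V"
          using h by (auto simp: \<sigma>_def V_def)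
        have dist: "a \<noteq> b \<and> a \<noteq> d \<and> b \<noteq> d" by (rule edge_distinct[OF h(5)])
        then have "{a, b, d} \<in> F" using h(5) s unfolding F_def by blast
        then have "inj_on c {a, b, d}" using c unfolding rainbow_def by blast
        then have "c a \<noteq> c b \<and> c a \<noteq> c d \<and> c b \<noteq> c d" using dist by (auto simp: inj_on_def)
        then show ?thesis unfolding s(1) using three_colours[OF c3 c3 c3] by blast
      qed
    qed
  qed
  obtain c0 where c0: "rainbow c0 F" using sep[of 0 "Suc 0"] by auto
  have size1: "size (\<sigma> c0 n) \<ge> 1" for n using sne[OF c0, of n] by (simp add: Suc_leI nonempty_has_size)
  have size_sub: "size (sub (\<sigma> c0) u) \<ge> size u" for u
  proof (induction u)
    case (add n u) then show ?case using size1[of n] by simp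
  qed simp
  have sw: "size (sub (\<sigma> c0) w) = 3" unfolding full[OF c0] by simp
  have val: "n \<in># w \<Longrightarrow> \<sigma> c n = hyp_word c (v n)" for c n using lt by (simp add: \<sigma>_def)
  have szw: "size (hyp_word c0 (Co x)) = 2" for x using hyp_word_props(1)[of c0 x] rainbow_less[OF c0] by blast
  have sz: "size (hyp_word c0 y) = (case y of Vx x \<Rightarrow> 1 | Co x \<Rightarrow> 2 | Top \<Rightarrow> 3 | Inf \<Rightarrow> 6)" for y
    using szw by (cases y) (auto simp del: hyp_word.simps(2))
  have "size w \<le> 3" using size_sub[of w] sw by simp
  with S(2) show ?thesis
  proof (cases rule: word_forms)
    case (1 n)
    then have "size (hyp_word c0 (v n)) = 3" using sw val[of n c0] by simp
    then have "v n = Top" unfolding sz by (cases "v n") simp_all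
    with 1 show ?thesis unfolding wval_hyp_Top[OF v S(2)] by (intro disjI1 exI[of _ n] conjI)
  next
    case (2 p q)
    have "size (hyp_word c0 (v p)) + size (hyp_word c0 (v q)) = 3" using sw val[of p c0] val[of q c0] 2 by simp
    then have "(\<exists>x y. v p = Vx x \<and> v q = Co y) \<or> (\<exists>x y. v q = Vx x \<and> v p = Co y)"
      unfolding sz by (cases "v p"; cases "v q") simp_all
    moreover have "w = {#q, p#}" using 2 by (simp add: add_mset_commute)
    ultimately obtain p' q' x y where pq: "w = {#p', q'#}" "v p' = Vx x" "v q' = Co y"
      using 2 by blast
    have "x = y"
    proof (rule ccontr)
      assume "x \<noteq> y"
      then obtain c where c: "rainbow c F" "c x \<noteq> c y" using sep by blast
      have "add_mset (c x) (hyp_word c (Co y)) = {#0, 1, 2#}"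
        using full[OF c(1)] val[of p' c] val[of q' c] pq by simp
      then have "add_mset (c x) (hyp_word c (Co y)) = add_mset (c y) (hyp_word c (Co y))"
        using hyp_word_props(2)[of c y, OF rainbow_less[OF c(1)]] by simp
      then show False using c(2) by simp
    qed
    with pq show ?thesis unfolding wval_hyp_Top[OF v S(2)]
      by - (rule disjI2, rule disjI1, rule exI[of _ p'], rule exI[of _ q'], rule exI[of _ x], simp)
  next
    case (3 p q r)
    have "size (hyp_word c0 (v p)) + size (hyp_word c0 (v q)) + size (hyp_word c0 (v r)) = 3"
      using sw val[of p c0] val[of q c0] val[of r c0] 3 by simp
    moreover have ge: "size (hyp_word c0 y) \<ge> 1" for y unfolding sz by (cases y) simp_all
    ultimately have one: "size (hyp_word c0 (v p)) = 1" "size (hyp_word c0 (v q)) = 1" "size (hyp_word c0 (v r)) = 1"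
      using ge[of "v p"] ge[of "v q"] ge[of "v r"] by linarith+
    have is_Vx: "\<exists>x. y = Vx x" if "size (hyp_word c0 y) = 1" for y
      using that unfolding sz by (cases y) simp_all
    obtain a b d where abd: "v p = Vx a" "v q = Vx b" "v r = Vx d"
      using is_Vx[OF one(1)] is_Vx[OF one(2)] is_Vx[OF one(3)] by blast
    have cols: "c a \<noteq> c b \<and> c a \<noteq> c d \<and> c b \<noteq> c d" if c: "rainbow c F" for c
    proof -
      have "{#c a, c b, c d#} = {#0, 1, 2#}"
        using full[OF c] val[of p c] val[of q c] val[of r c] abd 3 by (simp add: add_mset_commute)
      then show ?thesis using three_colours[OF rainbow_less[OF c] rainbow_less[OF c] rainbow_less[OF c]] by blast
    qed
    have d: "a \<noteq> b" "a \<noteq> d" "b \<noteq> d" using cols[OF c0] by auto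
    have "{a, b, d} \<in> F"
    proof (rule ccontr)
      assume "{a, b, d} \<notin> F"
      from tri[OF d this] obtain c where c: "rainbow c F" "\<not> inj_on c {a, b, d}" by blast
      then show False using cols[OF c(1)] by (auto simp: inj_on_def)
    qed
    then have "{a, b, d} \<in> H" using FH by blast
    with abd 3 show ?thesis unfolding wval_hyp_Top[OF v S(2)]
      by (intro disjI2 exI[of _ p] exI[of _ q] exI[of _ r] exI[of _ a] exI[of _ b] exI[of _ d] conjI)
  qed
qed

text \<open>Values \<open>Vx x\<close> and \<open>Co x\<close> are reduced to \<open>Top\<close> by multiplying with a fresh letter of the
  complementary value.\<close>

lemma hyp_local:
  assumes leaf: "\<And>F. F \<subseteq> H \<Longrightarrow> F \<noteq> {} \<Longrightarrow> card F \<le> K \<Longrightarrow> \<exists>e. leaf_edge F e"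
    and E: "base_consequence E" "\<not> obeys E law_ABC" and k: "Suc k * Suc k \<le> K"
    and S: "good S" "w \<noteq> {#}" "letters_below k S w" and e: "E S w"
  shows "ent (hyp_alg H) S w"
  unfolding ent_def
proof (intro allI impI ballI)
  interpret E: base_consequence E by fact
  interpret A: comm_ai_semiring "hyp_alg H" by unfold_locales (rule comm_ai_hyp)
  have sm: "smul (hyp_alg H) = hyp_mul H" by (simp add: hyp_alg_def)
  fix v :: "nat \<Rightarrow> hyp" and z
  assume v: "range v \<subseteq> elems (hyp_alg H)" and zH: "z \<in> elems (hyp_alg H)"
    and z: "\<forall>u\<in>S. le (hyp_alg H) (wval (hyp_alg H) v u) z"
  have ne: "u \<noteq> {#}" if "u \<in> S" for u using S that by (auto simp: good_def)
  have lb: "letters_below (Suc k) S w" using S(3) unfolding letters_below_def by force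
  have comp: "wval (hyp_alg H) v w = z" if z': "z' \<in> elems (hyp_alg H)" "\<And>y. hyp_mul H z' y = Top \<longleftrightarrow> y = z"
    and val: "\<And>u. u \<in> S \<Longrightarrow> wval (hyp_alg H) v u = z" for z'
  proof -
    define v' where "v' = v(k := z')"
    have v': "range v' \<subseteq> elems (hyp_alg H)" using v z' by (auto simp: v'_def)
    have same: "wval (hyp_alg H) v' u = wval (hyp_alg H) v u" if "u \<noteq> {#}" "u \<in> S \<or> u = w" for u
    proof (rule wval_cong[OF comm_ai_hyp v' v that(1)])
      fix n assume "n \<in># u"
      then have "n < k" using S(3) that(2) by (auto simp: letters_below_def)
      then show "v' n = v n" by (simp add: v'_def)
    qed
    have add: "wval (hyp_alg H) v' ({#k#} + u) = hyp_mul H z' (wval (hyp_alg H) v u)" if "u \<noteq> {#}" "u \<in> S \<or> u = w" for u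
    proof -
      have "wval (hyp_alg H) v' ({#k#} + u) = hyp_mul H (v' k) (wval (hyp_alg H) v' u)"
        using that(1) by (simp add: A.wval_add[OF v'] sm)
      then show ?thesis unfolding same[OF that] by (simp add: v'_def)
    qed
    have "wval (hyp_alg H) v' ({#k#} + w) = Top"
    proof (rule hyp_local_Top[OF leaf E k])
      show "E ((+) {#k#} ` S) ({#k#} + w)" by (rule E.mult[OF S(1) _ S(2) e]) simp
      show "good ((+) {#k#} ` S)" using S(1) by (auto simp: good_def)
      show "letters_below (Suc k) ((+) {#k#} ` S) ({#k#} + w)" using lb by (auto simp: letters_below_def)
      show "wval (hyp_alg H) v' u = Top" if "u \<in> (+) {#k#} ` S" for u
        using that add ne val z'(2) by auto
    qed (use v' in auto)
    then have "hyp_mul H z' (wval (hyp_alg H) v w) = Top" using add[OF S(2)] by (simp only: simp_thms)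
    then show ?thesis using z'(2) by blast
  qed
  show "le (hyp_alg H) (wval (hyp_alg H) v w) z"
  proof (cases "z = Inf")
    case False
    then have val: "wval (hyp_alg H) v u = z" if "u \<in> S" for u using z that by (auto simp: le_hyp)
    have "wval (hyp_alg H) v w = z"
    proof (cases z)
      case (Vx x)
      have "hyp_mul H (Co x) y = Top \<longleftrightarrow> y = z" for y unfolding Vx by (cases y) auto
      moreover have "Co x \<in> elems (hyp_alg H)" using zH unfolding Vx by (auto simp: hyp_alg_def)
      ultimately show ?thesis using comp val by blast
    next
      case (Co x)
      have "hyp_mul H (Vx x) y = Top \<longleftrightarrow> y = z" for y unfolding Co by (cases y) auto
      moreover have "Vx x \<in> elems (hyp_alg H)" using zH unfolding Co by (auto simp: hyp_alg_def)
      ultimately show ?thesis using comp val by blast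
    next
      case Top
      show ?thesis unfolding Top by (rule hyp_local_Top[OF leaf E k S(1,2) lb e v]) (use val Top in auto)
    qed (use False in simp)
    then show ?thesis by (simp add: le_hyp)
  qed (simp add: le_hyp)
qed

end

text \<open>The word \<open>w\<close> below repeats every vertex so that it has more than three letters, whatever the number
  of vertices, and hence a value other than \<open>Top\<close>.\<close>

theorem not_finitely_based_hypergraph:
  fixes W :: "'u alg set"
  assumes inf: "infinite (UNIV :: 'u set)" and W: "\<And>A. A \<in> W \<Longrightarrow> comm_ai A" "base_consequence (Ent W)"
    and S70: "\<And>S w. good S \<Longrightarrow> w \<noteq> {#} \<Longrightarrow> ent S70 S w \<Longrightarrow> Ent W S w"
    and n: "\<not> obeys (Ent W) law_ABC"
  shows "\<not> finitely_based W"
proof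
  assume "finitely_based W"
  from finite_basis_criterion[OF inf W(1) this, where ?'b = hyp]
  obtain k where k: "\<forall>B :: hyp alg. comm_ai B \<longrightarrow> finite (elems B) \<longrightarrow>
     (\<forall>S w. good S \<longrightarrow> w \<noteq> {#} \<longrightarrow> letters_below k S w \<longrightarrow> Ent W S w \<longrightarrow> ent B S w) \<longrightarrow>
     (\<forall>S w. good S \<longrightarrow> w \<noteq> {#} \<longrightarrow> Ent W S w \<longrightarrow> ent B S w)" ..
  define K where "K = Suc k * Suc k + 2"
  obtain H :: "nat set set" where H: "finite H" "\<forall>e\<in>H. card e = 3"
    "\<forall>F\<subseteq>H. F \<noteq> {} \<longrightarrow> card F \<le> K \<longrightarrow> (\<exists>e. leaf_edge F e)" and nt: "\<not> (\<exists>A. \<forall>e\<in>H. card (e \<inter> A) = 1)"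
    using local_forest_without_exact_transversal[of K] by blast
  have leaf: "\<exists>e. leaf_edge F e" if "F \<subseteq> H" "F \<noteq> {}" "card F \<le> K" for F using H(3) that by blast
  interpret linear_hypergraph H
  proof
    fix e e' assume ee: "e \<in> H" "e' \<in> H" "e \<noteq> e'"
    have "card {e, e'} \<le> K" using ee(3) by (simp add: K_def)
    then obtain f where "leaf_edge {e, e'} f" using leaf[of "{e, e'}"] ee by auto
    then obtain p where f: "f = e \<or> f = e'" "\<And>g. g \<in> {e, e'} - {f} \<Longrightarrow> f \<inter> g \<subseteq> {p}"
      unfolding leaf_edge_def by blast
    from f(1) have "e \<inter> e' \<subseteq> {p}"
    proof
      assume "f = e" then show ?thesis using f(2)[of e'] ee(3) by simp
    next
      assume "f = e'" then show ?thesis using f(2)[of e] ee(3) by (simp add: Int_commute)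
    qed
    then show "\<exists>p. e \<inter> e' \<subseteq> {p}" ..
  qed (use H in auto)
  define S where "S = mset_set ` H"
  define w where "w = mset_set (\<Union>H) + mset_set (\<Union>H)"
  have fin: "finite e" if "e \<in> H" for e using card_H[OF that] by (metis card.infinite zero_neq_numeral)
  have finU: "finite (\<Union>H)" using H(1) fin by blast
  have "H \<noteq> {}" using nt by blast
  then obtain e0 where e0: "e0 \<in> H" by blast
  have enz: "e \<noteq> {}" if "e \<in> H" for e using card_H[OF that] by auto
  have S: "good S" using H(1) fin enz \<open>H \<noteq> {}\<close> by (auto simp: good_def S_def mset_set_empty_iff)
  have Une: "\<Union>H \<noteq> {}" using e0 enz by blast
  then have w: "w \<noteq> {#}" using finU by (simp add: w_def mset_set_empty_iff)
  have "ent S70 S w"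
  proof (rule ent_S70_no_transversal[OF S w])
    show "set_mset w = \<Union> (set_mset ` S)" using fin finU by (auto simp: w_def S_def)
    fix A :: "nat set"
    obtain e where e: "e \<in> H" "card (e \<inter> A) \<noteq> 1" using nt by blast
    have "size (filter_mset (\<lambda>n. n \<in> A) (mset_set e)) = card (e \<inter> A)"
      using fin[OF e(1)] by (simp add: filter_mset_mset_set Int_def)
    then show "\<exists>u\<in>S. size (filter_mset (\<lambda>n. n \<in> A) u) \<noteq> 1" using e by (intro bexI[of _ "mset_set e"]) (auto simp: S_def)
  qed
  then have "Ent W S w" by (rule S70[OF S w])
  have ent: "ent (hyp_alg H) S w"
  proof (rule k[rule_format, OF comm_ai_hyp finite_hyp])
    show "ent (hyp_alg H) S w" if "good S" "w \<noteq> {#}" "letters_below k S w" "Ent W S w" for S w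
    proof (rule hyp_local[OF leaf W(2) n _ that])
      show "Suc k * Suc k \<le> K" unfolding K_def by (rule le_add1)
    qed
  qed fact+
  define v where "v n = (if n \<in> \<Union>H then Vx n else Inf)" for n
  have v: "range v \<subseteq> elems (hyp_alg H)" by (auto simp: v_def hyp_alg_def)
  have "le (hyp_alg H) (wval (hyp_alg H) v w) Top"
  proof (rule entD[OF ent v])
    fix u assume "u \<in> S"
    then obtain e where e: "e \<in> H" "u = mset_set e" by (auto simp: S_def)
    obtain a b c where abc: "e = {a, b, c}" "a \<noteq> b" "a \<noteq> c" "b \<noteq> c" using edge_cases[OF e(1)] by metis
    have u: "u = {#a, b, c#}" unfolding e(2) abc(1) using abc(2-4) by simp
    have "v a = Vx a" "v b = Vx b" "v c = Vx c" using e(1) abc(1) by (auto simp: v_def)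
    then have "wval (hyp_alg H) v u = Top"
      unfolding u using e(1) abc(1) by (subst wval_hyp_Top[OF v]) auto
    then show "le (hyp_alg H) (wval (hyp_alg H) v u) Top" by (simp add: le_hyp)
  qed (simp add: hyp_alg_def)
  then have "wval (hyp_alg H) v w = Top" by (simp add: le_hyp)
  then have "size w \<le> 3" unfolding wval_hyp_Top[OF v w] by auto
  moreover have "card (\<Union>H) \<ge> 3" using card_mono[OF finU, of e0] card_H[OF e0] e0 by auto
  ultimately show False by (simp add: w_def)
qed

section \<open>The subvarieties of \<open>V(S\<^sub>7\<^sup>0)\<close>\<close>

subsection \<open>Laws of the generating algebras\<close>

lemma wf_laws: "l \<in> set six_laws \<union> {law_ABC, law_path} \<union> set base_laws \<Longrightarrow> wf_law l"
  by (auto simp: six_laws_def law_defs base_laws_def wf_law_def)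

definition four_letters :: "tm \<Rightarrow> bool" where
  "four_letters t \<longleftrightarrow> (\<forall>w\<in>words t. set_mset w \<subseteq> {0, 1, 2, 3})"

lemma eval_four:
  assumes "comm_ai A" "range v \<subseteq> elems A" "four_letters t"
  shows "eval_tm A v t = eval_tm A (asg (v 0) (v 1) (v 2) (v 3)) t"
  using assms(3)
proof (induction t)
  case (Var n)
  then have "n = 0 \<or> n = 1 \<or> n = 2 \<or> n = 3" by (auto simp: four_letters_def)
  then show ?case by (elim disjE) (auto simp: asg_def)
next
  case (Sum s t) then show ?case by (auto simp: four_letters_def)
next
  case (Prod s t)
  have "four_letters s" "four_letters t"
    using Prod.prems words_nonempty[of s] words_nonempty[of t] unfolding four_letters_def by fastforce+
  then show ?case using Prod.IH by simp
qed

text \<open>The laws concern at most four letters, so their validity in a finite algebra is a finite check.\<close>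

lemma obeys_finite:
  assumes A: "comm_ai A" and l: "wf_law l" and four: "four_letters (fst (law_eq l))" "four_letters (snd (law_eq l))"
  shows "obeys (ent A) l \<longleftrightarrow> (\<forall>x\<in>elems A. \<forall>y\<in>elems A. \<forall>z\<in>elems A. \<forall>t\<in>elems A.
     eval_tm A (asg x y z t) (fst (law_eq l)) = eval_tm A (asg x y z t) (snd (law_eq l)))"
proof -
  interpret comm_ai_semiring A by unfold_locales (rule A)
  show ?thesis
    unfolding satisfies_law_eq[OF l, symmetric] satisfies_def
  proof (intro iffI ballI allI impI)
    fix x y z t assume "\<forall>v. range v \<subseteq> elems A \<longrightarrow> eval_tm A v (fst (law_eq l)) = eval_tm A v (snd (law_eq l))"
      "x \<in> elems A" "y \<in> elems A" "z \<in> elems A" "t \<in> elems A"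
    then show "eval_tm A (asg x y z t) (fst (law_eq l)) = eval_tm A (asg x y z t) (snd (law_eq l))"
      by (auto simp: asg_def image_subset_iff)
  next
    fix v :: "nat \<Rightarrow> 'a"
    assume *: "\<forall>x\<in>elems A. \<forall>y\<in>elems A. \<forall>z\<in>elems A. \<forall>t\<in>elems A.
        eval_tm A (asg x y z t) (fst (law_eq l)) = eval_tm A (asg x y z t) (snd (law_eq l))"
      and v: "range v \<subseteq> elems A"
    have "v n \<in> elems A" for n using v by auto
    then show "eval_tm A v (fst (law_eq l)) = eval_tm A v (snd (law_eq l))"
      unfolding eval_four[OF A v four(1)] eval_four[OF A v four(2)] using * by blast
  qed
qed

lemma four_letters_laws:
  assumes "l \<in> set six_laws \<union> {law_ABC, law_path} \<union> set base_laws"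
  shows "four_letters (fst (law_eq l))" "four_letters (snd (law_eq l))"
proof -
  have "set (snd l) \<subseteq> {0, 1, 2, 3}" "\<forall>s\<in>set (fst l). set s \<subseteq> {0, 1, 2, 3}"
    using assms by (auto simp: six_laws_def law_defs base_laws_def)
  then show "four_letters (fst (law_eq l))" "four_letters (snd (law_eq l))"
    using wf_laws[OF assms] by (auto simp: four_letters_def law_eq_def wf_law_def words_sumtm words_prodtm)
qed

lemmas obeys_check = obeys_finite[OF _ wf_laws four_letters_laws]

lemma two_sadd: "sadd D2 = max" "sadd M2 = max" "sadd T2 = max"
  by (simp_all add: D2_def M2_def T2_def)

lemma adjoin_sadd:
  "sadd (adjoin_zero S) None y = y" "sadd (adjoin_zero S) x None = x"
  "sadd (adjoin_zero S) (Some a) (Some b) = Some (sadd S a b)"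
  by (auto simp: adjoin_zero_def split: option.split)

lemma Sab_ops:
  "elems Sab = {SA, SB, SAB, SInf}"
  "sadd Sab x y = (if x = y then x else SInf)"
  "smul Sab x y = (if x = SA \<and> y = SB \<or> x = SB \<and> y = SA then SAB else SInf)"
proof -
  have "x \<in> {SA, SB, SAB, SInf}" for x by (cases x) auto
  then show "elems Sab = {SA, SB, SAB, SInf}" by (auto simp: Sab_def)
qed (simp_all add: Sab_def)

lemma S7_ops:
  "elems S7 = {S7_one, S7_a, S7_inf}" "sadd S7 x y = (if x = y then x else S7_inf)"
proof -
  have "x \<in> {S7_one, S7_a, S7_inf}" for x by (cases x) auto
  then show "elems S7 = {S7_one, S7_a, S7_inf}" by (auto simp: S7_def)
qed (simp add: S7_def)

lemmas check_simps = ex_disj_distrib law_eq_def two_ops two_sadd adjoin_ops adjoin_sadd Sab_ops S7_ops smul_S7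

definition signature :: "(nat multiset set \<Rightarrow> nat multiset \<Rightarrow> bool) \<Rightarrow> bool list" where
  "signature E = map (obeys E) six_laws"

lemma signature_D2: "signature (ent D2) = [False, True, True, True, True, True]"
  by (simp add: signature_def six_laws_def obeys_check[OF comm_ai_D2] law_defs check_simps)

lemma signature_M2: "signature (ent M2) = [True, False, True, True, True, True]"
  by (simp add: signature_def six_laws_def obeys_check[OF comm_ai_M2] law_defs check_simps)

lemma signature_T2: "signature (ent T2) = [True, True, False, True, True, True]"
  by (simp add: signature_def six_laws_def obeys_check[OF comm_ai_T2] law_defs check_simps)

lemma signature_M20: "signature (ent (adjoin_zero M2)) = [False, False, True, False, True, True]"
  by (simp add: signature_def six_laws_def obeys_check[OF comm_ai_adjoin_zero[OF comm_ai_M2]] law_defs check_simps)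

lemma signature_T20: "signature (ent (adjoin_zero T2)) = [False, True, False, True, False, True]"
  by (simp add: signature_def six_laws_def obeys_check[OF comm_ai_adjoin_zero[OF comm_ai_T2]] law_defs check_simps)

lemma signature_Sab: "signature (ent Sab) = [True, True, False, True, True, False]"
  by (simp add: signature_def six_laws_def obeys_check[OF comm_ai_Sab] law_defs check_simps)

lemma ABC_path_laws:
  "obeys (ent M2) law_ABC" "obeys (ent M2) law_path" "obeys (ent Sab) law_ABC" "obeys (ent Sab) law_path"
  by (simp_all add: obeys_check[OF comm_ai_M2] obeys_check[OF comm_ai_Sab] law_defs check_simps)

lemma signature_S70: "signature (ent S70) = [False, False, False, False, False, False]"
  by (simp add: signature_def six_laws_def obeys_check[OF comm_ai_S70] law_defs check_simps)

lemma base_S70: "l \<in> set base_laws \<Longrightarrow> obeys (ent S70) l"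
proof -
  assume l: "l \<in> set base_laws"
  have o: "obeys (ent S70) l \<longleftrightarrow> (\<forall>x\<in>elems S70. \<forall>y\<in>elems S70. \<forall>z\<in>elems S70. \<forall>t\<in>elems S70.
     eval_tm S70 (asg x y z t) (fst (law_eq l)) = eval_tm S70 (asg x y z t) (snd (law_eq l)))"
    by (rule obeys_check[OF comm_ai_S70]) (use l in blast)+
  show ?thesis
    unfolding o using l unfolding base_laws_def list.set
    by (elim insertE emptyE) (simp_all add: check_simps)
qed

subsection \<open>Varieties generated by finite algebras\<close>

definition comm_class :: "'a alg set \<Rightarrow> bool" where
  "comm_class W \<longleftrightarrow> (\<forall>A\<in>W. comm_ai A)"

lemma comm_class_iff:
  assumes "\<And>A. A \<in> W \<Longrightarrow> ai_semiring A"
  shows "comm_class W \<longleftrightarrow> holds_in W comm_eq"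
  using assms satisfies_comm_eq unfolding comm_class_def holds_in_def by blast

lemma comm_ai_copy:
  assumes "comm_ai S" "A \<in> copies S"
  shows "comm_ai A"
proof -
  have "ai_semiring A" using assms(2) by (simp add: copies_def)
  moreover have "satisfies S comm_eq" using assms(1) satisfies_comm_eq[of S] by (simp add: comm_ai_def)
  ultimately show ?thesis using satisfies_copies[OF assms(2)] satisfies_comm_eq by blast
qed

lemma comm_class_Vgen:
  assumes "comm_class K"
  shows "comm_class (Vgen K)"
proof -
  have ai: "ai_semiring A" if "A \<in> K" for A using assms that by (simp add: comm_class_def comm_ai_def)
  then have "ai_semiring A" if "A \<in> Vgen K" for A using variety_ai[OF variety_Vgen(1)] that by blast
  then show ?thesis
    using assms comm_class_iff[of K] comm_class_iff[of "Vgen K"] holds_in_Vgen[of K comm_eq] ai by blast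
qed

lemma Ent_Vgen:
  assumes K: "comm_class K" and S: "good S" "w \<noteq> {#}"
  shows "Ent (Vgen K) S w \<longleftrightarrow> Ent K S w"
proof -
  have ai: "ai_semiring A" if "A \<in> K" for A using K that by (simp add: comm_class_def comm_ai_def)
  have "Ent W S w \<longleftrightarrow> holds_in W (identity_of S w)" if "comm_class W" for W :: "'a alg set"
    using that satisfies_identity_of[OF _ S] unfolding Ent_def holds_in_def comm_class_def by blast
  then show ?thesis using K comm_class_Vgen[OF K] holds_in_Vgen[OF ai] by blast
qed

lemma Ent_copies:
  fixes K :: "'u alg set"
  assumes inf: "infinite (UNIV :: 'u set)" and B: "comm_ai B" "finite (elems B)" and S: "good S" "w \<noteq> {#}"
  shows "Ent (copies B :: 'u alg set) S w \<longleftrightarrow> ent B S w"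
proof -
  have e: "ent A S w \<longleftrightarrow> ent B S w" if A: "A \<in> copies B" for A :: "'u alg"
    using satisfies_copies[OF A] satisfies_identity_of[OF comm_ai_copy[OF B(1) A] S]
      satisfies_identity_of[OF B(1) S] by blast
  obtain A :: "'u alg" where "A \<in> copies B" using copies_nonempty[OF inf _ B(2)] B(1) by (auto simp: comm_ai_def)
  then show ?thesis using e unfolding Ent_def by blast
qed

lemma good_law: "wf_law l \<Longrightarrow> good (mset ` set (fst l)) \<and> mset (snd l) \<noteq> {#}"
  by (auto simp: wf_law_def good_def)

lemma obeys_Vgen: "comm_class K \<Longrightarrow> wf_law l \<Longrightarrow> obeys (Ent (Vgen K)) l \<longleftrightarrow> obeys (Ent K) l"
  unfolding obeys_def using Ent_Vgen good_law by blast

lemma obeys_Un: "obeys (Ent (K \<union> K')) l \<longleftrightarrow> obeys (Ent K) l \<and> obeys (Ent K') l"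
  unfolding obeys_Ent by blast

lemma Ent_mono: "W \<subseteq> V \<Longrightarrow> Ent V S w \<Longrightarrow> Ent W S w"
  unfolding Ent_def by blast

lemma base_consequence_Ent:
  assumes "comm_class W" "\<And>l. l \<in> set base_laws \<Longrightarrow> obeys (Ent W) l"
  shows "base_consequence (Ent W)"
  by (intro base_consequence.intro consequence_Ent base_consequence_axioms.intro)
    (use assms in \<open>auto simp: comm_class_def\<close>)

lemma ent_eq_Ent: "Ent {A} = ent A"
  unfolding Ent_def by auto

interpretation S70: base_consequence "ent S70"
  using base_consequence_Ent[of "{S70}"] base_S70 comm_ai_S70 by (simp add: ent_eq_Ent comm_class_def)

lemma comm_ai_Sc_ab: "comm_ai Sc_ab"
proof -
  have cl: "sadd Sc_ab x y \<in> elems Sc_ab \<and> smul Sc_ab x y \<in> elems Sc_ab"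
    if "x \<in> elems Sc_ab" "y \<in> elems Sc_ab" for x y
  proof
    have "sadd Sc_ab x y = (if x = y then x else None)" by (simp add: Sc_ab_def Sc_def)
    then show "sadd Sc_ab x y \<in> elems Sc_ab" using that by (auto simp: elems_Sc_ab)
    have m: "smul Sc_ab (Some {#La, Lb#}) (Some u) = None" if "u \<noteq> {#}" for u
      using Sc_ab_mul(7)[of u] that by blast
    show "smul Sc_ab x y \<in> elems Sc_ab"
      using that unfolding elems_Sc_ab
      by (elim insertE emptyE) (simp_all add: Sc_ab_mul(1-6,8,9) m)
  qed
  have "ai_semiring Sc_ab"
    by (rule ai_semiring_embed[OF _ Sc_ab_hom(1) _ _ cl])
      (use comm_ai_Sab Sc_ab_hom(2) in \<open>auto simp: comm_ai_def bij_betw_def elems_Sc_ab\<close>)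
  moreover have "satisfies Sab comm_eq" using comm_ai_Sab satisfies_comm_eq[of Sab] by (simp add: comm_ai_def)
  then have "satisfies Sc_ab comm_eq"
    using satisfies_inj[OF calculation Sc_ab_hom(1)] Sc_ab_hom(2) by (simp add: bij_betw_def)
  ultimately show ?thesis using satisfies_comm_eq by blast
qed

lemma ent_Sc_ab: "good S \<Longrightarrow> w \<noteq> {#} \<Longrightarrow> ent Sc_ab S w \<longleftrightarrow> ent Sab S w"
proof -
  assume S: "good S" "w \<noteq> {#}"
  have ai: "ai_semiring Sc_ab" using comm_ai_Sc_ab by (simp add: comm_ai_def)
  have b: "inj_on sab_elem (elems Sc_ab)" "sab_elem ` elems Sc_ab = elems Sab"
    using Sc_ab_hom(2) by (simp_all add: bij_betw_def)
  have "satisfies Sc_ab e \<longleftrightarrow> satisfies Sab e" for e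
    using satisfies_inj[OF ai Sc_ab_hom(1) b(1), of e] satisfies_image[OF ai Sc_ab_hom(1) b(2), of e]
    by (rule iffI[rotated])
  then show ?thesis using satisfies_identity_of[OF comm_ai_Sc_ab S] satisfies_identity_of[OF comm_ai_Sab S] by blast
qed

lemma obeys_Sc_ab: "wf_law l \<Longrightarrow> obeys (ent Sc_ab) l \<longleftrightarrow> obeys (ent Sab) l"
  unfolding obeys_def using ent_Sc_ab good_law by blast

lemma wf_six: "l \<in> set six_laws \<Longrightarrow> wf_law l" using wf_laws by blast

lemma signature_Sc_ab: "signature (ent Sc_ab) = [True, True, False, True, True, False]"
  unfolding signature_Sab[symmetric] signature_def using obeys_Sc_ab wf_six by simp

lemma ABC_path_Sc_ab: "obeys (ent Sc_ab) law_ABC" "obeys (ent Sc_ab) law_path"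
  using obeys_Sc_ab wf_laws ABC_path_laws(3,4) by auto

text \<open>Each generating algebra lies in \<open>V(S\<^sub>7\<^sup>0)\<close> because \<open>S\<^sub>7\<^sup>0\<close> refutes the law split by it.\<close>

lemma generators_in_V:
  assumes S: "good S" "w \<noteq> {#}" and e: "ent S70 S w"
  shows "ent D2 S w" "ent M2 S w" "ent T2 S w" "ent (adjoin_zero M2) S w" "ent (adjoin_zero T2) S w" "ent Sc_ab S w"
proof -
  have n: "\<not> obeys (ent S70) law_D2" "\<not> obeys (ent S70) law_M2" "\<not> obeys (ent S70) law_T2"
    "\<not> obeys (ent S70) law_M20" "\<not> obeys (ent S70) law_T20" "\<not> obeys (ent S70) law_AB"
    using signature_S70 by (simp_all add: signature_def six_laws_def)
  show "ent D2 S w" "ent M2 S w" "ent T2 S w" "ent (adjoin_zero M2) S w" "ent (adjoin_zero T2) S w"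
    using S70.split_D2[OF S e n(1)] S70.split_M2[OF S e n(2)] S70.split_T2[OF S e n(3)]
      S70.split_M20[OF S e n(4)] S70.split_T20[OF S e n(5)] by auto
  show "ent Sc_ab S w"
    using S70.split_AB[OF S e n(6)] ent_Sab_iff[OF S] ent_Sc_ab[OF S] by blast
qed

lemma finite_generators: "finite (elems D2)" "finite (elems M2)" "finite (elems T2)"
  "finite (elems (adjoin_zero M2))" "finite (elems (adjoin_zero T2))" "finite (elems Sc_ab)" "finite (elems S70)"
  by (simp_all add: two_ops adjoin_ops elems_Sc_ab S7_ops)

lemmas comm_generators = comm_ai_D2 comm_ai_M2 comm_ai_T2 comm_ai_adjoin_zero[OF comm_ai_M2]
  comm_ai_adjoin_zero[OF comm_ai_T2] comm_ai_Sc_ab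

lemma comm_class_copies: "comm_ai S \<Longrightarrow> comm_class (copies S)"
  unfolding comm_class_def using comm_ai_copy by blast

subsection \<open>Classification\<close>

lemma law_implications:
  assumes "base_consequence E"
  shows "obeys E law_D2 \<Longrightarrow> obeys E law_M20" "obeys E law_D2 \<Longrightarrow> obeys E law_T20"
    "obeys E law_M2 \<Longrightarrow> obeys E law_M20" "obeys E law_T2 \<Longrightarrow> obeys E law_T20" "obeys E law_T2 \<Longrightarrow> obeys E law_AB"
proof -
  interpret base_consequence E by fact
  show "obeys E law_M20" if "obeys E law_D2"
  proof -
    have "E {{#0, 1#} + {#0, 1#} + {#2#} + {#2#}} ({#0, 1#} + {#0, 1#})" by (rule D2[OF that]) auto
    moreover have "{#0, 1#} + {#0, 1#} + {#2#} + {#2 :: nat#} = {#0, 0, 1, 1, 2, 2#}"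
      "{#0, 1#} + {#0, 1 :: nat#} = {#0, 0, 1, 1#}" by (simp_all add: add_mset_commute)
    ultimately have "E {{#0, 0, 1, 1, 2, 2#}} {#0, 0, 1, 1#}" by (simp only:)
    from mono[OF this, of "{{#0, 0#}, {#0, 0, 1, 1, 2, 2#}}"] show ?thesis
      by (simp add: obeys_def law_M20_def)
  qed
  show "obeys E law_T20" if "obeys E law_D2"
    using that mono[of "{{#0, 0, 1, 1#}}" "{#0, 0#}" "{{#0#}, {#0, 0, 1, 1#}}"]
    by (simp add: obeys_def law_T20_def law_D2_def)
  show "obeys E law_M20" if "obeys E law_M2"
    using that mono[of "{{#0, 0#}}" "{#0, 0, 1, 1#}" "{{#0, 0#}, {#0, 0, 1, 1, 2, 2#}}"]
    by (simp add: obeys_def law_M20_def law_M2_def)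
  show "obeys E law_T20" if "obeys E law_T2"
    using that mono[of "{{#0#}}" "{#0, 0#}" "{{#0#}, {#0, 0, 1, 1#}}"]
    by (simp add: obeys_def law_T20_def law_T2_def)
  show "obeys E law_AB" if "obeys E law_T2"
  proof -
    have "E {{#0, 1#}} ({#0, 1#} + {#0, 1#})" by (rule T2[OF that]) auto
    moreover have "{#0, 1#} + {#0, 1 :: nat#} = {#0, 0, 1, 1#}" by (simp add: add_mset_commute)
    ultimately have "E {{#0, 1#}} {#0, 0, 1, 1#}" by (simp only:)
    then show ?thesis by (simp add: obeys_def law_AB_def)
  qed
qed

text \<open>The signatures compatible with the implications between the laws, in the order in which the
  fifteen varieties are listed.\<close>

definition admissible :: "bool list list" where
  "admissible =
    [[True, True, True, True, True, True],
     [False, True, True, True, True, True],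
     [True, False, True, True, True, True],
     [False, False, True, True, True, True],
     [False, False, True, False, True, True],
     [True, True, False, True, True, True],
     [False, True, False, True, True, True],
     [False, True, False, True, False, True],
     [True, True, False, True, True, False],
     [True, False, False, True, True, True],
     [False, False, False, True, True, True],
     [False, False, False, False, True, True],
     [False, False, False, True, False, True],
     [False, False, False, False, False, True],
     [True, False, False, True, True, False]]"

lemma distinct_admissible: "distinct admissible" "length admissible = 15"
  by (simp_all add: admissible_def)

lemma signature_admissible:
  assumes "base_consequence E" "tame E"
  shows "signature E \<in> set admissible"
proof -
  have "obeys E law_AB \<or> obeys E law_D2"
    using assms(2) base_consequence.path_imp_D2[OF assms(1)] by (auto simp: tame_def)
  then show ?thesis
    using law_implications[OF assms(1)]
    unfolding signature_def six_laws_def admissible_def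
    by (cases "obeys E law_D2"; cases "obeys E law_M2"; cases "obeys E law_T2"; cases "obeys E law_M20";
        cases "obeys E law_T20"; cases "obeys E law_AB") simp_all
qed

locale infinite_universe =
  fixes U :: "'u itself"
  assumes inf: "infinite (UNIV :: 'u set)"
begin

abbreviation V0 :: "'u alg set" where "V0 \<equiv> Vgen (copies S70)"

lemma comm_V0: "comm_class V0"
  by (intro comm_class_Vgen comm_class_copies comm_ai_S70)

lemma Ent_V0: "good S \<Longrightarrow> w \<noteq> {#} \<Longrightarrow> Ent V0 S w \<longleftrightarrow> ent S70 S w"
  using Ent_Vgen[OF comm_class_copies[OF comm_ai_S70]] Ent_copies[OF inf comm_ai_S70 finite_generators(7)] by blast

lemma variety_V0: "variety V0"
  by (rule variety_Vgen) (simp add: copies_def)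

lemma comm_sub: "W \<subseteq> V0 \<Longrightarrow> comm_class W"
  using comm_V0 by (auto simp: comm_class_def)

lemma base_sub:
  assumes "W \<subseteq> V0"
  shows "base_consequence (Ent W)"
proof (rule base_consequence_Ent[OF comm_sub[OF assms]])
  fix l assume l: "l \<in> set base_laws"
  then have "wf_law l" using wf_laws by blast
  then have "obeys (Ent V0) l" using base_S70[OF l] Ent_V0 good_law unfolding obeys_def by blast
  then show "obeys (Ent W) l" using Ent_mono[OF assms] unfolding obeys_def by blast
qed

text \<open>A tame variety is determined by its signature.\<close>

lemma tame_le:
  assumes W: "variety W" "comm_class W" "base_consequence (Ent W)"
    and V: "variety V" "comm_class V" "base_consequence (Ent V)" "tame (Ent V)"
    and s: "\<And>l. l \<in> set six_laws \<Longrightarrow> obeys (Ent W) l \<Longrightarrow> obeys (Ent V) l"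
  shows "V \<subseteq> (W :: 'u alg set)"
  by (rule variety_le_if_Ent[OF inf W(1) _ V(1)])
    (use W V tame_determined[OF V(3,4) W(3) s] in \<open>auto simp: comm_class_def\<close>)

lemma signature_eqD: "signature E = signature E' \<Longrightarrow> l \<in> set six_laws \<Longrightarrow> obeys E l \<longleftrightarrow> obeys E' l"
  by (auto simp: signature_def six_laws_def)

lemma tame_unique:
  assumes "variety W" "W \<subseteq> V0" "tame (Ent W)" "variety V" "V \<subseteq> V0" "tame (Ent V)"
    and "signature (Ent W) = signature (Ent V)"
  shows "W = V"
  using tame_le[of W V] tame_le[of V W] comm_sub base_sub assms signature_eqD[OF assms(7)] by blast

text \<open>The finitely many laws obeyed by a tame variety define a tame variety with the same signature.\<close>

lemma tame_finitely_based:
  assumes W: "variety W" "W \<subseteq> V0" "tame (Ent W)"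
  shows "finitely_based W"
proof -
  define L where "L = {l \<in> set six_laws \<union> {law_ABC, law_path} \<union> set base_laws. obeys (Ent W) l}"
  let ?E = "insert comm_eq (law_eq ` L)"
  let ?M = "models ?E :: 'u alg set"
  have wf: "wf_law l" if "l \<in> L" for l using that wf_laws unfolding L_def by blast
  have cW: "comm_class W" and bW: "base_consequence (Ent W)" using comm_sub base_sub W by auto
  have WM: "W \<subseteq> ?M"
  proof
    fix A assume A: "A \<in> W"
    then have "comm_ai A" "ai_semiring A" using cW by (auto simp: comm_class_def comm_ai_def)
    moreover have "satisfies A (law_eq l)" if "l \<in> L" for l
      using holds_in_law_eq[of W l] cW wf[OF that] that A by (auto simp: comm_class_def L_def holds_in_def)
    ultimately show "A \<in> ?M" using satisfies_comm_eq by (auto simp: models_def)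
  qed
  have cM: "comm_class ?M" unfolding comm_class_def models_def using satisfies_comm_eq by blast
  have LM: "obeys (Ent ?M) l" if "l \<in> L" for l
  proof -
    have "holds_in ?M (law_eq l)" using that by (auto simp: holds_in_def models_def)
    then show ?thesis using holds_in_law_eq[of ?M l] cM wf[OF that] by (auto simp: comm_class_def)
  qed
  have "base_consequence (Ent ?M)"
    by (rule base_consequence_Ent[OF cM]) (use bW LM in \<open>auto simp: L_def dest: base_consequence.base\<close>)
  moreover have "tame (Ent ?M)" using W(3) LM[of law_AB] LM[of law_ABC] LM[of law_path]
    unfolding tame_def L_def six_laws_def by simp blast
  moreover have "obeys (Ent ?M) l" if "l \<in> set six_laws" "obeys (Ent W) l" for l using that LM by (auto simp: L_def)
  ultimately have "?M \<subseteq> W" by (intro tame_le W(1) cW bW variety_models cM)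
  then have "W = ?M" using WM by blast
  moreover have "finite L" by (simp add: L_def)
  ultimately show ?thesis unfolding finitely_based_def models_def by (intro exI[of _ ?E]) auto
qed

lemma finitely_based_tame:
  assumes "W \<subseteq> V0" "finitely_based W"
  shows "tame (Ent W)"
proof -
  have c: "comm_ai A" if "A \<in> W" for A using comm_sub[OF assms(1)] that by (auto simp: comm_class_def)
  have s: "Ent W S w" if "good S" "w \<noteq> {#}" "ent S70 S w" for S w
    using Ent_V0[OF that(1,2)] that(3) Ent_mono[OF assms(1)] by blast
  show ?thesis
    using not_finitely_based_cycle[OF inf c base_sub[OF assms(1)] s]
      not_finitely_based_hypergraph[OF inf c base_sub[OF assms(1)] s] assms(2)
    unfolding tame_def by blast
qed

definition located :: "'u alg set \<Rightarrow> bool list \<Rightarrow> bool" where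
  "located W \<sigma> \<longleftrightarrow> variety W \<and> W \<subseteq> V0 \<and> tame (Ent W) \<and> signature (Ent W) = \<sigma>"

lemma copies_V0:
  assumes "comm_ai B" "finite (elems B)" "\<And>S w. good S \<Longrightarrow> w \<noteq> {#} \<Longrightarrow> ent S70 S w \<Longrightarrow> ent B S w"
  shows "copies B \<subseteq> V0"
proof -
  let ?W = "Vgen (copies B) :: 'u alg set"
  have c: "comm_class (copies B :: 'u alg set)" by (rule comm_class_copies[OF assms(1)])
  then have v: "variety ?W" "copies B \<subseteq> ?W"
    using variety_Vgen[of "copies B :: 'u alg set"] by (auto simp: comm_class_def comm_ai_def)
  have "?W \<subseteq> V0"
  proof (rule variety_le_if_Ent[OF inf variety_V0 _ v(1)])
    show "Ent ?W S w" if "good S" "w \<noteq> {#}" "Ent V0 S w" for S w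
      using assms(3)[OF that(1,2)] that Ent_V0 Ent_Vgen[OF c that(1,2)] Ent_copies[OF inf assms(1,2) that(1,2)] by blast
  qed (use comm_V0 comm_class_Vgen[OF c] in \<open>auto simp: comm_class_def\<close>)
  then show ?thesis using v(2) by blast
qed

lemmas generators_V0 =
  copies_V0[OF comm_generators(1) finite_generators(1) generators_in_V(1)]
  copies_V0[OF comm_generators(2) finite_generators(2) generators_in_V(2)]
  copies_V0[OF comm_generators(3) finite_generators(3) generators_in_V(3)]
  copies_V0[OF comm_generators(4) finite_generators(4) generators_in_V(4)]
  copies_V0[OF comm_generators(5) finite_generators(5) generators_in_V(5)]
  copies_V0[OF comm_generators(6) finite_generators(6) generators_in_V(6)]

lemma obeys_copies:
  "comm_ai B \<Longrightarrow> finite (elems B) \<Longrightarrow> wf_law l \<Longrightarrow> obeys (Ent (copies B :: 'u alg set)) l \<longleftrightarrow> obeys (ent B) l"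
  unfolding obeys_def using Ent_copies[OF inf] good_law by blast

lemma obeys_generators:
  assumes "wf_law l"
  shows "obeys (Ent (copies D2 :: 'u alg set)) l \<longleftrightarrow> obeys (ent D2) l"
    "obeys (Ent (copies M2 :: 'u alg set)) l \<longleftrightarrow> obeys (ent M2) l"
    "obeys (Ent (copies T2 :: 'u alg set)) l \<longleftrightarrow> obeys (ent T2) l"
    "obeys (Ent (copies (adjoin_zero M2) :: 'u alg set)) l \<longleftrightarrow> obeys (ent (adjoin_zero M2)) l"
    "obeys (Ent (copies (adjoin_zero T2) :: 'u alg set)) l \<longleftrightarrow> obeys (ent (adjoin_zero T2)) l"
    "obeys (Ent (copies Sc_ab :: 'u alg set)) l \<longleftrightarrow> obeys (ent Sc_ab) l"
  by (simp_all add: obeys_copies comm_generators finite_generators assms)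

lemma located_Vgen:
  assumes K: "K \<subseteq> V0" and t: "obeys (Ent K) law_AB \<or> obeys (Ent K) law_ABC \<and> obeys (Ent K) law_path"
    and s: "map (obeys (Ent K)) six_laws = \<sigma>"
  shows "located (Vgen K) \<sigma>"
proof -
  have c: "comm_class K" by (rule comm_sub[OF K])
  then have v: "variety (Vgen K)" by (intro variety_Vgen) (auto simp: comm_class_def comm_ai_def)
  have "Vgen K \<subseteq> V0" by (rule Vgen_least[OF variety_V0 K])
  moreover have o: "obeys (Ent (Vgen K)) l \<longleftrightarrow> obeys (Ent K) l" if "l \<in> set six_laws \<union> {law_ABC, law_path}" for l
    using obeys_Vgen[OF c] wf_laws that by blast
  moreover have "tame (Ent (Vgen K))"
    using t o[of law_AB] o[of law_ABC] o[of law_path] by (simp add: tame_def six_laws_def)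
  moreover have "signature (Ent (Vgen K)) = \<sigma>"
    unfolding s[symmetric] signature_def using o by simp
  ultimately show ?thesis using v by (simp add: located_def)
qed

lemma located_trivial: "located trivial_variety [True, True, True, True, True, True]"
proof -
  have triv: "satisfies A e" if "A \<in> trivial_variety" for A :: "'u alg" and e
  proof -
    obtain x where x: "ai_semiring A" "elems A = {x}" using \<open>A \<in> trivial_variety\<close> by (auto simp: trivial_variety_def)
    show ?thesis unfolding satisfies_def
      using eval_closed[OF x(1)] x(2) by (metis singletonD)
  qed
  have eq: "trivial_variety = (models {(Var 0, Var 1)} :: 'u alg set)"
  proof
    show "trivial_variety \<subseteq> (models {(Var 0, Var 1)} :: 'u alg set)"
      using triv by (auto simp: models_def trivial_variety_def)
    show "models {(Var 0, Var 1)} \<subseteq> (trivial_variety :: 'u alg set)"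
    proof
      fix A :: "'u alg" assume A: "A \<in> models {(Var 0, Var 1)}"
      then obtain x where x: "x \<in> elems A" by (auto simp: models_def ai_semiring_def)
      have "y = x" if "y \<in> elems A" for y
      proof -
        have "range (\<lambda>n. if n = 0 then x else y) \<subseteq> elems A" using x that by auto
        moreover have "satisfies A (Var 0, Var 1)" using A by (simp add: models_def)
        ultimately have "eval_tm A (\<lambda>n. if n = 0 then x else y) (Var 0) = eval_tm A (\<lambda>n. if n = 0 then x else y) (Var 1)"
          unfolding satisfies_def fst_conv snd_conv by (elim allE impE)
        then show ?thesis by simp
      qed
      then have "elems A = {x}" using x by blast
      then show "A \<in> trivial_variety" using A by (auto simp: trivial_variety_def models_def)
    qed
  qed
  have v: "variety (trivial_variety :: 'u alg set)" unfolding eq by (rule variety_models)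
  have sub: "trivial_variety \<subseteq> V0"
  proof
    fix A :: "'u alg" assume A: "A \<in> trivial_variety"
    show "A \<in> V0"
      by (rule birkhoff[OF inf variety_V0 _ triv[OF A]]) (use A in \<open>simp add: trivial_variety_def\<close>)
  qed
  have "obeys (Ent (trivial_variety :: 'u alg set)) l" if "l \<in> set six_laws" for l
    using holds_in_law_eq[of "trivial_variety :: 'u alg set" l] comm_sub[OF sub] wf_six[OF that] triv
    by (auto simp: comm_class_def holds_in_def)
  then show ?thesis using v sub by (simp add: located_def tame_def signature_def six_laws_def)
qed

lemmas generator_values =
  signature_D2[unfolded signature_def six_laws_def] signature_M2[unfolded signature_def six_laws_def]
  signature_T2[unfolded signature_def six_laws_def] signature_M20[unfolded signature_def six_laws_def]
  signature_T20[unfolded signature_def six_laws_def] signature_Sc_ab[unfolded signature_def six_laws_def]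

definition listed :: "'u alg set list" where
  "listed =
    [trivial_variety,
     Vgen (copies D2),
     Vgen (copies M2),
     Vgen (copies M2 \<union> copies D2),
     Vgen (copies (adjoin_zero M2)),
     Vgen (copies T2),
     Vgen (copies T2 \<union> copies D2),
     Vgen (copies (adjoin_zero T2)),
     Vgen (copies Sc_ab),
     Vgen (copies M2 \<union> copies T2),
     Vgen (copies M2 \<union> copies T2 \<union> copies D2),
     Vgen (copies (adjoin_zero M2) \<union> copies T2),
     Vgen (copies M2 \<union> copies (adjoin_zero T2)),
     Vgen (copies (adjoin_zero M2) \<union> copies (adjoin_zero T2)),
     Vgen (copies M2 \<union> copies Sc_ab)]"

lemma located_listed: "list_all2 located listed admissible"
proof -
  have wf: "wf_law law_D2" "wf_law law_M2" "wf_law law_T2" "wf_law law_M20" "wf_law law_T20" "wf_law law_AB"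
    "wf_law law_ABC" "wf_law law_path"
    using wf_laws by (auto simp: six_laws_def)
  note simps = six_laws_def obeys_Un obeys_generators wf generators_V0
    ABC_path_laws ABC_path_Sc_ab generator_values[simplified]
  show ?thesis
    unfolding listed_def admissible_def
    by (simp only: list_all2_Cons list_all2_Nil, intro conjI TrueI)
      (rule located_trivial refl | (rule located_Vgen; simp add: simps))+
qed

theorem classification:
  "card (set listed) = 15"
  "{W. subvariety W V0 \<and> finitely_based W} = set listed"
proof -
  have len: "length listed = 15" by (simp add: listed_def)
  have sig: "located (listed ! i) (admissible ! i)" if "i < 15" for i
    using located_listed that len distinct_admissible(2) by (simp add: list_all2_conv_all_nth)
  have "map (\<lambda>W. signature (Ent W)) listed = admissible"
    by (rule nth_equalityI) (use sig len distinct_admissible in \<open>auto simp: located_def\<close>)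
  then have "distinct (map (\<lambda>W. signature (Ent W)) listed)" using distinct_admissible by simp
  then have "distinct listed" by (simp add: distinct_map)
  then show "card (set listed) = 15" using len by (simp add: distinct_card)
  show "{W. subvariety W V0 \<and> finitely_based W} = set listed"
  proof
    show "set listed \<subseteq> {W. subvariety W V0 \<and> finitely_based W}"
    proof
      fix W assume "W \<in> set listed"
      then obtain i where "i < 15" "W = listed ! i" using len by (metis in_set_conv_nth)
      then have "located W (admissible ! i)" using sig by simp
      then show "W \<in> {W. subvariety W V0 \<and> finitely_based W}"
        using tame_finitely_based variety_V0 by (auto simp: located_def subvariety_def)
    qed
    show "{W. subvariety W V0 \<and> finitely_based W} \<subseteq> set listed"
    proof
      fix W assume "W \<in> {W. subvariety W V0 \<and> finitely_based W}"
      then have W: "variety W" "W \<subseteq> V0" "finitely_based W" by (auto simp: subvariety_def)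
      have t: "tame (Ent W)" by (rule finitely_based_tame[OF W(2,3)])
      have "signature (Ent W) \<in> set admissible" by (rule signature_admissible[OF base_sub[OF W(2)] t])
      then obtain i where i: "i < 15" "signature (Ent W) = admissible ! i"
        using distinct_admissible(2) by (metis in_set_conv_nth)
      have "located (listed ! i) (admissible ! i)" by (rule sig[OF i(1)])
      then have "W = listed ! i"
        using tame_unique[OF W(1,2) t, of "listed ! i"] i(2) by (auto simp: located_def)
      then show "W \<in> set listed" using i(1) len by simp
    qed
  qed
qed

end

theorem theorem3p34:
  assumes "infinite (UNIV :: 'u set)"
  shows "let L :: 'u alg set set =
           {trivial_variety,
            Vgen (copies D2),
            Vgen (copies M2),
            Vgen (copies M2 \<union> copies D2),
            Vgen (copies (adjoin_zero M2)),
            Vgen (copies T2),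
            Vgen (copies T2 \<union> copies D2),
            Vgen (copies (adjoin_zero T2)),
            Vgen (copies Sc_ab),
            Vgen (copies M2 \<union> copies T2),
            Vgen (copies M2 \<union> copies T2 \<union> copies D2),
            Vgen (copies (adjoin_zero M2) \<union> copies T2),
            Vgen (copies M2 \<union> copies (adjoin_zero T2)),
            Vgen (copies (adjoin_zero M2) \<union> copies (adjoin_zero T2)),
            Vgen (copies M2 \<union> copies Sc_ab)}
         in card L = 15 \<and>
            {W. subvariety W (Vgen (copies (adjoin_zero S7))) \<and> finitely_based W} = L \<and>
            (\<forall>W. subvariety W (Vgen (copies (adjoin_zero S7))) \<and> W \<notin> L \<longrightarrow>
                 nonfinitely_based W)"
proof -
  interpret infinite_universe "TYPE('u)" by unfold_locales (rule assms)
  note c = classification[unfolded listed_def list.set]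
  show ?thesis
    unfolding Let_def nonfinitely_based_def
  proof (intro conjI allI impI c)
    fix W :: "'u alg set"
    assume W: "subvariety W V0 \<and> W \<notin> {trivial_variety, Vgen (copies D2), Vgen (copies M2),
      Vgen (copies M2 \<union> copies D2), Vgen (copies (adjoin_zero M2)), Vgen (copies T2),
      Vgen (copies T2 \<union> copies D2), Vgen (copies (adjoin_zero T2)), Vgen (copies Sc_ab),
      Vgen (copies M2 \<union> copies T2), Vgen (copies M2 \<union> copies T2 \<union> copies D2),
      Vgen (copies (adjoin_zero M2) \<union> copies T2), Vgen (copies M2 \<union> copies (adjoin_zero T2)),
      Vgen (copies (adjoin_zero M2) \<union> copies (adjoin_zero T2)), Vgen (copies M2 \<union> copies Sc_ab)}"
    then have "W \<notin> {W. subvariety W V0 \<and> finitely_based W}" unfolding c(2) by (rule conjunct2)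
    then show "\<not> finitely_based W" using W by simp
  qed
qed

end
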